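(* Consider the minimization problem (M), the parameter assumptions, and the iteration (Algorithm M) described in the context. Suppose that $$(\forall k\in K)\quad\operatorname{epi}(g_k+\psi_k)+\operatorname{epi}h_k\ \text{ is closed}$$ and that problem (M) admits a Kuhn--Tucker point, that is, there exist $\widetilde{\boldsymbol x}\in\boldsymbol{\mathcal H}$ and $\widetilde{\boldsymbol v}^*\in\boldsymbol{\mathcal G}$ such that, for all $i\in I$ and $k\in K$, $$-\sum_{j\in K}L_{ji}^*\widetilde v_j^*\in\partial f_i(\widetilde x_i)+\nabla\varphi_i(\widetilde x_i)+\nabla_{\!i}\,\Theta(\widetilde{\boldsymbol x})\quad\text{and}\quad\sum_{j\in I}L_{kj}\widetilde x_j\in\partial\big(g_k^*\,\square\,\psi_k^*\big)(\widetilde v_k^* )+\partial h_k^*(\widetilde v_k^* ).$$ Let $(x_{i,n})_{n\in\mathbb N}$ and $(a_{i,n})_{n\in\mathbb N}$, $i\in I$, be generated by Algorithm M. Then there exists a solution $\overline{\boldsymbol x}$ to (M) such that, for every $i\in I$, $x_{i,n}\rightharpoonup\overline x_i$ and $a_{i,n}\rightharpoonup\overline x_i$ (weak convergence).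
   Context: Notation. $\Gamma_0(\mathcal K)$ is the class of proper lower semicontinuous convex functions $f\colon\mathcal K\to(-\infty,+\infty]$ on a real Hilbert space $\mathcal K$; $f^*$ is the conjugate of $f$, $\partial f$ its subdifferential, $\operatorname{epi}f$ its epigraph, and $\operatorname{prox}_fx$ the unique minimizer of $f+\frac12\|\cdot-x\|^2$. The infimal convolution is $(f\,\square\,h)(x)=\inf_{y\in\mathcal K}(f(y)+h(x-y))$. $\nabla_{\!i}\,\Theta$ is the partial gradient of $\Theta\colon\boldsymbol{\mathcal H}\to\mathbb R$ relative to $\mathcal H_i$. $\mathbb N=\{0,1,2,\dots\}$. Bold letters denote product space elements, e.g. $\boldsymbol x_n=(x_{i,n})_{i\in I}$. Problem (M). $(\mathcal H_i)_{i\in I}$ and $(\mathcal G_k)_{k\in K}$ are finite families of real Hilbert spaces, $\boldsymbol{\mathcal H}=\bigoplus_{i\in I}\mathcal H_i$, $\boldsymbol{\mathcal G}=\bigoplus_{k\in K}\mathcal G_k$. For every $i\in I$, $k\in K$: $f_i\in\Gamma_0(\mathcal H_i)$; $\alpha_i\in(0,+\infty)$ and $\varphi_i\colon\mathcal H_i\to\mathbb R$ is convex and differentiable with a $(1/\alpha_i)$-Lipschitzian gradient; $g_k,h_k\in\Gamma_0(\mathcal G_k)$; $\beta_k\in(0,+\infty)$ and $\psi_k\colon\mathcal G_k\to\mathbb R$ is convex and differentiable with a $(1/\beta_k)$-Lipschitzian gradient; $L_{ki}\colon\mathcal H_i\to\mathcal G_k$ is linear and bounded. $\chi\in[0,+\infty)$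 and $\Theta\colon\boldsymbol{\mathcal H}\to\mathbb R$ is convex and differentiable with a $\chi$-Lipschitzian gradient. Problem (M) is $$\underset{\boldsymbol x\in\boldsymbol{\mathcal H}}{\text{minimize}}\quad\Theta(\boldsymbol x)+\sum_{i\in I}\big(f_i(x_i)+\varphi_i(x_i)\big)+\sum_{k\in K}\big((g_k+\psi_k)\,\square\,h_k\big)\Big(\sum_{j\in I}L_{kj}x_j\Big).$$ Parameter assumptions. $\alpha=\min\{\alpha_i,\beta_k\}_{i\in I,k\in K}$, $\sigma\in(1/(4\alpha),+\infty)$, $\varepsilon\in(0,\min\{1,1/(\chi+\sigma)\})$. For all $i\in I$, $k\in K$, $n\in\mathbb N$: $\gamma_{i,n}\in[\varepsilon,1/(\chi+\sigma)]$, $\mu_{k,n},\nu_{k,n}\in[\varepsilon,1/\sigma]$, $\sigma_{k,n}\in[\varepsilon,1/\varepsilon]$, $\lambda_n\in[\varepsilon,2-\varepsilon]$. $\boldsymbol x_0\in\boldsymbol{\mathcal H}$ and $\boldsymbol y_0,\boldsymbol z_0,\boldsymbol v_0^*\in\boldsymbol{\mathcal G}$. Block selection: $P\in\mathbb N$; $(I_n)_{n\in\mathbb N}$ are nonempty subsets of $I$ and $(K_n)_{n\in\mathbb N}$ nonempty subsets of $K$ with $I_0=I$, $K_0=K$, and, for every $n$, $\bigcup_{j=n}^{n+P}I_j=I$ and $\bigcup_{j=n}^{n+P}K_j=K$. Delays: $T\in\mathbb N$; for all $i\in I$, $k\in K$, $(\pi_i(n))_{n\in\mathbb N}$ and $(\omega_k(n))_{n\in\mathbb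 N}$ are sequences in $\mathbb N$ with $n-T\le\pi_i(n)\le n$ and $n-T\le\omega_k(n)\le n$ for every $n$. Algorithm M. For $n=0,1,\dots$: 1. For every $i\in I_n$, writing $\pi=\pi_i(n)$: $l_{i,n}^*=\nabla_{\!i}\,\Theta(\boldsymbol x_\pi)+\sum_{k\in K}L_{ki}^*v_{k,\pi}^*$; $a_{i,n}=\operatorname{prox}_{\gamma_{i,\pi}f_i}\big(x_{i,\pi}-\gamma_{i,\pi}(l_{i,n}^*+\nabla\varphi_i(x_{i,\pi}))\big)$; $a_{i,n}^*=\gamma_{i,\pi}^{-1}(x_{i,\pi}-a_{i,n})-l_{i,n}^*$; $\xi_{i,n}=\|a_{i,n}-x_{i,\pi}\|^2$. 2. For every $i\in I\smallsetminus I_n$: $a_{i,n}=a_{i,n-1}$, $a_{i,n}^*=a_{i,n-1}^*$, $\xi_{i,n}=\xi_{i,n-1}$. 3. For every $k\in K_n$, writing $\omega=\omega_k(n)$: $b_{k,n}=\operatorname{prox}_{\mu_{k,\omega}g_k}\big(y_{k,\omega}+\mu_{k,\omega}(v_{k,\omega}^*-\nabla\psi_k(y_{k,\omega}))\big)$; $d_{k,n}=\operatorname{prox}_{\nu_{k,\omega}h_k}\big(z_{k,\omega}+\nu_{k,\omega}v_{k,\omega}^*\big)$; $e_{k,n}^*=\sigma_{k,\omega}\big(\sum_{i\in I}L_{ki}x_{i,\omega}-y_{k,\omega}-z_{k,\omega}\big)+v_{k,\omega}^*$; $q_{k,n}^*=\mu_{k,\omega}^{-1}(y_{k,\omega}-b_{k,n})+v_{k,\omega}^*-e_{k,n}^*$;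 $t_{k,n}^*=\nu_{k,\omega}^{-1}(z_{k,\omega}-d_{k,n})+v_{k,\omega}^*-e_{k,n}^*$; $\eta_{k,n}=\|b_{k,n}-y_{k,\omega}\|^2+\|d_{k,n}-z_{k,\omega}\|^2$. 4. For every $k\in K\smallsetminus K_n$: $b_{k,n},d_{k,n},e_{k,n}^*,q_{k,n}^*,t_{k,n}^*,\eta_{k,n}$ are set equal to their values at index $n-1$. 5. For every $k\in K$: $e_{k,n}=b_{k,n}+d_{k,n}-\sum_{i\in I}L_{ki}a_{i,n}$. For every $i\in I$: $p_{i,n}^*=a_{i,n}^*+\nabla_{\!i}\,\Theta(\boldsymbol a_n)+\sum_{k\in K}L_{ki}^*e_{k,n}^*$. 6. $\Delta_n=-(4\alpha)^{-1}\big(\sum_{i\in I}\xi_{i,n}+\sum_{k\in K}\eta_{k,n}\big)+\sum_{i\in I}\langle x_{i,n}-a_{i,n}\mid p_{i,n}^*\rangle+\sum_{k\in K}\big(\langle y_{k,n}-b_{k,n}\mid q_{k,n}^*\rangle+\langle z_{k,n}-d_{k,n}\mid t_{k,n}^*\rangle+\langle e_{k,n}\mid v_{k,n}^*-e_{k,n}^*\rangle\big)$. 7. If $\Delta_n>0$: $\theta_n=\lambda_n\Delta_n\big/\big(\sum_{i\in I}\|p_{i,n}^*\|^2+\sum_{k\in K}(\|q_{k,n}^*\|^2+\|t_{k,n}^*\|^2+\|e_{k,n}\|^2)\big)$ and, for all $i\in I$, $k\in K$, $x_{i,n+1}=x_{i,n}-\theta_np_{i,n}^*$, $y_{k,n+1}=y_{k,n}-\theta_nq_{k,n}^*$,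 $z_{k,n+1}=z_{k,n}-\theta_nt_{k,n}^*$, $v_{k,n+1}^*=v_{k,n}^*-\theta_ne_{k,n}$. Otherwise: $x_{i,n+1}=x_{i,n}$, $y_{k,n+1}=y_{k,n}$, $z_{k,n+1}=z_{k,n}$, $v_{k,n+1}^*=v_{k,n}^*$ for all $i\in I$, $k\in K$. *)

theory Defs
  imports "HOL-Analysis.Analysis"
begin

text \<open>
  A family of possibly different real Hilbert spaces is represented by complete linear subspaces of
  one ambient inner product space. Every finite family of Hilbert spaces arises in this way, as the
  summands of its own direct sum. All notions below are relative to such a subspace \<open>V\<close>: values of
  functions outside \<open>V\<close> never matter.
\<close>

definition hilbert_space :: "'a::real_inner set \<Rightarrow> bool" where
  "hilbert_space V \<longleftrightarrow> subspace V \<and> complete V"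

text \<open>The type \<open>'a ^ 'i\<close> carries the \<open>\<ell>\<^sup>2\<close> inner product, so this is the Hilbert direct sum.\<close>

definition hilbert_sum :: "('i::finite \<Rightarrow> 'a::real_inner set) \<Rightarrow> ('a ^ 'i) set" where
  "hilbert_sum H = {x. \<forall>i. x $ i \<in> H i}"

definition bounded_linear_between ::
    "'a::real_inner set \<Rightarrow> 'b::real_inner set \<Rightarrow> ('a \<Rightarrow> 'b) \<Rightarrow> bool" where
  "bounded_linear_between V W L \<longleftrightarrow>
     (\<forall>x\<in>V. L x \<in> W) \<and>
     (\<forall>x\<in>V. \<forall>y\<in>V. L (x + y) = L x + L y) \<and>
     (\<forall>r. \<forall>x\<in>V. L (r *\<^sub>R x) = r *\<^sub>R L x) \<and>
     (\<exists>B. \<forall>x\<in>V. norm (L x) \<le> B * norm x)"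

definition adjoint_on :: "'a::real_inner set \<Rightarrow> ('a \<Rightarrow> 'b::real_inner) \<Rightarrow> 'b \<Rightarrow> 'a" where
  "adjoint_on V L y = (THE u. u \<in> V \<and> (\<forall>x\<in>V. inner (L x) y = inner x u))"

definition gradient_on :: "'a::real_inner set \<Rightarrow> ('a \<Rightarrow> real) \<Rightarrow> 'a \<Rightarrow> 'a" where
  "gradient_on V \<phi> x = (THE u. u \<in> V \<and> (\<phi> has_derivative (\<lambda>t. inner u t)) (at x within V))"

definition partial_gradient ::
    "('i::finite \<Rightarrow> 'a::real_inner set) \<Rightarrow> ('a ^ 'i \<Rightarrow> real) \<Rightarrow> 'i \<Rightarrow> 'a ^ 'i \<Rightarrow> 'a" where
  "partial_gradient H \<Theta> i x =
     gradient_on (H i) (\<lambda>t. \<Theta> (\<chi> j. if j = i then t else x $ j)) (x $ i)"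

text \<open>Unlike the library's \<open>epigraph\<close>, this one is for extended-real-valued functions.\<close>

definition epi :: "'a set \<Rightarrow> ('a \<Rightarrow> ereal) \<Rightarrow> ('a \<times> real) set" where
  "epi V f = {(x, r). x \<in> V \<and> f x \<le> ereal r}"

definition Gamma0 :: "'a::real_inner set \<Rightarrow> ('a \<Rightarrow> ereal) set" where
  "Gamma0 V = {f.
     (\<forall>x\<in>V. f x \<noteq> -\<infinity>) \<and> (\<exists>x\<in>V. f x \<noteq> \<infinity>) \<and>
     (\<forall>x\<in>V. f x \<le> Liminf (at x within V) f) \<and>
     convex (epi V f)}"

definition conjugate :: "'a::real_inner set \<Rightarrow> ('a \<Rightarrow> ereal) \<Rightarrow> 'a \<Rightarrow> ereal" where
  "conjugate V f u = (SUP x\<in>V. ereal (inner x u) - f x)"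

definition subdifferential :: "'a::real_inner set \<Rightarrow> ('a \<Rightarrow> ereal) \<Rightarrow> 'a \<Rightarrow> 'a set" where
  "subdifferential V f x = {u \<in> V. \<forall>y\<in>V. ereal (inner (y - x) u) + f x \<le> f y}"

definition inf_conv ::
    "'a::real_inner set \<Rightarrow> ('a \<Rightarrow> ereal) \<Rightarrow> ('a \<Rightarrow> ereal) \<Rightarrow> 'a \<Rightarrow> ereal" where
  "inf_conv V f h x = (INF y\<in>V. f y + h (x - y))"

definition prox :: "'a::real_inner set \<Rightarrow> ('a \<Rightarrow> ereal) \<Rightarrow> 'a \<Rightarrow> 'a" where
  "prox V f x =
     (THE p. is_arg_min (\<lambda>y. f y + ereal ((norm (y - x))\<^sup>2 / 2)) (\<lambda>y. y \<in> V) p)"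

definition converges_weakly :: "'a::real_inner set \<Rightarrow> (nat \<Rightarrow> 'a) \<Rightarrow> 'a \<Rightarrow> bool" where
  "converges_weakly V x l \<longleftrightarrow> (\<forall>u\<in>V. (\<lambda>n. inner (x n) u) \<longlonglongrightarrow> inner l u)"

end

theory Submission
  imports Defs "HOL-Library.Diagonal_Subsequence"
begin

text \<open>
  Write \<open>w = (x, y, z)\<close>, let \<open>F w = (\<Sum>i. f i x\<^sub>i) + (\<Sum>k. g k y\<^sub>k) + (\<Sum>k. h k z\<^sub>k)\<close> collect the functions that
  are accessed through their proximal points, let \<open>S\<close> be the sum of \<open>\<Theta>\<close>, the \<open>\<phi> i\<close> and the \<open>\<psi> k\<close>, and put
  \<open>M (x, y, z) = L x - y - z\<close>. Splitting each infimal convolution turns the problem into the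
  minimization of \<open>F + S\<close> on the kernel of \<open>M\<close>. Its saddle points \<open>(w, v)\<close>, the set \<open>KT\<close> below, are
  characterised by \<open>M w = 0\<close> and \<open>- M\<^sup>* v - C w - R w \<in> \<partial>F w\<close>, where the gradient of \<open>S\<close> is \<open>C + R\<close>: the
  gradients of the \<open>\<phi> i\<close> and \<open>\<psi> k\<close> form \<open>C\<close>, that of \<open>\<Theta>\<close> is \<open>R\<close>. A Kuhn-Tucker point yields a saddle point because
  a proper lower semicontinuous convex function is the supremum of its affine minorants
  (\<open>KT_from_Kuhn_Tucker\<close>); conversely the \<open>x\<close>-part of every saddle point is a solution
  (\<open>KT_minimizer\<close>). So it suffices that the iterates \<open>(w\<^sub>n, v\<^sub>n)\<close> converge weakly to a saddle point.

  This is a projection argument. The proximal points computed at step \<open>n\<close> give an element of the graph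
  of \<open>\<partial>F\<close>, and monotonicity places all saddle points in a half-space (\<open>half_space\<close>). The gradients
  in \<open>C\<close> are evaluated at the points from which the proximal points are computed, not at the latter; since \<open>C\<close> is cocoercive (\<open>Baillon_Haddad\<close>), this costs
  only the term \<open>(4\<alpha>)\<^sup>-\<^sup>1 (\<Sum>\<xi> + \<Sum>\<eta>)\<close>. The number \<open>\<Delta> n\<close> measures by how much the current iterate violates the half-space,
  and the update is a relaxed projection onto it. Hence the iterates are Fejer monotone with respect
  to \<open>KT\<close>: they are bounded and consecutive differences vanish (\<open>projection_step\<close>). Every block is
  refreshed at least once in \<open>P + 1\<close> steps from data at most \<open>T\<close> steps old, so after the differences
  have become small the blocks and the delays perturb the step by a vanishing error only.

  Up to that error \<open>\<Delta> n\<close> is bounded below by \<open>(\<sigma> - 1/(4\<alpha>)) \<parallel>w\<^sub>n - a\<^sub>n\<parallel>\<^sup>2 + \<epsilon> \<parallel>M w\<^sub>n\<parallel>\<^sup>2\<close>, where \<open>a\<^sub>n\<close>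
  collects the proximal points, whereas Fejer monotonicity drives the positive part of \<open>\<Delta> n\<close> to zero. Thus
  \<open>w\<^sub>n - a\<^sub>n\<close>, \<open>M w\<^sub>n\<close> and the normal vectors of the half-spaces tend to zero (\<open>weak_convergence\<close>). Weak lower semicontinuity of \<open>F\<close>
  then makes every weak cluster point of \<open>(w\<^sub>n, v\<^sub>n)\<close> a saddle point (\<open>cluster_point_KT\<close>), and Opial's lemma
  turns this into weak convergence.
\<close>

section \<open>Proximal points and affine minorants\<close>

lemma Gamma0_not_MInfty: "f \<in> Gamma0 V \<Longrightarrow> x \<in> V \<Longrightarrow> f x \<noteq> -\<infinity>"
  by (auto simp: Gamma0_def)

lemma Gamma0_proper:
  assumes "f \<in> Gamma0 V"
  obtains x r where "x \<in> V" "f x = ereal r"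
  using assms unfolding Gamma0_def by (smt (verit) ereal_cases mem_Collect_eq)

lemma Gamma0_convex:
  assumes "f \<in> Gamma0 V" "x \<in> V" "y \<in> V" "f x \<le> ereal r" "f y \<le> ereal s" "0 \<le> t" "t \<le> 1"
  shows "f ((1 - t) *\<^sub>R x + t *\<^sub>R y) \<le> ereal ((1 - t) * r + t * s)"
proof -
  have "convex (epi V f)" "(x, r) \<in> epi V f" "(y, s) \<in> epi V f"
    using assms by (auto simp: Gamma0_def epi_def)
  then have "(1 - t) *\<^sub>R (x, r) + t *\<^sub>R (y, s) \<in> epi V f"
    using assms by (intro convexD) auto
  then show ?thesis by (auto simp: epi_def)
qed

text \<open>The epigraph is sequentially closed: the form in which lower semicontinuity is used.\<close>
lemma Gamma0_closed:
  assumes f: "f \<in> Gamma0 V" and "x \<in> V" "\<And>n. u n \<in> V" "u \<longlonglongrightarrow> x"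
    and le: "\<And>n. f (u n) \<le> ereal (r n)" and r: "r \<longlonglongrightarrow> s"
  shows "f x \<le> ereal s"
proof (rule ccontr)
  assume "\<not> f x \<le> ereal s"
  then obtain c where c: "ereal s < ereal c" "ereal c < f x"
    by (metis ereal_dense2 not_le)
  have "f x \<le> Liminf (at x within V) f" using f \<open>x \<in> V\<close> by (auto simp: Gamma0_def)
  then have "eventually (\<lambda>y. ereal c < f y) (at x within V)"
    using c(2) by (intro less_LiminfD) auto
  then have "eventually (\<lambda>y. y \<in> V \<longrightarrow> ereal c < f y) (nhds x)"
    unfolding eventually_at_filter using c(2) by (auto elim!: eventually_mono)
  then have "eventually (\<lambda>n. u n \<in> V \<longrightarrow> ereal c < f (u n)) sequentially"
    using \<open>u \<longlonglongrightarrow> x\<close> by (auto simp: filterlim_iff)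
  moreover have "eventually (\<lambda>n. r n < c) sequentially"
    using r c(1) by (auto intro: order_tendstoD)
  ultimately have "eventually (\<lambda>n. False) sequentially"
  proof eventually_elim
    case (elim n)
    then show ?case using le[of n] assms(3)[of n]
      by (metis less_ereal.simps(1) order.strict_trans not_le)
  qed
  then show False by simp
qed

text \<open>
  Lower semicontinuity bounds \<open>f\<close> below on a small ball around a point of its domain; convexity along
  rays from that point propagates the bound with at most linear decay.
\<close>
lemma Gamma0_minorant:
  assumes V: "subspace V" and f: "f \<in> Gamma0 V"
  shows "\<exists>c m. m \<ge> 0 \<and> (\<forall>y\<in>V. ereal (c - m * norm (y - u)) \<le> f y)"
proof -
  obtain x0 f0 where x0: "x0 \<in> V" "f x0 = ereal f0" using Gamma0_proper[OF f] .
  have "ereal (f0 - 1) < Liminf (at x0 within V) f"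
    using f x0 by (auto simp: Gamma0_def intro: less_le_trans[of _ "f x0"])
  then have "eventually (\<lambda>y. ereal (f0 - 1) < f y) (at x0 within V)"
    by (rule less_LiminfD)
  then obtain \<delta> where \<delta>: "\<delta> > 0"
    "\<And>y. y \<in> V \<Longrightarrow> y \<noteq> x0 \<Longrightarrow> dist y x0 < \<delta> \<Longrightarrow> ereal (f0 - 1) < f y"
    unfolding eventually_at by blast
  have *: "ereal (f0 - 1 - 2 / \<delta> * norm (y - x0)) \<le> f y" if y: "y \<in> V" for y
  proof (cases "norm (y - x0) < \<delta>")
    case True
    have "ereal (f0 - 1) \<le> f y"
      using \<delta>(2)[OF y] x0 True by (cases "y = x0") (auto simp: dist_norm less_imp_le)
    moreover have "ereal (f0 - 1 - 2 / \<delta> * norm (y - x0)) \<le> ereal (f0 - 1)"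
      using \<delta>(1) by simp
    ultimately show ?thesis by (rule order_trans[rotated])
  next
    case False
    define t where "t = \<delta> / (2 * norm (y - x0))"
    have n: "norm (y - x0) > 0" using False \<delta>(1) by linarith
    have t: "0 < t" "t \<le> 1" using False \<delta>(1) n by (auto simp: t_def field_simps)
    show ?thesis
    proof (rule ereal_le_real)
      fix r assume r: "f y \<le> ereal r"
      let ?z = "(1 - t) *\<^sub>R x0 + t *\<^sub>R y"
      have z: "?z \<in> V" using V x0 y by (simp add: subspace_add subspace_scale)
      have "?z - x0 = t *\<^sub>R (y - x0)" by (simp add: algebra_simps)
      then have nz: "norm (?z - x0) = \<delta> / 2" using t n \<delta>(1) by (simp add: t_def)
      then have "ereal (f0 - 1) < f ?z"
        using \<delta> z by (intro \<delta>(2)) (auto simp: dist_norm)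
      also have "f ?z \<le> ereal ((1 - t) * f0 + t * r)"
        using Gamma0_convex[OF f x0(1) y _ r, of f0 t] x0 t by auto
      finally have "t * (f0 - r) \<le> 1" by (simp add: algebra_simps)
      then have "f0 - r \<le> 2 / \<delta> * norm (y - x0)"
        using n \<delta>(1) by (simp add: t_def field_simps)
      then show "ereal (f0 - 1 - 2 / \<delta> * norm (y - x0)) \<le> ereal r" by simp
    qed
  qed
  show ?thesis
  proof (intro exI conjI ballI)
    show "0 \<le> 2 / \<delta>" using \<delta>(1) by simp
    fix y assume y: "y \<in> V"
    have "norm (y - x0) \<le> norm (y - u) + norm (u - x0)"
      using norm_triangle_ineq[of "y - u" "u - x0"] by simp
    then have "2 / \<delta> * norm (y - x0) \<le> 2 / \<delta> * (norm (y - u) + norm (u - x0))"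
      using \<delta>(1) by (intro mult_left_mono) auto
    then have "ereal ((f0 - 1 - 2 / \<delta> * norm (u - x0)) - 2 / \<delta> * norm (y - u))
      \<le> ereal (f0 - 1 - 2 / \<delta> * norm (y - x0))" by (simp add: algebra_simps)
    then show "ereal ((f0 - 1 - 2 / \<delta> * norm (u - x0)) - 2 / \<delta> * norm (y - u)) \<le> f y"
      using *[OF y] by (rule order_trans)
  qed
qed

lemma DERIV_along_line:
  assumes V: "subspace V" and "x \<in> V" "d \<in> V"
    and S: "(S has_derivative (\<lambda>w. inner u w)) (at (x + t *\<^sub>R d) within V)"
  shows "((\<lambda>s. S (x + s *\<^sub>R d)) has_real_derivative inner u d) (at t)"
proof -
  have "((\<lambda>s. S (x + s *\<^sub>R d)) has_derivative (\<lambda>s. inner u (s *\<^sub>R d))) (at t within UNIV)"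
  proof (rule has_derivative_in_compose[where f = "\<lambda>s. x + s *\<^sub>R d"])
    show "((\<lambda>s. x + s *\<^sub>R d) has_derivative (\<lambda>s. s *\<^sub>R d)) (at t)"
      by (auto intro!: derivative_eq_intros)
    show "(S has_derivative (\<lambda>w. inner u w)) (at (x + t *\<^sub>R d) within (\<lambda>s. x + s *\<^sub>R d) ` UNIV)"
      using assms by (intro has_derivative_subset[OF S]) (auto simp: subspace_add subspace_scale)
  qed
  then show ?thesis
    by (auto simp: has_field_derivative_def mult.commute elim!: has_derivative_eq_rhs)
qed

text \<open>
  The sum rule for a convex and a differentiable function: at a minimizer of \<open>f + S\<close>, moving
  towards \<open>y\<close> by the fraction \<open>t\<close> changes \<open>f\<close> by at most \<open>t (f y - f x)\<close>, so dividing by \<open>t\<close> and letting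
  \<open>t \<rightarrow> 0\<close> compares that difference with the directional derivative of \<open>S\<close>.
\<close>
lemma minimizer_convex_plus_smooth:
  assumes V: "subspace V" and x: "x \<in> V" and fx: "f x = ereal c"
    and conv: "\<And>y r t. y \<in> V \<Longrightarrow> f y \<le> ereal r \<Longrightarrow> 0 \<le> t \<Longrightarrow> t \<le> 1 \<Longrightarrow>
      f ((1 - t) *\<^sub>R x + t *\<^sub>R y) \<le> ereal ((1 - t) * c + t * r)"
    and S: "(S has_derivative (\<lambda>w. inner u w)) (at x within V)"
    and min: "\<And>y. y \<in> V \<Longrightarrow> f x + ereal (S x) \<le> f y + ereal (S y)"
    and y: "y \<in> V"
  shows "ereal (- inner u (y - x)) + f x \<le> f y"
proof (rule ereal_le_real)
  fix r assume r: "f y \<le> ereal r"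
  define g where "g t = S (x + t *\<^sub>R (y - x))" for t
  have d: "y - x \<in> V" using V x y by (simp add: subspace_diff)
  have "(g has_real_derivative inner u (y - x)) (at 0)"
    unfolding g_def using S by (intro DERIV_along_line[OF V x d]) simp
  then have lim: "((\<lambda>t. (g t - g 0) / t) \<longlongrightarrow> inner u (y - x)) (at_right 0)"
    unfolding DERIV_def by (auto intro: tendsto_mono[OF at_le])
  have "eventually (\<lambda>t. t \<in> {0<..1}) (at_right (0::real))"
    unfolding eventually_at by (rule exI[of _ 1]) (auto simp: dist_real_def)
  then have "eventually (\<lambda>t. c - r \<le> (g t - g 0) / t) (at_right 0)"
  proof eventually_elim
    case (elim t)
    have eq: "x + t *\<^sub>R (y - x) = (1 - t) *\<^sub>R x + t *\<^sub>R y" by (simp add: algebra_simps)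
    have "x + t *\<^sub>R (y - x) \<in> V" using V x d by (simp add: subspace_add subspace_scale)
    from min[OF this] have "ereal (c + S x) \<le> f (x + t *\<^sub>R (y - x)) + ereal (g t)"
      by (simp add: g_def fx)
    also have "\<dots> \<le> ereal ((1 - t) * c + t * r) + ereal (g t)"
      unfolding eq using elim by (intro add_right_mono conv[OF y r]) auto
    finally show ?case using elim by (simp add: g_def field_simps)
  qed
  then have "c - r \<le> inner u (y - x)"
    using lim by (intro tendsto_lowerbound[OF lim]) auto
  then show "ereal (- inner u (y - x)) + f x \<le> ereal r" by (simp add: fx)
qed

text \<open>
  Minimizing sequences of the proximal objective are Cauchy, because the squared norm makes the objective
  uniformly convex. The extra term \<open>\<parallel>y - p\<parallel>\<^sup>2 / 8\<close> is what the midpoint inequality leaves over; it gives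
  uniqueness of the minimizer.
\<close>
lemma prox_objective_minimizer:
  assumes V: "hilbert_space V" and f: "f \<in> Gamma0 V" and \<gamma>: "\<gamma> > 0"
  obtains p c where "p \<in> V" "f p = ereal c"
    "\<And>y r. y \<in> V \<Longrightarrow> f y \<le> ereal r \<Longrightarrow>
       \<gamma> * c + (norm (p - u))\<^sup>2 / 2 + (norm (y - p))\<^sup>2 / 8 \<le> \<gamma> * r + (norm (y - u))\<^sup>2 / 2"
proof -
  have sub: "subspace V" and comp: "complete V" using V by (auto simp: hilbert_space_def)
  define A where "A = {\<gamma> * r + (norm (y - u))\<^sup>2 / 2 | y r. y \<in> V \<and> f y \<le> ereal r}"
  obtain x0 f0 where x0: "x0 \<in> V" "f x0 = ereal f0" using Gamma0_proper[OF f] .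
  then have "\<gamma> * f0 + (norm (x0 - u))\<^sup>2 / 2 \<in> A" unfolding A_def by (intro CollectI exI[of _ f0] exI[of _ x0]) simp
  then have "A \<noteq> {}" by blast
  obtain c0 m0 where m0: "m0 \<ge> 0" "\<And>y. y \<in> V \<Longrightarrow> ereal (c0 - m0 * norm (y - u)) \<le> f y"
    using Gamma0_minorant[OF sub f, of u] by meson
  have "bdd_below A"
  proof (rule bdd_belowI)
    fix s assume "s \<in> A"
    then obtain y r where y: "y \<in> V" "f y \<le> ereal r" and s: "s = \<gamma> * r + (norm (y - u))\<^sup>2 / 2"
      by (auto simp: A_def)
    have "ereal (c0 - m0 * norm (y - u)) \<le> ereal r"
      using m0(2)[OF y(1)] y(2) by (rule order_trans)
    then have "\<gamma> * (c0 - m0 * norm (y - u)) \<le> \<gamma> * r" using \<gamma> by (intro mult_left_mono) auto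
    moreover have "0 \<le> (norm (y - u) - \<gamma> * m0)\<^sup>2" by simp
    ultimately show "\<gamma> * c0 - (\<gamma> * m0)\<^sup>2 / 2 \<le> s"
      by (simp add: s power2_eq_square algebra_simps)
  qed
  define m where "m = Inf A"
  have m: "m \<le> s" if "s \<in> A" for s
    unfolding m_def by (rule cInf_lower) (use that \<open>bdd_below A\<close> in auto)
  \<comment> \<open>uniform convexity of the objective, measured at midpoints\<close>
  have strong: "m + (norm (y - y'))\<^sup>2 / 8 \<le>
      ((\<gamma> * r + (norm (y - u))\<^sup>2 / 2) + (\<gamma> * r' + (norm (y' - u))\<^sup>2 / 2)) / 2"
    if "y \<in> V" "f y \<le> ereal r" "y' \<in> V" "f y' \<le> ereal r'" for y y' r r'
  proof -
    let ?z = "(1 - 1/2) *\<^sub>R y + (1/2) *\<^sub>R y'"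
    have "?z \<in> V" using sub that by (simp add: subspace_add subspace_scale)
    moreover have "f ?z \<le> ereal ((1 - 1/2) * r + (1/2) * r')"
      by (rule Gamma0_convex[OF f that(1,3,2,4)]) auto
    ultimately have "\<gamma> * ((1 - 1/2) * r + (1/2) * r') + (norm (?z - u))\<^sup>2 / 2 \<in> A"
      unfolding A_def by blast
    from m[OF this] have 1: "m \<le> \<gamma> * (r / 2 + r' / 2) + (norm (?z - u))\<^sup>2 / 2" by simp
    have zu: "?z - u = (1/2) *\<^sub>R ((y - u) + (y' - u))"
      by (simp add: algebra_simps flip: scaleR_add_left)
    have yy: "y - y' = (y - u) - (y' - u)" by simp
    have 2: "(norm (?z - u))\<^sup>2 / 2 + (norm (y - y'))\<^sup>2 / 8 = (norm (y - u))\<^sup>2 / 4 + (norm (y' - u))\<^sup>2 / 4"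
      unfolding zu unfolding yy
      by (simp add: power2_norm_eq_inner inner_add inner_diff inner_commute field_simps)
    then show ?thesis using 1 by (simp add: field_simps)
  qed
  have "\<exists>y r. y \<in> V \<and> f y \<le> ereal r \<and> \<gamma> * r + (norm (y - u))\<^sup>2 / 2 < m + inverse (Suc n)" for n
  proof -
    have "\<exists>s\<in>A. s < m + inverse (Suc n)"
      unfolding m_def using \<open>A \<noteq> {}\<close> \<open>bdd_below A\<close> by (subst cInf_less_iff[symmetric]) auto
    then show ?thesis by (auto simp: A_def)
  qed
  then obtain Y R where Y: "\<And>n. Y n \<in> V" "\<And>n. f (Y n) \<le> ereal (R n)"
    and YR: "\<And>n::nat. \<gamma> * R n + (norm (Y n - u))\<^sup>2 / 2 < m + inverse (Suc n)" by metis
  have dist: "(norm (Y n - Y k))\<^sup>2 \<le> 4 * (inverse (Suc n) + inverse (Suc k))" for n k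
  proof -
    have aux: "d \<le> 4 * (i + j)" if "m + d / 8 \<le> (A + B) / 2" "A < m + i" "B < m + j" for A B d i j :: real
      using that by (simp add: field_simps)
    show ?thesis
      by (rule aux[OF strong[OF Y(1)[of n] Y(2)[of n] Y(1)[of k] Y(2)[of k]] YR[of n] YR[of k]])
  qed
  have "Cauchy Y"
  proof (rule metric_CauchyI)
    fix e :: real assume e: "e > 0"
    obtain N :: nat where N: "inverse (Suc N) < e\<^sup>2 / 8"
      using reals_Archimedean[of "e\<^sup>2 / 8"] e by auto
    show "\<exists>M. \<forall>n\<ge>M. \<forall>k\<ge>M. dist (Y n) (Y k) < e"
    proof (intro exI allI impI)
      fix n k assume nk: "n \<ge> N" "k \<ge> N"
      have "inverse (real (Suc n)) \<le> inverse (real (Suc N))" "inverse (real (Suc k)) \<le> inverse (real (Suc N))"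
        using nk by (auto intro!: le_imp_inverse_le)
      then have "(norm (Y n - Y k))\<^sup>2 < e\<^sup>2" using dist[of n k] N by argo
      then show "dist (Y n) (Y k) < e"
        using e by (simp add: dist_norm power_less_imp_less_base less_imp_le)
    qed
  qed
  then obtain p where p: "p \<in> V" "Y \<longlonglongrightarrow> p"
    using comp Y(1) unfolding complete_def by blast
  define R' where "R' n = (m + inverse (Suc n) - (norm (Y n - u))\<^sup>2 / 2) / \<gamma>" for n
  have "f p \<le> ereal ((m + 0 - (norm (p - u))\<^sup>2 / 2) / \<gamma>)"
  proof (rule Gamma0_closed[OF f p(1) Y(1) p(2)])
    fix n
    have "\<gamma> * R n \<le> m + inverse (real (Suc n)) - (norm (Y n - u))\<^sup>2 / 2" using YR[of n] by linarith
    then have "R n \<le> R' n"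
      unfolding R'_def using \<gamma> by (simp add: pos_le_divide_eq mult.commute del: of_nat_Suc)
    then show "f (Y n) \<le> ereal (R' n)" using Y(2)[of n] by (meson ereal_less_eq(3) order_trans)
    show "R' \<longlonglongrightarrow> (m + 0 - (norm (p - u))\<^sup>2 / 2) / \<gamma>"
      unfolding R'_def using \<gamma> p by (intro tendsto_intros LIMSEQ_inverse_real_of_nat) auto
  qed
  moreover obtain c where c: "f p = ereal c"
    using calculation Gamma0_not_MInfty[OF f p(1)] by (cases "f p") auto
  ultimately have cm: "\<gamma> * c + (norm (p - u))\<^sup>2 / 2 \<le> m" using \<gamma> by (simp add: field_simps)
  show ?thesis
  proof
    show "p \<in> V" "f p = ereal c" by fact+
    fix y r assume yr: "y \<in> V" "f y \<le> ereal r"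
    have "\<gamma> * r + (norm (y - u))\<^sup>2 / 2 \<in> A" using yr by (auto simp: A_def)
    then have "m \<le> \<gamma> * r + (norm (y - u))\<^sup>2 / 2" by (rule m)
    then show "\<gamma> * c + (norm (p - u))\<^sup>2 / 2 + (norm (y - p))\<^sup>2 / 8 \<le> \<gamma> * r + (norm (y - u))\<^sup>2 / 2"
    proof -
      have aux: "A + d / 8 \<le> B" if "m + d / 8 \<le> (B + A) / 2" "A \<le> m" "m \<le> B" for A B d :: real
        using that by (simp add: field_simps)
      show ?thesis by (rule aux[OF strong[OF yr p(1) eq_refl[OF c]] cm \<open>m \<le> _\<close>])
    qed
  qed
qed


text \<open>
  The point \<open>u\<close> may lie outside \<open>V\<close>, so that membership of proximal points in \<open>V\<close> does not depend on where
  the algorithm evaluates them.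
\<close>
lemma prox_scaled:
  assumes V: "hilbert_space V" and f: "f \<in> Gamma0 V" and \<gamma>: "\<gamma> > 0"
  shows prox_in: "prox V (\<lambda>w. ereal \<gamma> * f w) u \<in> V"
    and prox_subgradient: "y \<in> V \<Longrightarrow>
      ereal (inner (y - prox V (\<lambda>w. ereal \<gamma> * f w) u)
        (inverse \<gamma> *\<^sub>R (u - prox V (\<lambda>w. ereal \<gamma> * f w) u)))
      + f (prox V (\<lambda>w. ereal \<gamma> * f w) u) \<le> f y"
proof -
  have sub: "subspace V" using V by (simp add: hilbert_space_def)
  obtain p c where p: "p \<in> V" and fp: "f p = ereal c"
    and growth: "\<And>y r. y \<in> V \<Longrightarrow> f y \<le> ereal r \<Longrightarrow>
       \<gamma> * c + (norm (p - u))\<^sup>2 / 2 + (norm (y - p))\<^sup>2 / 8 \<le> \<gamma> * r + (norm (y - u))\<^sup>2 / 2"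
    using prox_objective_minimizer[OF V f \<gamma>, of u] by blast
  let ?F = "\<lambda>y. ereal \<gamma> * f y + ereal ((norm (y - u))\<^sup>2 / 2)"
  have below: "?F p \<le> ?F y" "?F y \<le> ?F p \<Longrightarrow> y = p" if y: "y \<in> V" for y
  proof -
    consider r where "f y = ereal r" | "f y = \<infinity>"
      using Gamma0_not_MInfty[OF f y] by (cases "f y") auto
    then have "?F p \<le> ?F y \<and> (?F y \<le> ?F p \<longrightarrow> y = p)"
    proof cases
      case 1
      have "0 \<le> (norm (y - p))\<^sup>2" by simp
      then have "\<gamma> * c + (norm (p - u))\<^sup>2 / 2 \<le> \<gamma> * r + (norm (y - u))\<^sup>2 / 2"
        using growth[OF y eq_refl[OF 1]] by linarith
      moreover have "y = p" if "\<gamma> * r + (norm (y - u))\<^sup>2 / 2 \<le> \<gamma> * c + (norm (p - u))\<^sup>2 / 2"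
      proof -
        have "(norm (y - p))\<^sup>2 \<le> 0" using that growth[OF y eq_refl[OF 1]] by linarith
        then show ?thesis by simp
      qed
      ultimately show ?thesis by (simp add: fp 1)
    qed (use \<gamma> in \<open>simp add: fp\<close>)
    then show "?F p \<le> ?F y" "?F y \<le> ?F p \<Longrightarrow> y = p" by blast+
  qed
  have "prox V (\<lambda>w. ereal \<gamma> * f w) u = p"
    unfolding prox_def
  proof (rule the_equality)
    show "is_arg_min ?F (\<lambda>y. y \<in> V) p" using p below(1) by (auto simp: is_arg_min_def not_less)
    fix y assume "is_arg_min ?F (\<lambda>y. y \<in> V) y"
    then show "y = p" using below(2)[of y] p by (auto simp: is_arg_min_def not_less)
  qed
  moreover have "ereal (inner (y - p) (inverse \<gamma> *\<^sub>R (u - p))) + f p \<le> f y" if y: "y \<in> V" for y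
  proof -
    let ?S = "\<lambda>y. inverse \<gamma> * ((norm (y - u))\<^sup>2 / 2)"
    have "((\<lambda>y. inverse \<gamma> * (inner (y - u) (y - u) / 2)) has_derivative
      (\<lambda>w. inner (inverse \<gamma> *\<^sub>R (p - u)) w)) (at p within V)"
      by (auto intro!: derivative_eq_intros simp: inner_commute)
    then have S: "(?S has_derivative (\<lambda>w. inner (inverse \<gamma> *\<^sub>R (p - u)) w)) (at p within V)"
      by (simp add: power2_norm_eq_inner)
    have "ereal (- inner (inverse \<gamma> *\<^sub>R (p - u)) (y - p)) + f p \<le> f y"
    proof (rule minimizer_convex_plus_smooth[where f = f, OF sub p fp _ S _ y])
      fix y r t assume "y \<in> V" "f y \<le> ereal r" "0 \<le> t" "t \<le> (1::real)"
      then show "f ((1 - t) *\<^sub>R p + t *\<^sub>R y) \<le> ereal ((1 - t) * c + t * r)"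
        using Gamma0_convex[OF f p, of y c r t] fp by simp
    next
      fix y assume y: "y \<in> V"
      consider r where "f y = ereal r" | "f y = \<infinity>"
        using Gamma0_not_MInfty[OF f y] by (cases "f y") auto
      then show "f p + ereal (?S p) \<le> f y + ereal (?S y)"
      proof cases
        case 1
        then have "\<gamma> * c + (norm (p - u))\<^sup>2 / 2 \<le> \<gamma> * r + (norm (y - u))\<^sup>2 / 2"
          using growth[OF y, of r, OF eq_refl] zero_le_power2[of "norm (y - p)"] by linarith
        then have "inverse \<gamma> * (\<gamma> * c + (norm (p - u))\<^sup>2 / 2) \<le> inverse \<gamma> * (\<gamma> * r + (norm (y - u))\<^sup>2 / 2)"
          using \<gamma> by (intro mult_left_mono) auto
        then show ?thesis using \<gamma> by (simp add: 1 fp distrib_left flip: mult.assoc)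
      qed (simp add: fp)
    qed
    moreover have "- inner (inverse \<gamma> *\<^sub>R (p - u)) (y - p) = inner (y - p) (inverse \<gamma> *\<^sub>R (u - p))"
      by (simp add: inner_commute inner_diff algebra_simps)
    ultimately show ?thesis by simp
  qed
  ultimately show "prox V (\<lambda>w. ereal \<gamma> * f w) u \<in> V"
    and "y \<in> V \<Longrightarrow>
      ereal (inner (y - prox V (\<lambda>w. ereal \<gamma> * f w) u)
        (inverse \<gamma> *\<^sub>R (u - prox V (\<lambda>w. ereal \<gamma> * f w) u)))
      + f (prox V (\<lambda>w. ereal \<gamma> * f w) u) \<le> f y"
    using p by auto
qed

lemma subdifferential_finite:
  assumes f: "f \<in> Gamma0 V" and x: "x \<in> V" and u: "u \<in> subdifferential V f x"
  obtains c where "f x = ereal c"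
proof -
  obtain y r where y: "y \<in> V" "f y = ereal r" using Gamma0_proper[OF f] .
  then have "ereal (inner (y - x) u) + f x \<le> ereal r"
    using u by (force simp: subdifferential_def)
  then show ?thesis using that Gamma0_not_MInfty[OF f x] by (cases "f x") auto
qed

text \<open>
  The representing vector is the proximal point of \<open>- l\<close> at the origin, that is, the minimizer of
  \<open>\<parallel>y\<parallel>\<^sup>2 / 2 - l y\<close>. The ambient space is not complete, so completeness has to come from \<open>V\<close>.
\<close>
lemma riesz_representation:
  fixes l :: "'a::real_inner \<Rightarrow> real"
  assumes V: "hilbert_space V" and l: "bounded_linear_between V UNIV l"
  obtains p where "p \<in> V" "\<And>x. x \<in> V \<Longrightarrow> l x = inner x p"
proof -
  have sub: "subspace V" using V by (simp add: hilbert_space_def)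
  have add: "l (x + y) = l x + l y" if "x \<in> V" "y \<in> V" for x y
    using l that by (auto simp: bounded_linear_between_def)
  have scale: "l (r *\<^sub>R x) = r * l x" if "x \<in> V" for r x
    using l that by (auto simp: bounded_linear_between_def)
  have diff: "l (x - y) = l x - l y" if "x \<in> V" "y \<in> V" for x y
    using add[OF that(1), of "(-1) *\<^sub>R y"] scale[OF that(2), of "-1"] sub that by (simp add: subspace_neg)
  obtain B where B: "\<And>x. x \<in> V \<Longrightarrow> \<bar>l x\<bar> \<le> B * norm x"
    using l unfolding bounded_linear_between_def real_norm_def by blast
  have cont: "(l \<longlongrightarrow> l x) (at x within V)" if x: "x \<in> V" for x
  proof -
    have "((\<lambda>y. l y - l x) \<longlongrightarrow> 0) (at x within V)"
    proof (rule Lim_null_comparison)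
      show "eventually (\<lambda>y. norm (l y - l x) \<le> B * norm (y - x)) (at x within V)"
        unfolding eventually_at_filter using B diff x sub
        by (intro always_eventually) (metis subspace_diff real_norm_def)
      show "((\<lambda>y. B * norm (y - x)) \<longlongrightarrow> 0) (at x within V)"
        by (auto intro!: tendsto_eq_intros)
    qed
    then show ?thesis by (simp add: LIM_zero_iff)
  qed
  define f where "f x = ereal (- l x)" for x
  have "f \<in> Gamma0 V"
    unfolding Gamma0_def
  proof (intro CollectI conjI ballI)
    show "\<exists>x\<in>V. f x \<noteq> \<infinity>" using sub by (auto simp: f_def intro!: bexI[of _ 0] subspace_0)
    fix x assume x: "x \<in> V"
    show "f x \<noteq> -\<infinity>" by (simp add: f_def)
    show "f x \<le> Liminf (at x within V) f"
    proof (cases "at x within V = bot")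
      case False
      have "(f \<longlongrightarrow> f x) (at x within V)" unfolding f_def using cont[OF x] by (auto intro: tendsto_minus)
      then show ?thesis using lim_imp_Liminf[OF False] by (metis order_refl)
    qed simp
  next
    show "convex (epi V f)"
      using sub by (auto simp: convex_def epi_def f_def subspace_add subspace_scale add scale)
        (smt (verit) mult_left_mono mult_minus_right)
  qed
  define p where "p = prox V (\<lambda>w. ereal 1 * f w) 0"
  have p: "p \<in> V" unfolding p_def by (rule prox_in[OF V \<open>f \<in> Gamma0 V\<close>]) simp
  have le: "l w \<le> inner w p" if w: "w \<in> V" for w
  proof -
    have "p + w \<in> V" using sub p w by (simp add: subspace_add)
    from prox_subgradient[OF V \<open>f \<in> Gamma0 V\<close> zero_less_one this, of 0, folded p_def]
    show ?thesis using add[OF p w] by (simp add: f_def)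
  qed
  have "l w = inner w p" if w: "w \<in> V" for w
    using le[OF w] le[of "- w"] scale[OF w, of "-1"] sub w by (simp add: subspace_neg)
  then show ?thesis using p that by blast
qed

text \<open>
  The essential half of the Fenchel-Moreau theorem. The proximal points \<open>p n\<close> of \<open>f / (n + 1)\<close> at \<open>u\<close> come with
  subgradients and hence with affine minorants. If their values at \<open>u\<close> all stayed below \<open>M < f u\<close>,
  the at most linear decay of \<open>f\<close> would force \<open>p n \<rightarrow> u\<close>, contradicting lower semicontinuity at \<open>u\<close>.
\<close>
lemma Gamma0_affine_minorant:
  assumes V: "hilbert_space V" and f: "f \<in> Gamma0 V" and u: "u \<in> V" and M: "ereal M < f u"
  obtains s k where "s \<in> V" "\<And>y. y \<in> V \<Longrightarrow> ereal (inner y s - k) \<le> f y" "M < inner u s - k"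
proof (rule ccontr)
  assume no: "\<not> thesis"
  have sub: "subspace V" using V by (simp add: hilbert_space_def)
  define p where "p n = prox V (\<lambda>w. ereal (inverse (real (Suc n))) * f w) u" for n
  define s where "s n = real (Suc n) *\<^sub>R (u - p n)" for n
  have p: "p n \<in> V" for n unfolding p_def by (rule prox_in[OF V f]) simp
  have s: "s n \<in> V" for n unfolding s_def using p sub u by (simp add: subspace_diff subspace_scale)
  have minor: "ereal (inner (y - p n) (s n)) + f (p n) \<le> f y" if "y \<in> V" for y n
    using prox_subgradient[OF V f _ that, of "inverse (real (Suc n))" u, folded p_def]
    by (simp add: s_def)
  then have "s n \<in> subdifferential V f (p n)" for n
    using s by (simp add: subdifferential_def)
  then have "\<exists>c. f (p n) = ereal c" for n
    using subdifferential_finite[OF f p] by blast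
  then obtain c where c: "\<And>n. f (p n) = ereal (c n)" by metis
  have "c n + real (Suc n) * (norm (u - p n))\<^sup>2 \<le> M" for n
  proof (rule ccontr)
    assume "\<not> ?thesis"
    then have "M < inner u (s n) - (inner (p n) (s n) - c n)"
      by (simp add: s_def power2_norm_eq_inner algebra_simps)
    moreover have "ereal (inner y (s n) - (inner (p n) (s n) - c n)) \<le> f y" if "y \<in> V" for y
      using minor[OF that, of n] by (simp add: c inner_diff_left algebra_simps)
    ultimately show False using no that s by blast
  qed
  note upper = this
  obtain c0 m where m: "m \<ge> 0" "\<And>y. y \<in> V \<Longrightarrow> ereal (c0 - m * norm (y - u)) \<le> f y"
    using Gamma0_minorant[OF sub f, of u] by meson
  have r: "(norm (p n - u))\<^sup>2 \<le> (2 * \<bar>M - c0\<bar> + m\<^sup>2) * inverse (real (Suc n))" for n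
  proof -
    have "c0 - m * norm (p n - u) \<le> c n" using m(2)[OF p, of n] c by simp
    moreover have "0 \<le> (m - norm (p n - u))\<^sup>2" by simp
    ultimately have "real (Suc n) * (norm (p n - u))\<^sup>2 \<le> \<bar>M - c0\<bar> + m\<^sup>2 / 2 + (norm (p n - u))\<^sup>2 / 2"
      using upper[of n] by (simp add: power2_eq_square norm_minus_commute algebra_simps)
    moreover have "(norm (p n - u))\<^sup>2 \<le> real (Suc n) * (norm (p n - u))\<^sup>2"
      by (simp add: algebra_simps)
    moreover have "A \<le> 2 * B + D" if "A \<le> B + D / 2 + C / 2" "C \<le> A" for A B C D :: real
      using that by linarith
    ultimately have "real (Suc n) * (norm (p n - u))\<^sup>2 \<le> 2 * \<bar>M - c0\<bar> + m\<^sup>2" by blast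
    then show ?thesis by (simp add: field_simps)
  qed
  have "(\<lambda>n. (norm (p n - u))\<^sup>2) \<longlonglongrightarrow> 0"
  proof (rule Lim_null_comparison[OF always_eventually])
    show "\<forall>n. norm ((norm (p n - u))\<^sup>2) \<le> (2 * \<bar>M - c0\<bar> + m\<^sup>2) * inverse (real (Suc n))"
      using r by simp
    show "(\<lambda>n. (2 * \<bar>M - c0\<bar> + m\<^sup>2) * inverse (real (Suc n))) \<longlonglongrightarrow> 0"
      using tendsto_mult_right_zero[OF LIMSEQ_inverse_real_of_nat] by blast
  qed
  from tendsto_real_sqrt[OF this] have "(\<lambda>n. norm (p n - u)) \<longlonglongrightarrow> 0" by simp
  then have pu: "p \<longlonglongrightarrow> u" by (simp add: tendsto_norm_zero_iff LIM_zero_iff)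
  have "f u \<le> ereal M"
  proof (rule Gamma0_closed[OF f u p pu])
    show "f (p n) \<le> ereal M" for n
    proof -
      have "0 \<le> real (Suc n) * (norm (u - p n))\<^sup>2" by simp
      then have "c n \<le> M" using upper[of n] by linarith
      then show ?thesis by (simp add: c)
    qed
    show "(\<lambda>n. M) \<longlonglongrightarrow> M" by simp
  qed
  then show False using M by simp
qed

lemma Gamma0_weakly_lsc:
  assumes V: "hilbert_space V" and f: "f \<in> Gamma0 V" and "\<And>n. w n \<in> V" and l: "l \<in> V"
    and conv: "converges_weakly V w l"
  shows "f l \<le> liminf (\<lambda>n. f (w n))"
  unfolding le_Liminf_iff
proof (intro allI impI)
  fix y assume "y < f l"
  then obtain M where M: "y < ereal M" "ereal M < f l" by (metis ereal_dense2)
  obtain s k where s: "s \<in> V" "\<And>y. y \<in> V \<Longrightarrow> ereal (inner y s - k) \<le> f y" "M < inner l s - k"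
    using Gamma0_affine_minorant[OF V f l M(2)] by blast
  have "(\<lambda>n. inner (w n) s - k) \<longlonglongrightarrow> inner l s - k"
    using conv s(1) by (intro tendsto_diff tendsto_const) (auto simp: converges_weakly_def)
  then have "eventually (\<lambda>n. M < inner (w n) s - k) sequentially"
    using s(3) by (rule order_tendstoD)
  then show "eventually (\<lambda>n. y < f (w n)) sequentially"
  proof eventually_elim
    case (elim n)
    have "y < ereal M" by fact
    also have "\<dots> < ereal (inner (w n) s - k)" using elim by simp
    also have "\<dots> \<le> f (w n)" using s(2) assms(3) by blast
    finally show ?case .
  qed
qed

lemma conjugate_ge: "y \<in> V \<Longrightarrow> f y \<le> ereal r \<Longrightarrow> ereal (inner y u - r) \<le> conjugate V f u"
  unfolding conjugate_def
  by (rule order_trans[OF _ SUP_upper[of y]])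
     (auto simp: ereal_minus_mono ereal_minus(1)[symmetric] simp del: ereal_minus(1))

lemma conjugate_le:
  "(\<And>y. y \<in> V \<Longrightarrow> ereal (inner y u - r) \<le> f y) \<Longrightarrow> conjugate V f u \<le> ereal r"
  unfolding conjugate_def
proof (rule SUP_least)
  fix y assume "\<And>y. y \<in> V \<Longrightarrow> ereal (inner y u - r) \<le> f y" "y \<in> V"
  then show "ereal (inner y u) - f y \<le> ereal r" by (cases "f y") (force)+
qed

text \<open>Reduces a bound on a possibly infinite \<open>x\<close> to bounds on the reals below it.\<close>
lemma ereal_dense_bound_add:
  assumes "\<And>M. ereal M < x \<Longrightarrow> ereal (c + M) \<le> y"
  shows "ereal c + x \<le> y"
proof -
  have "x \<le> y - ereal c"
  proof (rule dense_le)
    fix z assume "z < x"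
    then obtain M where "z < ereal M" "ereal M < x" by (metis ereal_dense2)
    then show "z \<le> y - ereal c" using assms[of M] by (cases y; cases z) auto
  qed
  then show ?thesis by (cases x; cases y) auto
qed

text \<open>
  Instead of forming the biconjugate, test the subgradient inequality of the conjugate at the slope \<open>s\<close> of
  an affine minorant of \<open>h\<close> that is nearly exact at \<open>w\<close>.
\<close>
lemma subgradient_of_conjugate:
  assumes V: "hilbert_space V" and h: "h \<in> Gamma0 V" and v: "v \<in> V"
    and w: "w \<in> subdifferential V (conjugate V h) v"
  shows "v \<in> subdifferential V h w"
proof -
  have wV: "w \<in> V" using w by (simp add: subdifferential_def)
  have "ereal (inner (y - w) v) + h w \<le> h y" if y: "y \<in> V" for y
  proof (rule ereal_dense_bound_add)
    fix M assume M: "ereal M < h w"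
    obtain s k where s: "s \<in> V" "\<And>y. y \<in> V \<Longrightarrow> ereal (inner y s - k) \<le> h y" "M < inner w s - k"
      using Gamma0_affine_minorant[OF V h wV M] by blast
    show "ereal (inner (y - w) v + M) \<le> h y"
    proof (rule ereal_le_real)
      fix r assume "h y \<le> ereal r"
      then have "ereal (inner (s - v) w) + ereal (inner y v - r) \<le> ereal (inner (s - v) w) + conjugate V h v"
        using y by (intro add_left_mono conjugate_ge)
      also have "\<dots> \<le> conjugate V h s" using w s(1) by (simp add: subdifferential_def)
      also have "\<dots> \<le> ereal k" using s(2) by (rule conjugate_le)
      finally have "inner (s - v) w + inner y v - r \<le> k" by simp
      then show "ereal (inner (y - w) v + M) \<le> ereal r"
        using s(3) by (simp add: inner_diff inner_commute)
    qed
  qed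
  then show ?thesis using v by (simp add: subdifferential_def)
qed

text \<open>
  The conjugate of the infimal convolution of \<open>g\<^sup>*\<close> and \<open>\<psi>\<^sup>*\<close> is \<open>g + \<psi>\<close>. The test slope is \<open>s + \<psi>' u\<close>, with \<open>s\<close>
  the slope of a nearly exact affine minorant of \<open>g\<close> at \<open>u\<close>, and the infimal convolution is
  estimated there by the decomposition into these two summands.
\<close>
lemma subgradient_of_inf_conv_conjugates:
  assumes V: "hilbert_space V" and g: "g \<in> Gamma0 V" and v: "v \<in> V"
    and \<psi>: "\<And>x. x \<in> V \<Longrightarrow> \<psi>' x \<in> V" "\<And>x y. x \<in> V \<Longrightarrow> y \<in> V \<Longrightarrow> \<psi> x + inner (y - x) (\<psi>' x) \<le> \<psi> y"
    and u: "u \<in> subdifferential V (inf_conv V (conjugate V g) (conjugate V (\<lambda>s. ereal (\<psi> s)))) v"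
  shows "v \<in> subdifferential V (\<lambda>s. g s + ereal (\<psi> s)) u"
proof -
  let ?D = "inf_conv V (conjugate V g) (conjugate V (\<lambda>s. ereal (\<psi> s)))"
  have uV: "u \<in> V" using u by (simp add: subdifferential_def)
  have sub: "subspace V" using V by (simp add: hilbert_space_def)
  have "ereal (inner (y - u) v + \<psi> u - \<psi> y) + g u \<le> g y" if y: "y \<in> V" for y
  proof (rule ereal_dense_bound_add)
    fix M assume M: "ereal M < g u"
    obtain s k where s: "s \<in> V" "\<And>y. y \<in> V \<Longrightarrow> ereal (inner y s - k) \<le> g y" "M < inner u s - k"
      using Gamma0_affine_minorant[OF V g uV M] by blast
    show "ereal (inner (y - u) v + \<psi> u - \<psi> y + M) \<le> g y"
    proof (rule ereal_le_real)
      fix r assume r: "g y \<le> ereal r"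
      have Dv: "ereal (inner y v - r - \<psi> y) \<le> ?D v"
        unfolding inf_conv_def
      proof (rule INF_greatest)
        fix z assume "z \<in> V"
        have "ereal (inner y v - r - \<psi> y) = ereal (inner y z - r) + ereal (inner y (v - z) - \<psi> y)"
          by (simp add: inner_diff_right)
        also have "\<dots> \<le> conjugate V g z + conjugate V (\<lambda>s. ereal (\<psi> s)) (v - z)"
          using y r by (intro add_mono conjugate_ge) auto
        finally show "ereal (inner y v - r - \<psi> y) \<le> conjugate V g z + conjugate V (\<lambda>s. ereal (\<psi> s)) (v - z)" .
      qed
      have "?D (s + \<psi>' u) \<le> conjugate V g s + conjugate V (\<lambda>s. ereal (\<psi> s)) (s + \<psi>' u - s)"
        unfolding inf_conv_def using s(1) by (rule INF_lower)
      also have "\<dots> \<le> ereal k + ereal (inner u (\<psi>' u) - \<psi> u)"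
        using s(2) \<psi>(2)[OF uV]
        by (intro add_mono conjugate_le) (auto simp: inner_diff_left algebra_simps)
      finally have Ds: "?D (s + \<psi>' u) \<le> ereal (k + (inner u (\<psi>' u) - \<psi> u))" by simp
      have "ereal (inner (s + \<psi>' u - v) u) + ereal (inner y v - r - \<psi> y)
          \<le> ereal (inner (s + \<psi>' u - v) u) + ?D v" by (intro add_left_mono Dv)
      also have "\<dots> \<le> ?D (s + \<psi>' u)"
        using u s(1) \<psi>(1)[OF uV] sub by (simp add: subdifferential_def subspace_add)
      also note Ds
      finally have "inner (s + \<psi>' u - v) u + (inner y v - r - \<psi> y) \<le> k + (inner u (\<psi>' u) - \<psi> u)" by simp
      then show "ereal (inner (y - u) v + \<psi> u - \<psi> y + M) \<le> ereal r"
        using s(3) by (simp add: inner_diff inner_add inner_commute)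
    qed
  qed
  note le = this
  have "ereal (inner (y - u) v) + (g u + ereal (\<psi> u)) \<le> g y + ereal (\<psi> y)" if y: "y \<in> V" for y
    using le[OF y] by (cases "g u"; cases "g y") auto
  then show ?thesis using v by (simp add: subdifferential_def)
qed

section \<open>Gradients, adjoints and Hilbert sums\<close>
lemma gradient_unique:
  assumes V: "subspace V" and x: "x \<in> V" and "u \<in> V" "w \<in> V"
    and u: "(\<phi> has_derivative (\<lambda>t. inner u t)) (at x within V)"
    and w: "(\<phi> has_derivative (\<lambda>t. inner w t)) (at x within V)"
  shows "u = w"
proof -
  have d: "u - w \<in> V" using assms by (simp add: subspace_diff)
  have "((\<lambda>s. \<phi> (x + s *\<^sub>R (u - w))) has_real_derivative inner u (u - w)) (at 0)"
    "((\<lambda>s. \<phi> (x + s *\<^sub>R (u - w))) has_real_derivative inner w (u - w)) (at 0)"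
    using u w by (auto intro!: DERIV_along_line[OF V x d])
  then have "inner u (u - w) = inner w (u - w)" by (rule DERIV_unique)
  then have "inner (u - w) (u - w) = 0" by (simp add: inner_diff_left)
  then show ?thesis by simp
qed

lemma gradient_onI:
  assumes "subspace V" "x \<in> V" "u \<in> V" "(\<phi> has_derivative (\<lambda>t. inner u t)) (at x within V)"
  shows "gradient_on V \<phi> x = u"
  unfolding gradient_on_def using assms by (intro the_equality) (auto intro: gradient_unique)

lemma gradient_on_derivative:
  assumes V: "hilbert_space V" and x: "x \<in> V" and \<phi>: "\<phi> differentiable_on V"
  shows gradient_on_in: "gradient_on V \<phi> x \<in> V"
    and gradient_on_has_derivative:
      "(\<phi> has_derivative (\<lambda>t. inner (gradient_on V \<phi> x) t)) (at x within V)"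
proof -
  have sub: "subspace V" using V by (simp add: hilbert_space_def)
  obtain D where D: "(\<phi> has_derivative D) (at x within V)"
    using \<phi> x by (auto simp: differentiable_on_def differentiable_def)
  then interpret D: bounded_linear D by (rule has_derivative_bounded_linear)
  obtain B where "\<And>w. norm (D w) \<le> norm w * B" using D.bounded by blast
  then have "bounded_linear_between V UNIV D"
    unfolding bounded_linear_between_def
    by (auto simp: D.add D.scaleR mult.commute intro!: exI[of _ B])
  then obtain p where p: "p \<in> V" "\<And>w. w \<in> V \<Longrightarrow> D w = inner w p"
    using riesz_representation[OF V] by metis
  have "(\<phi> has_derivative (\<lambda>t. inner p t)) (at x within V)"
    unfolding has_derivative_within
  proof
    show "bounded_linear (inner p)" by (rule bounded_linear_inner_right)
    have "((\<lambda>y. (1 / norm (y - x)) *\<^sub>R (\<phi> y - (\<phi> x + D (y - x)))) \<longlongrightarrow> 0) (at x within V)"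
      using D by (simp add: has_derivative_within)
    moreover have "eventually (\<lambda>y. D (y - x) = inner p (y - x)) (at x within V)"
      unfolding eventually_at_filter using p sub x
      by (intro always_eventually) (auto simp: subspace_diff inner_commute)
    then have "eventually (\<lambda>y. (1 / norm (y - x)) *\<^sub>R (\<phi> y - (\<phi> x + D (y - x))) =
      (1 / norm (y - x)) *\<^sub>R (\<phi> y - (\<phi> x + inner p (y - x)))) (at x within V)"
      by eventually_elim simp
    ultimately show "((\<lambda>y. (1 / norm (y - x)) *\<^sub>R (\<phi> y - (\<phi> x + inner p (y - x)))) \<longlongrightarrow> 0) (at x within V)"
      by (rule Lim_transform_eventually)
  qed
  moreover from this have "gradient_on V \<phi> x = p" by (rule gradient_onI[OF sub x p(1)])
  ultimately show "gradient_on V \<phi> x \<in> V"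
    "(\<phi> has_derivative (\<lambda>t. inner (gradient_on V \<phi> x) t)) (at x within V)"
    using p by auto
qed

text \<open>The point \<open>x\<close> minimizes \<open>\<phi> + (- \<phi>)\<close>, so the sum rule applies with the smooth part \<open>- \<phi>\<close>.\<close>
lemma convex_gradient_inequality:
  assumes V: "subspace V" and cv: "convex_on V \<phi>" and x: "x \<in> V" and y: "y \<in> V"
    and D: "(\<phi> has_derivative (\<lambda>t. inner u t)) (at x within V)"
  shows "\<phi> x + inner (y - x) u \<le> \<phi> y"
proof -
  have "((\<lambda>w. - \<phi> w) has_derivative (\<lambda>t. inner (- u) t)) (at x within V)"
    using has_derivative_minus[OF D] by simp
  note D' = this
  have "ereal (- inner (- u) (y - x)) + ereal (\<phi> x) \<le> ereal (\<phi> y)"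
  proof (rule minimizer_convex_plus_smooth[where f = "\<lambda>w. ereal (\<phi> w)", OF V x refl _ D' _ y])
    fix y r t assume "y \<in> V" "ereal (\<phi> y) \<le> ereal r" "0 \<le> t" "t \<le> (1::real)"
    then have "\<phi> ((1 - t) *\<^sub>R x + t *\<^sub>R y) \<le> (1 - t) * \<phi> x + t * \<phi> y" "t * \<phi> y \<le> t * r"
      using convex_onD[OF cv] x by (auto intro: mult_left_mono)
    then show "ereal (\<phi> ((1 - t) *\<^sub>R x + t *\<^sub>R y)) \<le> ereal ((1 - t) * \<phi> x + t * r)" by simp
  qed auto
  then show ?thesis by (simp add: inner_commute)
qed

lemma descent_lemma:
  assumes V: "subspace V"
    and D: "\<And>x. x \<in> V \<Longrightarrow> (\<phi> has_derivative (\<lambda>t. inner (D x) t)) (at x within V)"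
    and K: "K-lipschitz_on V D" and x: "x \<in> V" and y: "y \<in> V"
  shows "\<phi> y \<le> \<phi> x + inner (y - x) (D x) + K / 2 * (norm (y - x))\<^sup>2"
proof -
  define d where "d = y - x"
  have d: "d \<in> V" using V x y by (simp add: d_def subspace_diff)
  define h where "h t = \<phi> (x + t *\<^sub>R d) - t * inner (D x) d - K / 2 * t\<^sup>2 * (norm d)\<^sup>2" for t
  have "h 0 \<ge> h 1"
  proof (rule DERIV_nonpos_imp_nonincreasing[where f = h and a = 0 and b = 1])
    fix t :: real assume t: "0 \<le> t"
    have xt: "x + t *\<^sub>R d \<in> V" using V x d by (simp add: subspace_add subspace_scale)
    have "(h has_real_derivative inner (D (x + t *\<^sub>R d)) d - inner (D x) d - K * t * (norm d)\<^sup>2) (at t)"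
      unfolding h_def
      by (rule derivative_eq_intros DERIV_along_line[OF V x d D[OF xt]] refl | simp)+
    moreover have "inner (D (x + t *\<^sub>R d) - D x) d \<le> norm (D (x + t *\<^sub>R d) - D x) * norm d"
      by (rule norm_cauchy_schwarz)
    moreover have "norm (D (x + t *\<^sub>R d) - D x) \<le> K * (t * norm d)"
      using lipschitz_onD[OF K xt x] t by (simp add: dist_norm)
    then have "norm (D (x + t *\<^sub>R d) - D x) * norm d \<le> K * (t * norm d) * norm d"
      by (rule mult_right_mono) simp
    ultimately show "\<exists>y. (h has_real_derivative y) (at t) \<and> y \<le> 0"
      by (intro exI conjI) (assumption, simp add: inner_diff_left power2_eq_square mult.assoc)
  qed simp
  then show ?thesis by (simp add: h_def d_def inner_commute)
qed

text \<open>
  Compare the affine minorant of \<open>\<phi>\<close> at \<open>x\<close> with the quadratic majorant at \<open>y\<close>, both evaluated at the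
  minimizer \<open>y + (D x - D y) / K\<close> of their difference. Symmetrizing gives cocoercivity.
\<close>
lemma Baillon_Haddad:
  assumes V: "subspace V" and cv: "convex_on V \<phi>"
    and DV: "\<And>x. x \<in> V \<Longrightarrow> D x \<in> V"
    and D: "\<And>x. x \<in> V \<Longrightarrow> (\<phi> has_derivative (\<lambda>t. inner (D x) t)) (at x within V)"
    and K: "K-lipschitz_on V D" "K > 0" and x: "x \<in> V" and y: "y \<in> V"
  shows "(norm (D x - D y))\<^sup>2 / K \<le> inner (x - y) (D x - D y)"
proof -
  have half: "(norm (D x - D y))\<^sup>2 / (2 * K) \<le> \<phi> y - \<phi> x - inner (y - x) (D x)"
    if x: "x \<in> V" and y: "y \<in> V" for x y
  proof -
    define w where "w = inverse K *\<^sub>R (D x - D y)"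
    have "y + w \<in> V" using V x y DV by (simp add: w_def subspace_add subspace_diff subspace_scale)
    from convex_gradient_inequality[OF V cv x this D[OF x]]
      descent_lemma[OF V D K(1) y this]
    have "\<phi> x + inner (y + w - x) (D x) \<le> \<phi> y + inner w (D y) + K / 2 * (norm w)\<^sup>2" by simp
    moreover have "inner w (D x) - inner w (D y) - K / 2 * (norm w)\<^sup>2 = (norm (D x - D y))\<^sup>2 / (2 * K)"
    proof -
      have "inner w (D x) - inner w (D y) = (norm (D x - D y))\<^sup>2 / K"
        unfolding inner_diff_right[symmetric]
        by (simp add: w_def power2_norm_eq_inner divide_inverse mult.commute)
      moreover have "K / 2 * (norm w)\<^sup>2 = (norm (D x - D y))\<^sup>2 / (2 * K)"
      proof -
        have "norm w = norm (D x - D y) / K"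
          using K(2) unfolding w_def norm_scaleR by (simp add: divide_inverse mult.commute)
        then show ?thesis using K(2) by (simp add: power2_eq_square)
      qed
      ultimately show ?thesis by (simp add: field_simps)
    qed
    ultimately show ?thesis by (simp add: inner_add_left inner_diff_left)
  qed
  have "(norm (D x - D y))\<^sup>2 / K = (norm (D x - D y))\<^sup>2 / (2 * K) + (norm (D y - D x))\<^sup>2 / (2 * K)"
    by (simp add: norm_minus_commute)
  also have "\<dots> \<le> inner (x - y) (D x - D y)"
    using half[OF x y] half[OF y x] by (simp add: inner_diff algebra_simps)
  finally show ?thesis .
qed

lemma bounded_linear_between_diff:
  assumes "subspace V" "bounded_linear_between V W L" "x \<in> V" "y \<in> V"
  shows "L (x - y) = L x - L y"
proof -
  have "L (x + (-1) *\<^sub>R y) = L x + (-1) *\<^sub>R L y"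
    using assms unfolding bounded_linear_between_def by (metis subspace_scale)
  then show ?thesis by simp
qed

lemma adjoint_on_works:
  assumes V: "hilbert_space V" and L: "bounded_linear_between V W L"
  shows adjoint_on_in: "adjoint_on V L y \<in> V"
    and adjoint_on_inner: "x \<in> V \<Longrightarrow> inner (L x) y = inner x (adjoint_on V L y)"
proof -
  have sub: "subspace V" using V by (simp add: hilbert_space_def)
  obtain B where B: "\<And>x. x \<in> V \<Longrightarrow> norm (L x) \<le> B * norm x"
    using L unfolding bounded_linear_between_def by blast
  have "bounded_linear_between V UNIV (\<lambda>x. inner (L x) y)"
    unfolding bounded_linear_between_def
  proof (intro conjI exI ballI)
    fix x assume x: "x \<in> V"
    have "norm (inner (L x) y) \<le> norm (L x) * norm y" by (rule Cauchy_Schwarz_ineq2[folded real_norm_def])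
    also have "\<dots> \<le> B * norm x * norm y" by (intro mult_right_mono B x) simp
    finally show "norm (inner (L x) y) \<le> B * norm y * norm x" by (simp add: mult_ac)
  qed (use L in \<open>auto simp: bounded_linear_between_def inner_add_left\<close>)
  then obtain p where p: "p \<in> V" "\<And>x. x \<in> V \<Longrightarrow> inner (L x) y = inner x p"
    using riesz_representation[OF V] by metis
  have "adjoint_on V L y = p"
    unfolding adjoint_on_def
  proof (rule the_equality)
    fix u assume u: "u \<in> V \<and> (\<forall>x\<in>V. inner (L x) y = inner x u)"
    then have "u - p \<in> V" using sub p by (simp add: subspace_diff)
    then have "inner (u - p) u = inner (u - p) p" using u p by metis
    then have "inner (u - p) (u - p) = 0" by (simp add: inner_diff_right)
    then show "u = p" by simp
  qed (use p in auto)
  then show "adjoint_on V L y \<in> V" "x \<in> V \<Longrightarrow> inner (L x) y = inner x (adjoint_on V L y)"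
    using p by auto
qed

lemma power2_norm_vec: "(norm x)\<^sup>2 = (\<Sum>i\<in>UNIV. (norm (x $ i))\<^sup>2)"
  for x :: "'a::real_inner ^ 'i::finite"
  by (simp add: power2_norm_eq_inner inner_vec_def)

lemma hilbert_space_hilbert_sum:
  fixes H :: "'i::finite \<Rightarrow> 'a::real_inner set"
  assumes H: "\<And>i. hilbert_space (H i)"
  shows "hilbert_space (hilbert_sum H)"
  unfolding hilbert_space_def
proof
  have sub: "subspace (H i)" and comp: "complete (H i)" for i
    using H by (auto simp: hilbert_space_def)
  show "subspace (hilbert_sum H)"
    using sub by (auto simp: subspace_def hilbert_sum_def)
  show "complete (hilbert_sum H)"
    unfolding complete_def
  proof (intro allI impI, elim conjE)
    fix X :: "nat \<Rightarrow> 'a ^ 'i" assume X: "\<forall>n. X n \<in> hilbert_sum H" "Cauchy X"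
    have "\<exists>l\<in>H i. (\<lambda>n. X n $ i) \<longlonglongrightarrow> l" for i
      using comp[of i] X Cauchy_vec_nth[of X i] unfolding complete_def hilbert_sum_def by auto
    then obtain l where l: "\<And>i. l i \<in> H i" "\<And>i. (\<lambda>n. X n $ i) \<longlonglongrightarrow> l i" by metis
    have "X \<longlonglongrightarrow> (\<chi> i. l i)" using l(2) by (intro vec_tendstoI) simp
    moreover have "(\<chi> i. l i) \<in> hilbert_sum H" using l(1) by (simp add: hilbert_sum_def)
    ultimately show "\<exists>l\<in>hilbert_sum H. X \<longlonglongrightarrow> l" by blast
  qed
qed

lemma hilbert_space_Times:
  assumes "hilbert_space V" "hilbert_space W"
  shows "hilbert_space (V \<times> W)"
  unfolding hilbert_space_def
proof
  show "subspace (V \<times> W)" using assms by (simp add: hilbert_space_def subspace_Times)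
  show "complete (V \<times> W)"
    unfolding complete_def
  proof (intro allI impI, elim conjE)
    fix X :: "nat \<Rightarrow> 'a \<times> 'b" assume X: "\<forall>n. X n \<in> V \<times> W" "Cauchy X"
    have "Cauchy (\<lambda>n. fst (X n))" "Cauchy (\<lambda>n. snd (X n))"
      using X(2) unfolding Cauchy_def
      by (metis dist_fst_le le_less_trans, metis dist_snd_le le_less_trans)
    then obtain l m where "l \<in> V" "m \<in> W" "(\<lambda>n. fst (X n)) \<longlonglongrightarrow> l" "(\<lambda>n. snd (X n)) \<longlonglongrightarrow> m"
      using X(1) assms unfolding hilbert_space_def complete_def by (metis mem_Times_iff)
    then show "\<exists>l\<in>V \<times> W. X \<longlonglongrightarrow> l"
      using tendsto_Pair[of "\<lambda>n. fst (X n)" l sequentially "\<lambda>n. snd (X n)" m] by auto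
  qed
qed

text \<open>The chain rule along \<open>t \<mapsto> x + axis i (t - x\<^sub>i)\<close>.\<close>
lemma partial_gradient_component:
  fixes H :: "'i::finite \<Rightarrow> 'a::real_inner set"
  assumes H: "\<And>i. hilbert_space (H i)" and \<Theta>: "\<Theta> differentiable_on hilbert_sum H"
    and x: "x \<in> hilbert_sum H"
  shows "partial_gradient H \<Theta> i x = gradient_on (hilbert_sum H) \<Theta> x $ i"
  unfolding partial_gradient_def
proof (rule gradient_onI)
  let ?u = "gradient_on (hilbert_sum H) \<Theta> x"
  have V: "hilbert_space (hilbert_sum H)" by (rule hilbert_space_hilbert_sum[OF H])
  have u: "?u \<in> hilbert_sum H" by (rule gradient_on_in[OF V x \<Theta>])
  have sub: "subspace (H i)" using H by (simp add: hilbert_space_def)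
  then show "subspace (H i)" "x $ i \<in> H i" "?u $ i \<in> H i"
    using x u by (auto simp: hilbert_sum_def)
  let ?c = "\<lambda>t. \<chi> j. if j = i then t else x $ j"
  have bl: "bounded_linear (axis i :: 'a \<Rightarrow> 'a ^ 'i)"
  proof (rule bounded_linear_intro[where K = 1])
    show "norm (axis i t :: 'a ^ 'i) \<le> norm t * 1" for t
      by (simp add: norm_eq_sqrt_inner inner_axis_axis)
  qed (auto simp: vec_eq_iff axis_def)
  have c: "?c = (\<lambda>t. x + axis i (t - x $ i))" by (auto simp: vec_eq_iff axis_def fun_eq_iff)
  have "(?c has_derivative axis i) (at (x $ i) within H i)"
    unfolding c
    using has_derivative_add[OF has_derivative_const[of x] bounded_linear.has_derivative[OF bl
        has_derivative_diff[OF has_derivative_ident has_derivative_const[of "x $ i"]]]] by simp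
  moreover have "?c (x $ i) = x" by (simp add: vec_eq_iff)
  moreover have "(\<Theta> has_derivative (\<lambda>t. inner ?u t)) (at x within ?c ` H i)"
    using x by (intro has_derivative_subset[OF gradient_on_has_derivative[OF V x \<Theta>]])
      (auto simp: hilbert_sum_def)
  ultimately have "((\<lambda>t. \<Theta> (?c t)) has_derivative (\<lambda>t. inner ?u (axis i t))) (at (x $ i) within H i)"
    using has_derivative_in_compose[of ?c "axis i" "x $ i" "H i" \<Theta> "\<lambda>t. inner ?u t"] by simp
  then show "((\<lambda>t. \<Theta> (?c t)) has_derivative (\<lambda>t. inner (?u $ i) t)) (at (x $ i) within H i)"
    by (simp add: inner_axis)
qed

section \<open>Weak convergence\<close>

text \<open>
  A diagonal subsequence makes the inner products with all members of the sequence converge. The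
  vectors \<open>u\<close> for which they converge form a complete subspace \<open>U\<close>, on which the limit functional
  has a Riesz representer \<open>l\<close>. An arbitrary \<open>v\<close> is replaced by its orthogonal projection onto \<open>U\<close>,
  which the members of the sequence cannot distinguish from \<open>v\<close>.
\<close>
lemma bounded_has_weakly_convergent_subsequence:
  assumes V: "hilbert_space V" and x: "\<And>n. x n \<in> V" and B: "\<And>n. norm (x n) \<le> B"
  obtains l r where "l \<in> V" "strict_mono (r :: nat \<Rightarrow> nat)" "converges_weakly V (x \<circ> r) l"
proof -
  have sub: "subspace V" using V by (simp add: hilbert_space_def)
  interpret subseqs "\<lambda>n s. convergent (\<lambda>k. inner (x (s k)) (x n))"
  proof
    fix n and s :: "nat \<Rightarrow> nat"
    have "norm (inner (x (s k)) (x n)) \<le> B * norm (x n)" for k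
      using Cauchy_Schwarz_ineq2[of "x (s k)" "x n"] mult_right_mono[OF B[of "s k"], of "norm (x n)"]
      by simp
    then have "bounded (range (\<lambda>k. inner (x (s k)) (x n)))" unfolding bounded_iff by blast
    then obtain l r where "strict_mono (r :: nat \<Rightarrow> nat)" "((\<lambda>k. inner (x (s k)) (x n)) \<circ> r) \<longlonglongrightarrow> l"
      using bounded_imp_convergent_subsequence by blast
    then show "\<exists>r'. strict_mono r' \<and> convergent (\<lambda>k. inner (x ((s \<circ> r') k)) (x n))"
      by (auto simp: convergent_def o_def)
  qed
  let ?d = diagseq
  have conv_x: "convergent (\<lambda>k. inner (x (?d k)) (x n))" for n
  proof -
    have "convergent (\<lambda>k. inner (x ((?d \<circ> ((+) (Suc n))) k)) (x n))"
    proof (rule diagseq_holds)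
      fix r s :: "nat \<Rightarrow> nat" and n
      assume "strict_mono r" "convergent (\<lambda>k. inner (x (s k)) (x n))"
      then show "convergent (\<lambda>k. inner (x ((s \<circ> r) k)) (x n))"
        using convergent_subseq_convergent[of "\<lambda>k. inner (x (s k)) (x n)" r] by (simp add: o_def)
    qed
    then have "convergent (\<lambda>k. inner (x (?d (k + Suc n))) (x n))" by (simp add: add.commute)
    then show ?thesis
      using convergent_ignore_initial_segment[of "\<lambda>k. inner (x (?d k)) (x n)" "Suc n"] by blast
  qed
  define U where "U = {u \<in> V. convergent (\<lambda>k. inner (x (?d k)) u)}"
  have U: "hilbert_space U"
    unfolding hilbert_space_def
  proof
    show "subspace U"
      using sub unfolding subspace_def U_def
      by (auto simp: inner_add_right intro!: convergent_add convergent_mult convergent_const)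
    show "complete U"
      unfolding complete_def
    proof (intro allI impI, elim conjE)
      fix u assume u: "\<forall>n. u n \<in> U" "Cauchy u"
      then obtain w where w: "w \<in> V" "u \<longlonglongrightarrow> w"
        using V unfolding hilbert_space_def complete_def U_def by blast
      have "Cauchy (\<lambda>k. inner (x (?d k)) w)"
      proof (rule metric_CauchyI)
        fix e :: real assume e: "e > 0"
        define B' where "B' = max B 1"
        have B': "B' > 0" "\<And>n. norm (x n) \<le> B'" using B by (auto simp: B'_def le_max_iff_disj)
        obtain n where n: "norm (u n - w) < e / (4 * B')"
          using LIMSEQ_D[OF w(2), of "e / (4 * B')"] e B' by auto
        have close: "\<bar>inner (x k) w - inner (x k) (u n)\<bar> \<le> e / 4" for k
        proof -
          have "\<bar>inner (x k) (w - u n)\<bar> \<le> norm (x k) * norm (w - u n)" by (rule Cauchy_Schwarz_ineq2)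
          also have "\<dots> \<le> B' * (e / (4 * B'))"
            using n B' e by (intro mult_mono) (auto simp: norm_minus_commute)
          also have "\<dots> = e / 4" using B' by simp
          finally show ?thesis by (simp add: inner_diff_right)
        qed
        have "Cauchy (\<lambda>k. inner (x (?d k)) (u n))"
          using u(1) by (auto simp: U_def intro: convergent_Cauchy)
        then have "\<exists>M. \<forall>j\<ge>M. \<forall>k\<ge>M. dist (inner (x (?d j)) (u n)) (inner (x (?d k)) (u n)) < e / 4"
          by (rule metric_CauchyD) (use e in simp)
        then obtain M where M: "\<And>j k. j \<ge> M \<Longrightarrow> k \<ge> M \<Longrightarrow> dist (inner (x (?d j)) (u n)) (inner (x (?d k)) (u n)) < e / 4"
          by blast
        show "\<exists>M. \<forall>j\<ge>M. \<forall>k\<ge>M. dist (inner (x (?d j)) w) (inner (x (?d k)) w) < e"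
        proof (intro exI allI impI)
          fix j k assume "j \<ge> M" "k \<ge> M"
          then show "dist (inner (x (?d j)) w) (inner (x (?d k)) w) < e"
            using M[of j k] close[of "?d j"] close[of "?d k"] e unfolding dist_real_def by linarith
        qed
      qed
      then have "w \<in> U" using w(1) by (simp add: U_def Cauchy_convergent_iff)
      then show "\<exists>l\<in>U. u \<longlonglongrightarrow> l" using w(2) by blast
    qed
  qed
  define f where "f u = lim (\<lambda>k. inner (x (?d k)) u)" for u
  have f: "(\<lambda>k. inner (x (?d k)) u) \<longlonglongrightarrow> f u" if "u \<in> U" for u
    using that by (simp add: U_def f_def convergent_LIMSEQ_iff)
  have "bounded_linear_between U UNIV f"
    unfolding bounded_linear_between_def
  proof (intro conjI ballI allI exI)
    have subU: "subspace U" using U by (simp add: hilbert_space_def)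
    fix u r assume u: "u \<in> U"
    show "f (r *\<^sub>R u) = r *\<^sub>R f u"
      using tendsto_mult_left[OF f[OF u], of r] f[OF subspace_scale[OF subU u, of r]]
      by (intro LIMSEQ_unique) (auto simp: inner_scaleR_right)
    have "\<bar>inner (x (?d k)) u\<bar> \<le> B * norm u" for k
      using Cauchy_Schwarz_ineq2[of "x (?d k)" u] mult_right_mono[OF B[of "?d k"], of "norm u"] by simp
    then show "norm (f u) \<le> B * norm u"
      using tendsto_rabs[OF f[OF u]] by (intro tendsto_upperbound[of _ _ sequentially]) auto
    fix w assume w: "w \<in> U"
    show "f (u + w) = f u + f w"
      using tendsto_add[OF f[OF u] f[OF w]] f[OF subspace_add[OF subU u w]]
      by (intro LIMSEQ_unique) (auto simp: inner_add_right)
  qed simp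
  then obtain l where l: "l \<in> U" "\<And>u. u \<in> U \<Longrightarrow> f u = inner u l"
    using riesz_representation[OF U] by metis
  have "converges_weakly V (x \<circ> ?d) l"
    unfolding converges_weakly_def
  proof
    fix v assume v: "v \<in> V"
    \<comment> \<open>the orthogonal projection of \<open>v\<close> onto \<open>U\<close>\<close>
    have "bounded_linear_between U UNIV (\<lambda>u. inner u v)"
      unfolding bounded_linear_between_def
      by (auto simp: inner_add_left mult.commute Cauchy_Schwarz_ineq2 intro!: exI[of _ "norm v"])
    then obtain p where p: "p \<in> U" "\<And>u. u \<in> U \<Longrightarrow> inner u v = inner u p"
      using riesz_representation[OF U] by metis
    have xU: "x n \<in> U" for n using x conv_x by (simp add: U_def)
    have "f p = inner l v" using l(2)[OF p(1)] p(2)[OF l(1)] by (simp add: inner_commute)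
    then have "(\<lambda>k. inner (x (?d k)) v) \<longlonglongrightarrow> inner l v"
      using f[OF p(1)] by (simp add: p(2)[OF xU])
    then show "(\<lambda>n. inner ((x \<circ> ?d) n) v) \<longlonglongrightarrow> inner l v" by simp
  qed
  then show ?thesis using that l(1) subseq_diagseq by (auto simp: U_def)
qed

text \<open>
  For two weak cluster points \<open>l\<close> and \<open>m\<close> the numbers \<open>\<parallel>X n - m\<parallel>\<^sup>2 - \<parallel>X n - l\<parallel>\<^sup>2\<close> converge, hence so do the
  inner products with \<open>l - m\<close>, whose limit must be both \<open>\<langle>l, l - m\<rangle>\<close> and \<open>\<langle>m, l - m\<rangle>\<close>.
\<close>
lemma Opial:
  assumes V: "hilbert_space V" and X: "\<And>n. X n \<in> V" and C: "C \<noteq> {}" "C \<subseteq> V"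
    and conv: "\<And>c. c \<in> C \<Longrightarrow> convergent (\<lambda>n. norm (X n - c))"
    and cluster: "\<And>l r. l \<in> V \<Longrightarrow> strict_mono r \<Longrightarrow> converges_weakly V (X \<circ> r) l \<Longrightarrow> l \<in> C"
  obtains l where "l \<in> C" "converges_weakly V X l"
proof -
  have sub: "subspace V" using V by (simp add: hilbert_space_def)
  obtain c where "c \<in> C" using C by blast
  then obtain B where B: "\<And>n. norm (X n - c) \<le> B"
    using convergent_imp_Bseq[OF conv] by (auto simp: Bseq_def)
  have "norm (X n) \<le> B + norm c" for n
    using B[of n] norm_triangle_ineq[of "X n - c" c] by simp
  note bdd = this
  have subseq: "\<exists>l\<in>V. \<exists>q. strict_mono q \<and> converges_weakly V (X \<circ> (r \<circ> q)) l" for r :: "nat \<Rightarrow> nat"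
    using bounded_has_weakly_convergent_subsequence[OF V, of "X \<circ> r" "B + norm c"] X bdd
    by (metis comp_assoc comp_apply)
  have unique: "l = m"
    if l: "l \<in> V" "strict_mono r" "converges_weakly V (X \<circ> r) l"
      and m: "m \<in> V" "strict_mono s" "converges_weakly V (X \<circ> s) m" for l m and r s :: "nat \<Rightarrow> nat"
  proof -
    obtain a where a: "(\<lambda>n. norm (X n - l)) \<longlonglongrightarrow> a" using conv[OF cluster[OF l]] by (auto simp: convergent_def)
    obtain b where b: "(\<lambda>n. norm (X n - m)) \<longlonglongrightarrow> b" using conv[OF cluster[OF m]] by (auto simp: convergent_def)
    have eq: "((norm (X n - m))\<^sup>2 - (norm (X n - l))\<^sup>2 + (norm l)\<^sup>2 - (norm m)\<^sup>2) / 2 = inner (X n) (l - m)" for n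
      by (simp add: power2_norm_eq_inner inner_diff inner_commute)
    have lim: "(\<lambda>n. inner (X n) (l - m)) \<longlonglongrightarrow> (b\<^sup>2 - a\<^sup>2 + (norm l)\<^sup>2 - (norm m)\<^sup>2) / 2"
      unfolding eq[symmetric] by (intro tendsto_intros a b) simp
    have lm: "l - m \<in> V" using sub l m by (simp add: subspace_diff)
    have "inner l (l - m) = (b\<^sup>2 - a\<^sup>2 + (norm l)\<^sup>2 - (norm m)\<^sup>2) / 2"
    proof (rule LIMSEQ_unique)
      show "(\<lambda>n. inner (X (r n)) (l - m)) \<longlonglongrightarrow> inner l (l - m)"
        using l(3) lm by (simp add: converges_weakly_def)
      show "(\<lambda>n. inner (X (r n)) (l - m)) \<longlonglongrightarrow> (b\<^sup>2 - a\<^sup>2 + (norm l)\<^sup>2 - (norm m)\<^sup>2) / 2"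
        using LIMSEQ_subseq_LIMSEQ[OF lim l(2)] by (simp add: o_def)
    qed
    moreover have "inner m (l - m) = (b\<^sup>2 - a\<^sup>2 + (norm l)\<^sup>2 - (norm m)\<^sup>2) / 2"
    proof (rule LIMSEQ_unique)
      show "(\<lambda>n. inner (X (s n)) (l - m)) \<longlonglongrightarrow> inner m (l - m)"
        using m(3) lm by (simp add: converges_weakly_def)
      show "(\<lambda>n. inner (X (s n)) (l - m)) \<longlonglongrightarrow> (b\<^sup>2 - a\<^sup>2 + (norm l)\<^sup>2 - (norm m)\<^sup>2) / 2"
        using LIMSEQ_subseq_LIMSEQ[OF lim m(2)] by (simp add: o_def)
    qed
    ultimately have "inner (l - m) (l - m) = 0" by (simp add: inner_diff_left)
    then show ?thesis by simp
  qed
  obtain l q where l: "l \<in> V" "strict_mono q" "converges_weakly V (X \<circ> q) l"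
    using subseq[of id] by auto
  have "converges_weakly V X l"
    unfolding converges_weakly_def
  proof (intro ballI, rule ccontr)
    fix u assume u: "u \<in> V" and "\<not> (\<lambda>n. inner (X n) u) \<longlonglongrightarrow> inner l u"
    then obtain e where e: "e > 0" "\<And>N. \<exists>n\<ge>N. \<not> dist (inner (X n) u) (inner l u) < e"
      unfolding lim_sequentially by blast
    define A where "A = {n. \<not> dist (inner (X n) u) (inner l u) < e}"
    have "infinite A" unfolding infinite_nat_iff_unbounded_le A_def using e(2) by auto
    then have r: "strict_mono (enumerate A)" "\<And>n. enumerate A n \<in> A"
      by (auto simp: strict_mono_enumerate enumerate_in_set)
    obtain m q' where m: "m \<in> V" "strict_mono q'" "converges_weakly V (X \<circ> (enumerate A \<circ> q')) m"
      using subseq[of "enumerate A"] by auto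
    have "m = l" by (rule unique[OF m(1) _ m(3) l]) (intro strict_mono_o r m)
    then have "(\<lambda>n. inner (X (enumerate A (q' n))) u) \<longlonglongrightarrow> inner l u"
      using m(3) u by (simp add: converges_weakly_def)
    then obtain N where "dist (inner (X (enumerate A (q' N))) u) (inner l u) < e"
      using e(1) by (metis lim_sequentially order_refl)
    then show False using r(2)[of "q' N"] by (simp add: A_def)
  qed
  then show ?thesis using that cluster[OF l] by blast
qed

lemma tendsto_inner_zero:
  fixes f g :: "nat \<Rightarrow> 'a::real_inner"
  assumes f: "f \<longlonglongrightarrow> 0" and g: "\<And>n. norm (g n) \<le> B"
  shows "(\<lambda>n. inner (f n) (g n)) \<longlonglongrightarrow> 0"
proof (rule Lim_null_comparison[OF always_eventually])
  show "\<forall>n. norm (inner (f n) (g n)) \<le> norm (f n) * B"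
    using Cauchy_Schwarz_ineq2 mult_left_mono[OF g norm_ge_zero] by (metis order_trans real_norm_def)
  show "(\<lambda>n. norm (f n) * B) \<longlonglongrightarrow> 0"
    using f by (auto intro!: tendsto_eq_intros)
qed

lemma norm_add4_le: "norm (a + b + c + d) \<le> norm a + norm b + norm c + norm d"
  for a b c d :: "'a::real_normed_vector"
  by norm

lemma converges_weakly_perturb:
  assumes y: "converges_weakly V y l" and f: "(\<lambda>n. z n - y n) \<longlonglongrightarrow> 0"
  shows "converges_weakly V z l"
  unfolding converges_weakly_def
proof
  fix u assume u: "u \<in> V"
  have "(\<lambda>n. inner (y n) u + inner (z n - y n) u) \<longlonglongrightarrow> inner l u + inner 0 u"
    by (rule tendsto_add[OF _ tendsto_inner[OF f tendsto_const]]) (use y u in \<open>simp add: converges_weakly_def\<close>)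
  then show "(\<lambda>n. inner (z n) u) \<longlonglongrightarrow> inner l u" by (simp add: inner_diff_left)
qed

section \<open>Saddle points of a linearly constrained problem\<close>

text \<open>
  The properties of \<open>Gamma0\<close> functions that the convergence proof uses. Unlike the topological form of
  lower semicontinuity, they pass to sums of functions of different coordinates without effort.
\<close>
definition weakly_lsc_convex_on :: "'a::real_inner set \<Rightarrow> ('a \<Rightarrow> ereal) \<Rightarrow> bool" where
  "weakly_lsc_convex_on V f \<longleftrightarrow>
     (\<forall>x\<in>V. f x \<noteq> -\<infinity>) \<and>
     (\<forall>x\<in>V. \<forall>y\<in>V. \<forall>r s t. f x \<le> ereal r \<longrightarrow> f y \<le> ereal s \<longrightarrow> 0 \<le> t \<longrightarrow> t \<le> 1 \<longrightarrow>
        f ((1 - t) *\<^sub>R x + t *\<^sub>R y) \<le> ereal ((1 - t) * r + t * s)) \<and>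
     (\<forall>w l. (\<forall>n. w n \<in> V) \<longrightarrow> l \<in> V \<longrightarrow> converges_weakly V w l \<longrightarrow> f l \<le> liminf (\<lambda>n. f (w n)))"

text \<open>
  Minimization of \<open>F + S\<close> on the kernel of \<open>M\<close>, where \<open>N\<close> is the adjoint of \<open>M\<close>. The gradient of \<open>S\<close> is
  split into \<open>C\<close>, whose cocoercivity allows it to be evaluated explicitly, and \<open>R\<close>, which is
  only known to be monotone and Lipschitz continuous.
\<close>
locale saddle_problem =
  fixes V :: "'a::real_inner set" and W :: "'b::real_inner set"
    and M :: "'a \<Rightarrow> 'b" and N :: "'b \<Rightarrow> 'a"
    and F :: "'a \<Rightarrow> ereal" and S :: "'a \<Rightarrow> real" and C R :: "'a \<Rightarrow> 'a" and \<alpha> K :: real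
  assumes V: "hilbert_space V" and W: "hilbert_space W"
    and M: "bounded_linear_between V W M"
    and N_in: "\<And>s. s \<in> W \<Longrightarrow> N s \<in> V"
    and N: "\<And>u s. u \<in> V \<Longrightarrow> s \<in> W \<Longrightarrow> inner (M u) s = inner u (N s)"
    and F: "weakly_lsc_convex_on V F" and F_proper: "\<exists>u\<in>V. F u \<noteq> \<infinity>"
    and S_derivative: "\<And>u. u \<in> V \<Longrightarrow> (S has_derivative (\<lambda>t. inner (C u + R u) t)) (at u within V)"
    and S_gradient: "\<And>u w. u \<in> V \<Longrightarrow> w \<in> V \<Longrightarrow> S u + inner (w - u) (C u + R u) \<le> S w"
    and C_in: "\<And>u. u \<in> V \<Longrightarrow> C u \<in> V" and \<alpha>: "\<alpha> > 0"
    and C_cocoercive: "\<And>u w. u \<in> V \<Longrightarrow> w \<in> V \<Longrightarrow> \<alpha> * (norm (C u - C w))\<^sup>2 \<le> inner (u - w) (C u - C w)"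
    and R_in: "\<And>u. u \<in> V \<Longrightarrow> R u \<in> V"
    and R_monotone: "\<And>u w. u \<in> V \<Longrightarrow> w \<in> V \<Longrightarrow> 0 \<le> inner (u - w) (R u - R w)"
    and R_lipschitz: "\<And>u w. u \<in> V \<Longrightarrow> w \<in> V \<Longrightarrow> norm (R u - R w) \<le> K * norm (u - w)"
begin

text \<open>The optimality system of the Lagrangian \<open>F + S + \<langle>M \<cdot>, s\<rangle>\<close>.\<close>
definition KT :: "('a \<times> 'b) set" where
  "KT = {(u, s). u \<in> V \<and> s \<in> W \<and> M u = 0 \<and> - N s - C u - R u \<in> subdifferential V F u}"

lemma subV: "subspace V" and subW: "subspace W"
  using V W by (auto simp: hilbert_space_def)

lemma M_in: "u \<in> V \<Longrightarrow> M u \<in> W"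
  using M by (auto simp: bounded_linear_between_def)

lemma M_diff: "u \<in> V \<Longrightarrow> w \<in> V \<Longrightarrow> M (u - w) = M u - M w"
  using bounded_linear_between_diff[OF subV M] .

lemma M_bound: "\<exists>B>0. \<forall>u\<in>V. norm (M u) \<le> B * norm u"
proof -
  obtain B where B: "\<And>u. u \<in> V \<Longrightarrow> norm (M u) \<le> B * norm u"
    using M unfolding bounded_linear_between_def by blast
  have "norm (M u) \<le> max B 1 * norm u" if "u \<in> V" for u
    using B[OF that] mult_right_mono[of B "max B 1" "norm u"] by simp
  then show ?thesis by (intro exI[of _ "max B 1"]) auto
qed

lemma N_diff:
  assumes "s \<in> W" "t \<in> W" shows "N (s - t) = N s - N t"
proof -
  let ?d = "N (s - t) - (N s - N t)"
  have "?d \<in> V" using assms subV subW by (intro subspace_diff N_in)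
  then have "inner ?d ?d = 0"
    using N[of ?d "s - t"] N[of ?d s] N[of ?d t] assms subW
    by (simp add: inner_diff_right subspace_diff)
  then show ?thesis by simp
qed

lemma N_bound: "\<exists>B>0. \<forall>s\<in>W. norm (N s) \<le> B * norm s"
proof -
  obtain B where B: "B > 0" "\<And>u. u \<in> V \<Longrightarrow> norm (M u) \<le> B * norm u"
    using M_bound by blast
  have "norm (N s) \<le> B * norm s" if s: "s \<in> W" for s
  proof (cases "norm (N s) = 0")
    case False
    have "norm (N s) * norm (N s) = inner (M (N s)) s"
      using N[OF N_in[OF s] s] by (simp add: power2_norm_eq_inner flip: power2_eq_square)
    also have "\<dots> \<le> norm (M (N s)) * norm s" by (rule norm_cauchy_schwarz)
    also have "\<dots> \<le> B * norm (N s) * norm s" using B(2)[OF N_in[OF s]] by (rule mult_right_mono) simp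
    finally have "norm (N s) * norm (N s) \<le> norm (N s) * (B * norm s)" by (simp add: mult_ac)
    then show ?thesis using False by simp
  qed (use B in simp)
  then show ?thesis using B(1) by blast
qed

lemma C_lipschitz:
  assumes "u \<in> V" "w \<in> V" shows "norm (C u - C w) \<le> inverse \<alpha> * norm (u - w)"
proof (cases "norm (C u - C w) = 0")
  case False
  have "\<alpha> * (norm (C u - C w))\<^sup>2 \<le> norm (u - w) * norm (C u - C w)"
    using C_cocoercive[OF assms] norm_cauchy_schwarz order_trans by blast
  then have "(\<alpha> * norm (C u - C w)) * norm (C u - C w) \<le> norm (u - w) * norm (C u - C w)"
    by (simp add: power2_eq_square mult.assoc)
  then have "\<alpha> * norm (C u - C w) \<le> norm (u - w)" using False by simp
  then show ?thesis using \<alpha> by (simp add: field_simps)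
qed (use \<alpha> in simp)

lemma F_not_MInfty: "u \<in> V \<Longrightarrow> F u \<noteq> -\<infinity>"
  using F by (simp add: weakly_lsc_convex_on_def)

lemma subgradient_finite:
  assumes u: "u \<in> V" and p: "p \<in> subdifferential V F u"
  obtains r where "F u = ereal r"
proof -
  obtain y where "y \<in> V" "F y \<noteq> \<infinity>" using F_proper by blast
  then have "ereal (inner (y - u) p) + F u \<le> F y" "F y \<noteq> \<infinity>"
    using p by (auto simp: subdifferential_def)
  then show ?thesis using F_not_MInfty[OF u] that by (cases "F u") auto
qed

lemma subdifferential_monotone:
  assumes u: "u \<in> V" "p \<in> subdifferential V F u" and w: "w \<in> V" "q \<in> subdifferential V F w"
  shows "0 \<le> inner (u - w) (p - q)"
proof -
  obtain r s where rs: "F u = ereal r" "F w = ereal s" using subgradient_finite u w by metis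
  have "ereal (inner (w - u) p) + F u \<le> F w" "ereal (inner (u - w) q) + F w \<le> F u"
    using u w by (auto simp: subdifferential_def)
  then show ?thesis by (simp add: rs inner_diff_right inner_diff_left)
qed

text \<open>
  Together with the next lemma: the optimality system is equivalent to the minimization of the Lagrangian
  by \<open>u\<close>. Half-spaces are derived from the system, which separates \<open>C\<close> from \<open>R\<close>; weak limits are
  taken in the minimization property, which involves function values only.
\<close>
lemma KT_saddle:
  assumes "(u, s) \<in> KT" and y: "y \<in> V"
  shows "F u + ereal (S u) \<le> F y + ereal (S y + inner (M y) s)"
proof -
  have u: "u \<in> V" "s \<in> W" "M u = 0" and sg: "- N s - C u - R u \<in> subdifferential V F u"
    using assms by (auto simp: KT_def)
  obtain r where r: "F u = ereal r" using subgradient_finite[OF u(1) sg] .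
  have 1: "ereal (inner (y - u) (- N s - C u - R u)) + F u \<le> F y"
    using sg y by (simp add: subdifferential_def)
  have "inner (y - u) (N s) = inner (M y) s"
    using N[of "y - u" s] M_diff[of y u] u y subV by (simp add: subspace_diff)
  then have 2: "- inner (y - u) (- N s - C u - R u) \<le> S y - S u + inner (M y) s"
    using S_gradient[OF u(1) y] by (simp add: inner_diff_right inner_add_right)
  show ?thesis
  proof (cases "F y")
    case (real q)
    then show ?thesis using 1 2 by (simp add: r)
  qed (use F_not_MInfty[OF y] in auto)
qed

lemma saddle_KT:
  assumes u: "u \<in> V" "s \<in> W" "M u = 0"
    and saddle: "\<And>y. y \<in> V \<Longrightarrow> F u + ereal (S u) \<le> F y + ereal (S y + inner (M y) s)"
  shows "(u, s) \<in> KT"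
proof -
  obtain y0 where y0: "y0 \<in> V" "F y0 \<noteq> \<infinity>" using F_proper by blast
  then obtain c where c: "F u = ereal c"
    using saddle[OF y0(1)] F_not_MInfty[OF u(1)] by (cases "F u") auto
  let ?S = "\<lambda>y. S y + inner y (N s)"
  have D: "(?S has_derivative (\<lambda>t. inner (C u + R u + N s) t)) (at u within V)"
    by (auto intro!: derivative_eq_intros S_derivative[OF u(1)] simp: inner_add_right inner_commute)
  have "ereal (- inner (C u + R u + N s) (y - u)) + F u \<le> F y" if y: "y \<in> V" for y
  proof (rule minimizer_convex_plus_smooth[where f = F, OF subV u(1) c _ D _ y])
    fix y r t assume "y \<in> V" "F y \<le> ereal r" "0 \<le> t" "t \<le> (1::real)"
    then show "F ((1 - t) *\<^sub>R u + t *\<^sub>R y) \<le> ereal ((1 - t) * c + t * r)"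
      using F u c unfolding weakly_lsc_convex_on_def by (metis order_refl)
  next
    fix y assume "y \<in> V"
    then show "F u + ereal (?S u) \<le> F y + ereal (?S y)"
      using saddle[of y] N[OF u(1,2)] N[of y s] u by simp
  qed
  moreover have "- inner (C u + R u + N s) (y - u) = inner (y - u) (- N s - C u - R u)" for y
    by (simp add: inner_commute inner_diff inner_add)
  moreover have "- N s - C u - R u \<in> V"
    using subV u by (simp add: subspace_diff subspace_neg N_in C_in R_in)
  ultimately show ?thesis using u by (simp add: KT_def subdifferential_def)
qed

end


section \<open>Projective splitting\<close>

text \<open>
  \<open>Y\<close> is the relaxed projection of \<open>X\<close> onto the half-space \<open>{Y. \<delta> \<le> \<langle>X - Y, g\<rangle>}\<close>, which contains \<open>c\<close>. The
  gain in squared distance is \<open>(2 - l) / l\<close> times the squared step, and \<open>\<epsilon> / 2 \<le> (2 - l) / l\<close>.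
\<close>
lemma relaxed_projection_step:
  fixes X c g Y :: "'a::real_inner"
  assumes \<delta>: "\<delta> > 0" "\<delta> \<le> inner (X - c) g" and l: "\<epsilon> \<le> l" "l \<le> 2 - \<epsilon>" "\<epsilon> > 0"
    and Y: "Y = X - (l * \<delta> / (norm g)\<^sup>2) *\<^sub>R g"
  shows "(norm (Y - c))\<^sup>2 + \<epsilon> / 2 * (norm (Y - X))\<^sup>2 \<le> (norm (X - c))\<^sup>2"
    and "\<epsilon> * \<delta> \<le> norm g * norm (Y - X)"
proof -
  have g: "norm g > 0" using \<delta> by auto
  define t where "t = l * \<delta> / (norm g)\<^sup>2"
  have t: "t > 0" using l \<delta> g by (simp add: t_def)
  have tg: "t * (norm g)\<^sup>2 = l * \<delta>" using g by (simp add: t_def)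
  have YX: "(norm (Y - X))\<^sup>2 = t * (l * \<delta>)"
    using Y by (simp add: t_def[symmetric] power_mult_distrib power2_eq_square[of t] tg mult.assoc)
  have "(norm (Y - c))\<^sup>2 = (norm (X - c))\<^sup>2 - 2 * (t * inner (X - c) g) + t\<^sup>2 * (norm g)\<^sup>2"
  proof -
    have eq: "Y - c = (X - c) - t *\<^sub>R g" using Y by (simp add: t_def)
    show ?thesis
      unfolding eq power2_norm_eq_inner
      by (simp add: inner_diff inner_commute power2_eq_square algebra_simps)
  qed
  also have "t\<^sup>2 * (norm g)\<^sup>2 = t * (l * \<delta>)" by (simp only: power2_eq_square[of t] tg mult.assoc)
  also have "(norm (X - c))\<^sup>2 - 2 * (t * inner (X - c) g) + t * (l * \<delta>)
      \<le> (norm (X - c))\<^sup>2 - 2 * (t * \<delta>) + t * (l * \<delta>)"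
    using mult_left_mono[OF \<delta>(2), of t] t by simp
  also have "\<dots> = (norm (X - c))\<^sup>2 - (t * \<delta>) * (2 - l)" by (simp add: algebra_simps)
  finally have "(norm (Y - c))\<^sup>2 \<le> (norm (X - c))\<^sup>2 - (t * \<delta>) * (2 - l)" .
  moreover have "\<epsilon> / 2 * l \<le> 2 - l"
  proof -
    have "l \<le> 2" using l by linarith
    then have "\<epsilon> / 2 * l \<le> \<epsilon> / 2 * 2" using l by (intro mult_left_mono) auto
    then show ?thesis using l by linarith
  qed
  then have "(t * \<delta>) * (\<epsilon> / 2 * l) \<le> (t * \<delta>) * (2 - l)" using t \<delta> by (intro mult_left_mono) auto
  ultimately show "(norm (Y - c))\<^sup>2 + \<epsilon> / 2 * (norm (Y - X))\<^sup>2 \<le> (norm (X - c))\<^sup>2"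
    by (simp add: YX algebra_simps)
  have "norm (Y - X) = t * norm g" using Y t by (simp add: t_def[symmetric])
  then have "norm g * norm (Y - X) = l * \<delta>" using tg by (simp add: power2_eq_square algebra_simps)
  then show "\<epsilon> * \<delta> \<le> norm g * norm (Y - X)" using l \<delta> by (simp add: mult_right_mono)
qed

lemma tendsto_norm_power2_zero:
  fixes f :: "nat \<Rightarrow> 'a::real_normed_vector"
  assumes "(\<lambda>n. (norm (f n))\<^sup>2) \<longlonglongrightarrow> 0"
  shows "f \<longlonglongrightarrow> 0"
  using tendsto_real_sqrt[OF assms] by (simp add: tendsto_norm_zero_iff)

lemma Fejer_convergent:
  fixes X :: "nat \<Rightarrow> 'a::real_normed_vector"
  assumes "\<And>n. (norm (X (Suc n) - c))\<^sup>2 \<le> (norm (X n - c))\<^sup>2"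
  shows "convergent (\<lambda>n. norm (X n - c))"
proof -
  have "norm (X (Suc n) - c) \<le> norm (X n - c)" for n
    using assms[of n] power2_le_imp_le by force
  then have "decseq (\<lambda>n. norm (X n - c))" by (rule decseq_SucI)
  then show ?thesis using decseq_convergent[of _ 0] by (metis convergentI norm_ge_zero)
qed

lemma Fejer_steps_vanish:
  fixes X :: "nat \<Rightarrow> 'a::real_normed_vector"
  assumes "\<epsilon> > 0" and step: "\<And>n. (norm (X (Suc n) - c))\<^sup>2 + \<epsilon> * (norm (X (Suc n) - X n))\<^sup>2 \<le> (norm (X n - c))\<^sup>2"
  shows "(\<lambda>n. X (Suc n) - X n) \<longlonglongrightarrow> 0"
proof -
  have "(norm (X (Suc n) - c))\<^sup>2 \<le> (norm (X n - c))\<^sup>2" for n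
  proof -
    have "0 \<le> \<epsilon> * (norm (X (Suc n) - X n))\<^sup>2" using \<open>\<epsilon> > 0\<close> by simp
    then show ?thesis using step[of n] by linarith
  qed
  from Fejer_convergent[of X c, OF this] obtain l where l: "(\<lambda>n. norm (X n - c)) \<longlonglongrightarrow> l"
    by (auto simp: convergent_def)
  have "(\<lambda>n. ((norm (X n - c))\<^sup>2 - (norm (X (Suc n) - c))\<^sup>2) / \<epsilon>) \<longlonglongrightarrow> (l\<^sup>2 - l\<^sup>2) / \<epsilon>"
    using \<open>\<epsilon> > 0\<close> by (intro tendsto_intros l LIMSEQ_Suc[OF l]) auto
  then have lim: "(\<lambda>n. ((norm (X n - c))\<^sup>2 - (norm (X (Suc n) - c))\<^sup>2) / \<epsilon>) \<longlonglongrightarrow> 0" by simp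
  have "(\<lambda>n. (norm (X (Suc n) - X n))\<^sup>2) \<longlonglongrightarrow> 0"
  proof (rule Lim_null_comparison[OF always_eventually lim], intro allI)
    fix n show "norm ((norm (X (Suc n) - X n))\<^sup>2) \<le> ((norm (X n - c))\<^sup>2 - (norm (X (Suc n) - c))\<^sup>2) / \<epsilon>"
      using step[of n] \<open>\<epsilon> > 0\<close> by (simp add: field_simps)
  qed
  then show ?thesis by (rule tendsto_norm_power2_zero)
qed

text \<open>
  One step of the method, without any assumption on how \<open>a' n\<close> and \<open>e' n\<close> are produced: these points
  only have to certify a subgradient of \<open>F\<close>. The sequence \<open>ws\<close> holds the possibly outdated points at which \<open>C\<close> was
  evaluated. The pair \<open>(p n, - M (a n))\<close> is the normal vector of the separating half-space.
\<close>
locale projective_splitting = saddle_problem V W M N F S C R \<alpha> K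
  for V :: "'a::real_inner set" and W :: "'b::real_inner set"
    and M N F S C R \<alpha> K +
  fixes w ws a a' p :: "nat \<Rightarrow> 'a" and v e' :: "nat \<Rightarrow> 'b" and \<Delta> \<theta> lam :: "nat \<Rightarrow> real" and \<epsilon> :: real
  assumes w_in: "w n \<in> V" and ws_in: "ws n \<in> V" and a_in: "a n \<in> V"
    and v_in: "v n \<in> W" and e'_in: "e' n \<in> W"
    and subgradient: "a' n - C (ws n) \<in> subdifferential V F (a n)"
    and p: "p n = a' n + R (a n) + N (e' n)"
    and \<Delta>: "\<Delta> n = - inverse (4 * \<alpha>) * (norm (a n - ws n))\<^sup>2 + inner (w n - a n) (p n)
      - inner (M (a n)) (v n - e' n)"
    and \<epsilon>: "\<epsilon> > 0" and lam: "\<epsilon> \<le> lam n" "lam n \<le> 2 - \<epsilon>"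
    and \<theta>: "\<Delta> n > 0 \<Longrightarrow> \<theta> n = lam n * \<Delta> n / ((norm (p n))\<^sup>2 + (norm (M (a n)))\<^sup>2)"
    and update: "\<Delta> n > 0 \<Longrightarrow> w (Suc n) = w n - \<theta> n *\<^sub>R p n \<and> v (Suc n) = v n + \<theta> n *\<^sub>R M (a n)"
    and stay: "\<not> \<Delta> n > 0 \<Longrightarrow> w (Suc n) = w n \<and> v (Suc n) = v n"
begin

text \<open>
  Add the monotonicity inequalities of \<open>\<partial>F\<close> and \<open>R\<close> between \<open>a n\<close> and \<open>u\<close>. The operator \<open>C\<close> enters at \<open>ws n\<close> rather than at \<open>a n\<close>;
  cocoercivity and completing the square in \<open>\<parallel>C (ws n) - C u\<parallel>\<close> bound the discrepancy by \<open>(4\<alpha>)\<^sup>-\<^sup>1 \<parallel>a n - ws n\<parallel>\<^sup>2\<close>.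
\<close>
lemma half_space:
  assumes "(u, s) \<in> KT"
  shows "\<Delta> n \<le> inner ((w n, v n) - (u, s)) (p n, - M (a n))"
proof -
  have u: "u \<in> V" "s \<in> W" "M u = 0" and sg: "- N s - C u - R u \<in> subdifferential V F u"
    using assms by (auto simp: KT_def)
  let ?D = "C (ws n) - C u"
  have mono: "0 \<le> inner (a n - u) ((a' n - C (ws n)) - (- N s - C u - R u))"
    by (rule subdifferential_monotone[OF a_in subgradient u(1) sg])
  have "inner (u - a n) ?D \<le> inverse (4 * \<alpha>) * (norm (a n - ws n))\<^sup>2"
  proof -
    have "inner (u - a n) ?D = inner (ws n - a n) ?D - inner (ws n - u) ?D"
      by (simp add: inner_diff_left)
    also have "\<dots> \<le> norm (ws n - a n) * norm ?D - \<alpha> * (norm ?D)\<^sup>2"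
      by (intro diff_mono norm_cauchy_schwarz C_cocoercive ws_in u)
    also have "\<dots> \<le> inverse (4 * \<alpha>) * (norm (ws n - a n))\<^sup>2"
    proof -
      have "0 \<le> inverse (4 * \<alpha>) * (norm (ws n - a n) - 2 * \<alpha> * norm ?D)\<^sup>2" using \<alpha> by simp
      also have "\<dots> = inverse (4 * \<alpha>) * (norm (ws n - a n))\<^sup>2 - norm (ws n - a n) * norm ?D + \<alpha> * (norm ?D)\<^sup>2"
        using \<alpha> by (simp add: power2_eq_square field_simps)
      finally show ?thesis by simp
    qed
    finally show ?thesis by (simp add: norm_minus_commute)
  qed
  moreover have "0 \<le> inner (a n - u) (R (a n) - R u)" by (rule R_monotone[OF a_in u(1)])
  moreover have "inner (a n - u) (N (e' n - s)) = inner (M (a n)) (e' n - s)"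
  proof -
    have "a n - u \<in> V" "e' n - s \<in> W"
      using u a_in e'_in subV subW by (auto simp: subspace_diff)
    from N[OF this] show ?thesis using u a_in[of n] M_diff[of "a n" u] by simp
  qed
  moreover have "p n = ((a' n - C (ws n)) - (- N s - C u - R u)) + ?D + (R (a n) - R u) + N (e' n - s)"
    unfolding p N_diff[OF e'_in u(2)] by simp
  then have "inner (a n - u) (p n) = inner (a n - u) ((a' n - C (ws n)) - (- N s - C u - R u))
      + inner (a n - u) ?D + inner (a n - u) (R (a n) - R u) + inner (a n - u) (N (e' n - s))"
    by (simp only: inner_add_right)
  moreover have "inner (u - a n) ?D = - inner (a n - u) ?D"
    by (simp only: inner_minus_left[symmetric] minus_diff_eq)
  ultimately have "0 \<le> inner (a n - u) (p n) + inverse (4 * \<alpha>) * (norm (a n - ws n))\<^sup>2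
      - inner (M (a n)) (e' n - s)"
    using mono by linarith
  then show ?thesis
    unfolding \<Delta> by (simp add: inner_diff_left inner_diff_right inner_commute)
qed

definition X :: "nat \<Rightarrow> 'a \<times> 'b" where "X n = (w n, v n)"

lemma projection_step:
  shows Fejer: "c \<in> KT \<Longrightarrow>
      (norm (X (Suc n) - c))\<^sup>2 + \<epsilon> / 2 * (norm (X (Suc n) - X n))\<^sup>2 \<le> (norm (X n - c))\<^sup>2"
    and \<Delta>_le: "KT \<noteq> {} \<Longrightarrow> \<epsilon> * max (\<Delta> n) 0 \<le> norm (p n, - M (a n)) * norm (X (Suc n) - X n)"
proof -
  have *: "(norm (X (Suc n) - c))\<^sup>2 + \<epsilon> / 2 * (norm (X (Suc n) - X n))\<^sup>2 \<le> (norm (X n - c))\<^sup>2 \<and>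
      \<epsilon> * max (\<Delta> n) 0 \<le> norm (p n, - M (a n)) * norm (X (Suc n) - X n)" if c: "c \<in> KT" for c
  proof (cases "\<Delta> n > 0")
    case True
    let ?g = "(p n, - M (a n))"
    have g: "(norm ?g)\<^sup>2 = (norm (p n))\<^sup>2 + (norm (M (a n)))\<^sup>2"
      by (simp add: norm_prod_def)
    have eq: "X (Suc n) = X n - (lam n * \<Delta> n / (norm ?g)\<^sup>2) *\<^sub>R ?g"
      using update[OF True] \<theta>[OF True] unfolding g by (simp add: X_def)
    have le: "\<Delta> n \<le> inner (X n - c) ?g"
      using half_space[of "fst c" "snd c" n] c by (simp add: X_def)
    have "max (\<Delta> n) 0 = \<Delta> n" using True by simp
    then show ?thesis
      using relaxed_projection_step[OF True le lam \<epsilon> eq] by metis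
  next
    case False
    then show ?thesis using stay[OF False] by (simp add: X_def max_def)
  qed
  show "c \<in> KT \<Longrightarrow>
      (norm (X (Suc n) - c))\<^sup>2 + \<epsilon> / 2 * (norm (X (Suc n) - X n))\<^sup>2 \<le> (norm (X n - c))\<^sup>2"
    "KT \<noteq> {} \<Longrightarrow> \<epsilon> * max (\<Delta> n) 0 \<le> norm (p n, - M (a n)) * norm (X (Suc n) - X n)"
    using * by auto
qed

lemma X_steps_vanish:
  assumes "KT \<noteq> {}" shows "(\<lambda>n. X (Suc n) - X n) \<longlonglongrightarrow> 0"
proof -
  obtain c where "c \<in> KT" using assms by blast
  from Fejer[OF this] show ?thesis using \<epsilon> by (intro Fejer_steps_vanish[of "\<epsilon> / 2"]) auto
qed

lemma X_Fejer_convergent: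
  assumes c: "c \<in> KT" shows "convergent (\<lambda>n. norm (X n - c))"
proof (rule Fejer_convergent)
  fix n
  have "0 \<le> \<epsilon> / 2 * (norm (X (Suc n) - X n))\<^sup>2" using \<epsilon> by simp
  then show "(norm (X (Suc n) - c))\<^sup>2 \<le> (norm (X n - c))\<^sup>2" using Fejer[OF c, of n] by linarith
qed

lemma X_bounded:
  assumes "KT \<noteq> {}"
  shows "\<exists>B. \<forall>n. norm (w n) \<le> B \<and> norm (v n) \<le> B"
proof -
  obtain c where c: "c \<in> KT" using assms by blast
  from convergent_imp_Bseq[OF X_Fejer_convergent[OF c]]
  obtain B where B: "\<And>n. norm (X n - c) \<le> B" by (auto simp: Bseq_def)
  have "norm (w n) \<le> B + norm c \<and> norm (v n) \<le> B + norm c" for n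
  proof -
    have "norm (X n) \<le> B + norm c" using B[of n] norm_triangle_ineq[of "X n - c" c] by simp
    then show ?thesis
      using norm_fst_le[of "w n" "v n"] norm_snd_le[of "v n" "w n"] by (simp add: X_def)
  qed
  then show ?thesis by blast
qed


text \<open>
  The subgradient inequality at \<open>a n\<close> says that \<open>a n\<close> minimizes the Lagrangian with multiplier \<open>e' n\<close>
  up to an error governed by \<open>z n \<rightarrow> 0\<close>. The bilinear term \<open>\<langle>M (a n), e' n\<rangle>\<close> pairs two sequences whose weak
  convergence alone would not determine its limit; it vanishes because \<open>M (a n) \<rightarrow> 0\<close> in norm.
\<close>
lemma cluster_point_KT:
  assumes r: "strict_mono r" and l: "u \<in> V" "s \<in> W"
    and wl: "converges_weakly V (w \<circ> r) u" and vl: "converges_weakly W (v \<circ> r) s"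
    and bnd: "\<And>n. norm (a n) \<le> B"
    and wa: "(\<lambda>n. a n - w n) \<longlonglongrightarrow> 0" and ve: "(\<lambda>n. e' n - v n) \<longlonglongrightarrow> 0"
    and wsa: "(\<lambda>n. a n - ws n) \<longlonglongrightarrow> 0" and p0: "p \<longlonglongrightarrow> 0" and Ma: "(\<lambda>n. M (a n)) \<longlonglongrightarrow> 0"
    and e'B: "\<And>n. norm (e' n) \<le> B'"
  shows "(u, s) \<in> KT"
proof -
  have al: "converges_weakly V (a \<circ> r) u"
    using wl by (rule converges_weakly_perturb) (use LIMSEQ_subseq_LIMSEQ[OF wa r] in \<open>simp add: o_def\<close>)
  have el: "converges_weakly W (e' \<circ> r) s"
    using vl by (rule converges_weakly_perturb) (use LIMSEQ_subseq_LIMSEQ[OF ve r] in \<open>simp add: o_def\<close>)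
  have ar: "(a \<circ> r) n \<in> V" for n using a_in by simp
  \<comment> \<open>the weak limit of \<open>M (a (r n))\<close> is \<open>M u\<close>, its strong limit is 0\<close>
  have Mu: "M u = 0"
  proof -
    have MuW: "M u \<in> W" using M_in l by simp
    have "(\<lambda>n. inner ((a \<circ> r) n) (N (M u))) \<longlonglongrightarrow> inner u (N (M u))"
      using al N_in[OF MuW] by (simp add: converges_weakly_def)
    moreover have "(\<lambda>n. inner ((a \<circ> r) n) (N (M u))) \<longlonglongrightarrow> inner 0 (M u)"
    proof -
      have "(\<lambda>n. inner (M (a (r n))) (M u)) \<longlonglongrightarrow> inner 0 (M u)"
        using LIMSEQ_subseq_LIMSEQ[OF Ma r] by (intro tendsto_inner tendsto_const) (simp add: o_def)
      then show ?thesis using N[OF a_in MuW] by simp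
    qed
    ultimately have "inner (M u) (M u) = 0"
      using N[OF l(1) MuW] LIMSEQ_unique by fastforce
    then show ?thesis by simp
  qed
  define z where "z n = p n + (C (a n) - C (ws n))" for n
  have "(\<lambda>n. C (a n) - C (ws n)) \<longlonglongrightarrow> 0"
  proof (rule Lim_null_comparison[OF always_eventually])
    show "\<forall>n. norm (C (a n) - C (ws n)) \<le> inverse \<alpha> * norm (a n - ws n)"
      using C_lipschitz[OF a_in ws_in] by blast
    show "(\<lambda>n. inverse \<alpha> * norm (a n - ws n)) \<longlonglongrightarrow> 0"
      using tendsto_mult_right_zero[OF tendsto_norm_zero[OF wsa]] by blast
  qed
  then have z0: "z \<longlonglongrightarrow> 0" unfolding z_def using tendsto_add[OF p0] by force
  have saddle: "F u + ereal (S u) \<le> F y + ereal (S y + inner (M y) s)" if y: "y \<in> V" for y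
  proof (cases "F y")
    case (real q)
    \<comment> \<open>an upper bound of \<open>F (a n)\<close> that converges along the subsequence\<close>
    define U where "U n = q + S y - S u - inner (a n - u) (C u + R u) + inner (M y) (e' n)
      - inner (M (a n)) (e' n) - inner (y - a n) (z n)" for n
    have "F (a n) \<le> ereal (U n)" for n
    proof -
      obtain f where f: "F (a n) = ereal f" using subgradient_finite[OF a_in subgradient] .
      have 1: "inner (y - a n) (a' n - C (ws n)) + f \<le> q"
        using subgradient[of n] y by (force simp: subdifferential_def real f)
      have 2: "S (a n) + inner (y - a n) (C (a n) + R (a n)) \<le> S y" by (rule S_gradient[OF a_in y])
      have 3: "S u + inner (a n - u) (C u + R u) \<le> S (a n)" by (rule S_gradient[OF l(1) a_in])
      have "a' n - C (ws n) = z n - (C (a n) + R (a n)) - N (e' n)" by (simp add: z_def p)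
      then have 4: "inner (y - a n) (a' n - C (ws n))
          = inner (y - a n) (z n) - inner (y - a n) (C (a n) + R (a n)) - inner (y - a n) (N (e' n))"
        by (simp only: inner_diff_right)
      have 5: "inner (y - a n) (N (e' n)) = inner (M y) (e' n) - inner (M (a n)) (e' n)"
        using N[OF _ e'_in[of n], of "y - a n"] M_diff[OF y a_in[of n]] y a_in[of n] subV
        by (simp add: subspace_diff inner_diff_left)
      show ?thesis unfolding f U_def using 1 2 3 4 5 by simp
    qed
    note upper = this
    have "(\<lambda>n. U (r n)) \<longlonglongrightarrow> q + S y - S u - 0 + inner (M y) s - 0 - 0"
      unfolding U_def
    proof (intro tendsto_diff tendsto_add tendsto_const)
      have CR: "C u + R u \<in> V" using l C_in R_in subV by (simp add: subspace_add)
      then have "(\<lambda>n. inner (a (r n)) (C u + R u) - inner u (C u + R u)) \<longlonglongrightarrow> inner u (C u + R u) - inner u (C u + R u)"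
        using al by (intro tendsto_diff tendsto_const) (simp add: converges_weakly_def)
      then show "(\<lambda>n. inner (a (r n) - u) (C u + R u)) \<longlonglongrightarrow> 0" by (simp add: inner_diff_left)
      have "(\<lambda>n. inner (e' (r n)) (M y)) \<longlonglongrightarrow> inner s (M y)"
        using el M_in[OF y] by (simp add: converges_weakly_def)
      then show "(\<lambda>n. inner (M y) (e' (r n))) \<longlonglongrightarrow> inner (M y) s" by (simp add: inner_commute)
      show "(\<lambda>n. inner (M (a (r n))) (e' (r n))) \<longlonglongrightarrow> 0"
        using LIMSEQ_subseq_LIMSEQ[OF tendsto_inner_zero[OF Ma e'B] r] by (simp add: o_def)
      have "norm (y - a n) \<le> norm y + B" for n
        using norm_triangle_ineq4[of y "a n"] bnd[of n] by simp
      from LIMSEQ_subseq_LIMSEQ[OF tendsto_inner_zero[OF z0 this] r]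
      show "(\<lambda>n. inner (y - a (r n)) (z (r n))) \<longlonglongrightarrow> 0" by (simp add: o_def inner_commute)
    qed
    then have U: "(\<lambda>n. ereal (U (r n))) \<longlonglongrightarrow> ereal (q + S y - S u + inner (M y) s)"
      by (intro tendsto_ereal) simp
    have "F u \<le> liminf (\<lambda>n. F ((a \<circ> r) n))"
      using F ar l(1) al unfolding weakly_lsc_convex_on_def by blast
    also have "\<dots> \<le> liminf (\<lambda>n. ereal (U (r n)))"
      using upper by (intro Liminf_mono always_eventually) simp
    also have "\<dots> = ereal (q + S y - S u + inner (M y) s)"
      using U by (intro lim_imp_Liminf) auto
    finally show ?thesis using F_not_MInfty[OF l(1)] by (cases "F u") (auto simp: real)
  qed (use F_not_MInfty[OF y] in auto)
  show ?thesis by (rule saddle_KT[OF l Mu saddle])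
qed

text \<open>
  Here \<open>a' n\<close> and \<open>e' n\<close> come from a resolvent step at \<open>w n\<close> with preconditioned residual \<open>c n\<close>, up to errors
  \<open>rem\<close> and \<open>rem'\<close> that tend to zero. Inserting this into \<open>\<Delta> n\<close> cancels all the terms with \<open>N\<close> and leaves
  \<open>\<langle>w n - a n, c n + R (a n) - R (w n)\<rangle> + \<langle>M (w n), s n\<rangle> - (4\<alpha>)\<^sup>-\<^sup>1 \<parallel>a n - ws n\<parallel>\<^sup>2\<close> plus inner products of \<open>rem\<close> and \<open>rem'\<close> with
  bounded sequences. As \<open>\<sigma> > 1/(4\<alpha>)\<close>, the first two terms dominate the third, and the upper bound
  on the positive part of \<open>\<Delta> n\<close> from Fejer monotonicity forces them to zero.
\<close>
lemma weak_convergence: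
  fixes c rem :: "nat \<Rightarrow> 'a" and s rem' :: "nat \<Rightarrow> 'b"
  assumes KT: "KT \<noteq> {}"
    and a'_eq: "\<And>n. a' n = c n - R (w n) - N (v n) + rem n" and rem: "rem \<longlonglongrightarrow> 0"
    and c_mono: "\<And>n. \<sigma> * (norm (w n - a n))\<^sup>2 \<le> inner (w n - a n) (c n + R (a n) - R (w n))"
    and c_bound: "\<And>n. norm (c n) \<le> \<kappa> * norm (w n - a n)"
    and e'_eq: "\<And>n. e' n = v n + s n + rem' n" and rem': "rem' \<longlonglongrightarrow> 0"
    and s_mono: "\<And>n. \<rho> * (norm (M (w n)))\<^sup>2 \<le> inner (M (w n)) (s n)"
    and s_bound: "\<And>n. norm (s n) \<le> \<kappa> * norm (M (w n))"
    and ws: "(\<lambda>n. ws n - w n) \<longlonglongrightarrow> 0"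
    and \<rho>: "\<rho> > 0" and \<sigma>: "\<sigma> > inverse (4 * \<alpha>)"
  shows "\<exists>u s. (u, s) \<in> KT \<and> converges_weakly V w u \<and> converges_weakly V a u"
proof -
  have \<sigma>0: "\<sigma> > 0" using \<sigma> \<alpha> by (metis inverse_positive_iff_positive less_trans mult_pos_pos zero_less_numeral)
  obtain Bw where Bw: "\<And>n. norm (w n) \<le> Bw" "\<And>n. norm (v n) \<le> Bw" using X_bounded[OF KT] by blast
  have bdd: "\<exists>B. \<forall>n. norm (f n) \<le> B" if "f \<longlonglongrightarrow> 0" for f :: "nat \<Rightarrow> 'c::real_normed_vector"
    using convergent_imp_Bseq[of f] that by (auto simp: convergent_def Bseq_def)
  obtain Br where Br: "\<And>n. norm (rem n) \<le> Br" using bdd[OF rem] by blast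
  obtain Br' where Br': "\<And>n. norm (rem' n) \<le> Br'" using bdd[OF rem'] by blast
  obtain Bs where Bs: "\<And>n. norm (ws n - w n) \<le> Bs" using bdd[OF ws] by blast
  obtain BM where BM: "BM > 0" "\<And>u. u \<in> V \<Longrightarrow> norm (M u) \<le> BM * norm u" using M_bound by blast
  obtain BN where BN: "BN > 0" "\<And>s. s \<in> W \<Longrightarrow> norm (N s) \<le> BN * norm s" using N_bound by blast
  define D where "D n = norm (w n - a n)" for n
  have D0: "D n \<ge> 0" for n by (simp add: D_def)
  have \<kappa>D: "norm (c n) \<le> \<bar>\<kappa>\<bar> * D n" for n
    using c_bound[of n] mult_right_mono[OF abs_ge_self[of \<kappa>] D0[of n]] by (simp add: D_def)
  \<comment> \<open>monotonicity of the subdifferential against a Kuhn-Tucker point bounds the iterates\<close>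
  obtain BD where BD: "\<And>n. D n \<le> BD"
  proof -
    obtain u t where ut: "(u, t) \<in> KT" using KT by auto
    then have u: "u \<in> V" "t \<in> W" and sg: "- N t - C u - R u \<in> subdifferential V F u" by (auto simp: KT_def)
    define b where "b n = (R u - R (w n)) + N (t - v n) + rem n + (C u - C (ws n))" for n
    define Bx where "Bx = Bw + norm u"
    have wu: "norm (w n - u) \<le> Bx" for n
      using norm_triangle_ineq4[of "w n" u] Bw(1)[of n] by (simp add: Bx_def)
    have "\<exists>Bb. \<forall>n. norm (b n) \<le> Bb"
    proof (intro exI allI)
      fix n
      have "norm (R u - R (w n)) \<le> \<bar>K\<bar> * Bx"
      proof -
        have "norm (R u - R (w n)) \<le> K * norm (u - w n)" by (rule R_lipschitz[OF u(1) w_in])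
        also have "\<dots> \<le> \<bar>K\<bar> * norm (u - w n)" by (intro mult_right_mono) auto
        also have "\<dots> \<le> \<bar>K\<bar> * Bx" using wu[of n] by (intro mult_left_mono) (auto simp: norm_minus_commute)
        finally show ?thesis .
      qed
      moreover have "norm (N (t - v n)) \<le> BN * (norm t + Bw)"
      proof -
        have "norm (N (t - v n)) \<le> BN * norm (t - v n)" using u v_in subW by (intro BN subspace_diff)
        also have "\<dots> \<le> BN * (norm t + Bw)"
          using BN(1) norm_triangle_ineq4[of t "v n"] Bw(2)[of n] by (intro mult_left_mono) auto
        finally show ?thesis .
      qed
      moreover have "norm (C u - C (ws n)) \<le> inverse \<alpha> * (Bx + Bs)"
      proof -
        have "norm (C u - C (ws n)) \<le> inverse \<alpha> * norm (u - ws n)" by (rule C_lipschitz[OF u(1) ws_in])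
        also have "\<dots> \<le> inverse \<alpha> * (Bx + Bs)"
          using \<alpha> norm_triangle_ineq4[of "w n - u" "w n - ws n"] wu[of n] Bs[of n]
          by (intro mult_left_mono) (auto simp: norm_minus_commute)
        finally show ?thesis .
      qed
      ultimately show "norm (b n) \<le> \<bar>K\<bar> * Bx + BN * (norm t + Bw) + Br + inverse \<alpha> * (Bx + Bs)"
        unfolding b_def using Br[of n]
          norm_add4_le[of "R u - R (w n)" "N (t - v n)" "rem n" "C u - C (ws n)"] by linarith
    qed
    then obtain Bb where Bb: "\<And>n. norm (b n) \<le> Bb" by blast
    have Bb0: "Bb \<ge> 0" and Bx0: "Bx \<ge> 0"
      using order_trans[OF norm_ge_zero Bb] order_trans[OF norm_ge_zero wu] by auto
    have "D n \<le> 1 + (\<bar>\<kappa>\<bar> * Bx + Bb + Bb * Bx) / \<sigma>" for n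
    proof (cases "D n \<le> 1")
      case True
      then show ?thesis using Bb0 Bx0 \<sigma>0 by (simp add: add_increasing2)
    next
      case False
      have "0 \<le> inner (a n - u) ((a' n - C (ws n)) - (- N t - C u - R u))"
        by (rule subdifferential_monotone[OF a_in subgradient u(1) sg])
      also have "(a' n - C (ws n)) - (- N t - C u - R u) = c n + b n"
        unfolding a'_eq b_def N_diff[OF u(2) v_in] by simp
      also have "inner (a n - u) (c n + b n) = - inner (w n - a n) (c n) + inner (w n - u) (c n) + inner (a n - u) (b n)"
        by (simp add: inner_add_right inner_diff_left)
      finally have 1: "inner (w n - a n) (c n) \<le> inner (w n - u) (c n) + inner (a n - u) (b n)" by simp
      have 2: "\<sigma> * (D n)\<^sup>2 \<le> inner (w n - a n) (c n)"
        using c_mono[of n] R_monotone[OF w_in a_in, of n n] by (simp add: D_def inner_diff_right inner_add_right)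
      have 3: "inner (w n - u) (c n) \<le> Bx * (\<bar>\<kappa>\<bar> * D n)"
        using norm_cauchy_schwarz[of "w n - u" "c n"] mult_mono[OF wu \<kappa>D Bx0 norm_ge_zero, of n n] by linarith
      have "norm (a n - u) \<le> D n + Bx"
        using norm_triangle_ineq[of "a n - w n" "w n - u"] wu[of n] by (simp add: D_def norm_minus_commute)
      then have 4: "inner (a n - u) (b n) \<le> (D n + Bx) * Bb"
        using norm_cauchy_schwarz[of "a n - u" "b n"] mult_mono[OF _ Bb _ norm_ge_zero, of "norm (a n - u)" "D n + Bx" n]
          D0[of n] Bx0 by linarith
      \<comment> \<open>with \<open>D n > 1\<close> the constant term is absorbed into the linear one\<close>
      have "Bb * Bx \<le> D n * (Bb * Bx)" using False Bb0 Bx0 mult_right_mono[of 1 "D n" "Bb * Bx"] by simp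
      then have "D n * (\<sigma> * D n) \<le> D n * (\<bar>\<kappa>\<bar> * Bx + Bb + Bb * Bx)"
        using 1 2 3 4 by (simp add: power2_eq_square algebra_simps)
      then have "\<sigma> * D n \<le> \<bar>\<kappa>\<bar> * Bx + Bb + Bb * Bx" using False by simp
      then show ?thesis using \<sigma>0 by (simp add: field_simps)
    qed
    then show ?thesis using that by blast
  qed
  have \<kappa>M: "norm (s n) \<le> \<bar>\<kappa>\<bar> * norm (M (w n))" for n
    using s_bound[of n] mult_right_mono[OF abs_ge_self[of \<kappa>] norm_ge_zero[of "M (w n)"]] by linarith
  have ev_in: "e' n - v n \<in> W" for n using e'_in v_in subW by (simp add: subspace_diff)
  have p_eq: "p n = c n + (R (a n) - R (w n)) + N (e' n - v n) + rem n" for n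
    unfolding p a'_eq N_diff[OF e'_in v_in] by simp
  have p_bound: "norm (p n) \<le> \<bar>\<kappa>\<bar> * D n + \<bar>K\<bar> * D n + BN * (\<bar>\<kappa>\<bar> * norm (M (w n)) + norm (rem' n)) + norm (rem n)" for n
  proof -
    have "norm (R (a n) - R (w n)) \<le> \<bar>K\<bar> * D n"
      using R_lipschitz[OF a_in w_in, of n n] mult_right_mono[OF abs_ge_self[of K] norm_ge_zero[of "a n - w n"]]
      by (simp add: D_def norm_minus_commute)
    moreover have "norm (N (e' n - v n)) \<le> BN * (\<bar>\<kappa>\<bar> * norm (M (w n)) + norm (rem' n))"
    proof -
      have "norm (e' n - v n) \<le> \<bar>\<kappa>\<bar> * norm (M (w n)) + norm (rem' n)"
        using norm_triangle_ineq[of "s n" "rem' n"] \<kappa>M[of n] by (simp add: e'_eq)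
      then have "BN * norm (e' n - v n) \<le> BN * (\<bar>\<kappa>\<bar> * norm (M (w n)) + norm (rem' n))"
        using BN(1) by (intro mult_left_mono) auto
      then show ?thesis using BN(2)[OF ev_in[of n]] by linarith
    qed
    ultimately show ?thesis unfolding p_eq using \<kappa>D[of n]
        norm_add4_le[of "c n" "R (a n) - R (w n)" "N (e' n - v n)" "rem n"] by linarith
  qed
  have Mw_bound: "norm (M (w n)) \<le> BM * Bw" for n
    using BM(2)[OF w_in[of n]] mult_left_mono[OF Bw(1)[of n], of BM] BM(1) by linarith
  have Ma_bound: "norm (M (a n)) \<le> norm (M (w n)) + BM * D n" for n
  proof -
    have "M (w n - a n) = M (w n) - M (a n)" by (rule M_diff[OF w_in a_in])
    then have "norm (M (w n) - M (a n)) \<le> BM * D n"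
      using BM(2)[of "w n - a n"] w_in a_in subV by (simp add: D_def subspace_diff)
    then show ?thesis using norm_triangle_ineq2[of "M (a n)" "M (w n)"] by (simp add: norm_minus_commute)
  qed
  \<comment> \<open>the adjoint relation moves \<open>N (e' n - v n)\<close> over to \<open>M (w n) - M (a n)\<close>, and \<open>M (a n)\<close> cancels\<close>
  have \<Delta>_eq: "\<Delta> n = - inverse (4 * \<alpha>) * (norm (a n - ws n))\<^sup>2 + inner (w n - a n) (c n + R (a n) - R (w n))
      + inner (w n - a n) (rem n) + inner (M (w n)) (s n) + inner (M (w n)) (rem' n)" for n
  proof -
    have "inner (w n - a n) (N (e' n - v n)) = inner (M (w n) - M (a n)) (e' n - v n)"
      using N[OF _ ev_in[of n], of "w n - a n"] M_diff[OF w_in a_in, of n n] w_in[of n] a_in[of n] subV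
      by (simp add: subspace_diff)
    moreover have "inner (w n - a n) (p n) = inner (w n - a n) (c n + R (a n) - R (w n))
        + inner (w n - a n) (N (e' n - v n)) + inner (w n - a n) (rem n)"
      unfolding p_eq by (simp add: inner_add_right inner_diff_right)
    moreover have "inner (M (w n)) (e' n - v n) = inner (M (w n)) (s n) + inner (M (w n)) (rem' n)"
      by (simp add: e'_eq inner_add_right)
    moreover have "inner (M (w n) - M (a n)) (e' n - v n) - inner (M (a n)) (v n - e' n)
        = inner (M (w n)) (e' n - v n)"
      by (simp add: inner_diff_left inner_diff_right)
    ultimately show ?thesis unfolding \<Delta> by linarith
  qed
  define \<tau> where "\<tau> = \<sigma> - inverse (4 * \<alpha>)"
  have \<tau>: "\<tau> > 0" using \<sigma> by (simp add: \<tau>_def)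
  \<comment> \<open>the error terms: expanding \<open>(D n + \<parallel>ws n - w n\<parallel>)\<^sup>2\<close> accounts for the factor 2\<close>
  define E where "E n = max (\<Delta> n) 0 + inverse (4 * \<alpha>) * (2 * (norm (ws n - w n) * D n) + (norm (ws n - w n))\<^sup>2)
      - inner (rem n) (w n - a n) - inner (rem' n) (M (w n))" for n
  have lower: "\<tau> * (D n)\<^sup>2 + \<rho> * (norm (M (w n)))\<^sup>2 \<le> E n" for n
  proof -
    have "(norm (a n - ws n))\<^sup>2 \<le> (D n + norm (ws n - w n))\<^sup>2"
      using norm_triangle_ineq[of "a n - w n" "w n - ws n"]
      by (intro power_mono) (simp_all add: D_def norm_minus_commute)
    then have "inverse (4 * \<alpha>) * (norm (a n - ws n))\<^sup>2
        \<le> inverse (4 * \<alpha>) * ((D n)\<^sup>2 + (2 * (norm (ws n - w n) * D n) + (norm (ws n - w n))\<^sup>2))"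
      using \<alpha> by (intro mult_left_mono) (simp_all add: power2_sum mult_ac add_ac)
    moreover have "\<Delta> n \<le> max (\<Delta> n) 0" by simp
    ultimately show ?thesis
      using c_mono[of n] s_mono[of n] \<Delta>_eq[of n]
      unfolding E_def \<tau>_def D_def[symmetric] by (simp add: distrib_left left_diff_distrib inner_commute)
  qed
  have "(\<lambda>n. max (\<Delta> n) 0) \<longlonglongrightarrow> 0"
  proof -
    define BX where "BX = \<bar>\<kappa>\<bar> * BD + \<bar>K\<bar> * BD + BN * (\<bar>\<kappa>\<bar> * (BM * Bw) + Br') + Br + (BM * Bw + BM * BD)"
    have pB: "norm (p n, - M (a n)) \<le> BX" for n
    proof -
      have "norm (p n, - M (a n)) \<le> norm (p n) + norm (M (a n))"
        using norm_Pair_le[of "p n" "- M (a n)"] by simp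
      moreover have "norm (M (a n)) \<le> BM * Bw + BM * BD"
        using Ma_bound[of n] Mw_bound[of n] mult_left_mono[OF BD[of n], of BM] BM(1) by linarith
      moreover have "\<bar>\<kappa>\<bar> * D n \<le> \<bar>\<kappa>\<bar> * BD" "\<bar>K\<bar> * D n \<le> \<bar>K\<bar> * BD"
        using BD[of n] by (auto intro: mult_left_mono)
      moreover have "BN * (\<bar>\<kappa>\<bar> * norm (M (w n)) + norm (rem' n)) \<le> BN * (\<bar>\<kappa>\<bar> * (BM * Bw) + Br')"
        using BN(1) Mw_bound[of n] Br'[of n] by (intro mult_left_mono add_mono) auto
      ultimately show ?thesis unfolding BX_def using p_bound[of n] Br[of n] by linarith
    qed
    show ?thesis
    proof (rule Lim_null_comparison[OF always_eventually])
      show "\<forall>n. norm (max (\<Delta> n) 0) \<le> BX / \<epsilon> * norm (X (Suc n) - X n)"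
      proof
        fix n
        have "\<epsilon> * max (\<Delta> n) 0 \<le> BX * norm (X (Suc n) - X n)"
          using \<Delta>_le[OF KT, of n] mult_right_mono[OF pB[of n] norm_ge_zero[of "X (Suc n) - X n"]] by linarith
        then have "max (\<Delta> n) 0 \<le> BX * norm (X (Suc n) - X n) / \<epsilon>"
          by (intro mult_imp_le_div_pos[OF \<epsilon>]) (simp only: mult.commute)
        moreover have "norm (max (\<Delta> n) 0) = max (\<Delta> n) 0" by simp
        ultimately show "norm (max (\<Delta> n) 0) \<le> BX / \<epsilon> * norm (X (Suc n) - X n)" by simp
      qed
      show "(\<lambda>n. BX / \<epsilon> * norm (X (Suc n) - X n)) \<longlonglongrightarrow> 0"
        using tendsto_mult_right_zero[OF tendsto_norm_zero[OF X_steps_vanish[OF KT]]] by blast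
    qed
  qed
  moreover have "(\<lambda>n. norm (ws n - w n) * D n) \<longlonglongrightarrow> 0"
  proof (rule Lim_null_comparison[OF always_eventually])
    show "\<forall>n. norm (norm (ws n - w n) * D n) \<le> norm (ws n - w n) * BD"
      using BD D0 by (auto simp: abs_mult intro: mult_left_mono)
    show "(\<lambda>n. norm (ws n - w n) * BD) \<longlonglongrightarrow> 0"
      using tendsto_mult_left_zero[OF tendsto_norm_zero[OF ws]] by blast
  qed
  moreover have "(\<lambda>n. (norm (ws n - w n))\<^sup>2) \<longlonglongrightarrow> 0"
    using tendsto_power[OF tendsto_norm_zero[OF ws], of 2] by simp
  moreover have "(\<lambda>n. inner (rem n) (w n - a n)) \<longlonglongrightarrow> 0"
    using BD by (intro tendsto_inner_zero[OF rem, of _ BD]) (simp add: D_def)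
  moreover have "(\<lambda>n. inner (rem' n) (M (w n))) \<longlonglongrightarrow> 0"
    using Mw_bound by (intro tendsto_inner_zero[OF rem'])
  ultimately have "E \<longlonglongrightarrow> 0 + inverse (4 * \<alpha>) * (2 * 0 + 0) - 0 - 0"
    unfolding E_def by (intro tendsto_intros)
  then have E0: "E \<longlonglongrightarrow> 0" by simp
  have D2: "(\<lambda>n. (norm (w n - a n))\<^sup>2) \<longlonglongrightarrow> 0"
  proof (rule Lim_null_comparison[OF always_eventually])
    show "\<forall>n. norm ((norm (w n - a n))\<^sup>2) \<le> inverse \<tau> * E n"
    proof
      fix n
      have "0 \<le> \<rho> * (norm (M (w n)))\<^sup>2" using \<rho> by simp
      then have "\<tau> * (D n)\<^sup>2 \<le> E n" using lower[of n] by linarith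
      then show "norm ((norm (w n - a n))\<^sup>2) \<le> inverse \<tau> * E n"
        using \<tau> by (simp add: D_def field_simps)
    qed
    show "(\<lambda>n. inverse \<tau> * E n) \<longlonglongrightarrow> 0" using tendsto_mult_right_zero[OF E0] by blast
  qed
  have M2: "(\<lambda>n. (norm (M (w n)))\<^sup>2) \<longlonglongrightarrow> 0"
  proof (rule Lim_null_comparison[OF always_eventually])
    show "\<forall>n. norm ((norm (M (w n)))\<^sup>2) \<le> inverse \<rho> * E n"
    proof
      fix n
      have "0 \<le> \<tau> * (D n)\<^sup>2" using \<tau> by simp
      then have "\<rho> * (norm (M (w n)))\<^sup>2 \<le> E n" using lower[of n] by linarith
      then show "norm ((norm (M (w n)))\<^sup>2) \<le> inverse \<rho> * E n"
        using \<rho> by (simp add: field_simps)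
    qed
    show "(\<lambda>n. inverse \<rho> * E n) \<longlonglongrightarrow> 0" using tendsto_mult_right_zero[OF E0] by blast
  qed
  have wa0: "(\<lambda>n. w n - a n) \<longlonglongrightarrow> 0" by (rule tendsto_norm_power2_zero[OF D2])
  have Mw0: "(\<lambda>n. M (w n)) \<longlonglongrightarrow> 0" by (rule tendsto_norm_power2_zero[OF M2])
  have D_0: "D \<longlonglongrightarrow> 0" unfolding D_def using tendsto_norm_zero[OF wa0] by simp
  have aw0: "(\<lambda>n. a n - w n) \<longlonglongrightarrow> 0" using tendsto_minus[OF wa0] by simp
  have aws0: "(\<lambda>n. a n - ws n) \<longlonglongrightarrow> 0" using tendsto_diff[OF aw0 ws] by simp
  have Ma0: "(\<lambda>n. M (a n)) \<longlonglongrightarrow> 0"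
  proof (rule Lim_null_comparison[OF always_eventually])
    show "\<forall>n. norm (M (a n)) \<le> norm (M (w n)) + BM * D n" using Ma_bound by blast
    show "(\<lambda>n. norm (M (w n)) + BM * D n) \<longlonglongrightarrow> 0"
      using Mw0 D_0 by (auto intro!: tendsto_eq_intros)
  qed
  have ev0: "(\<lambda>n. e' n - v n) \<longlonglongrightarrow> 0"
  proof (rule Lim_null_comparison[OF always_eventually])
    show "\<forall>n. norm (e' n - v n) \<le> \<bar>\<kappa>\<bar> * norm (M (w n)) + norm (rem' n)"
    proof
      fix n show "norm (e' n - v n) \<le> \<bar>\<kappa>\<bar> * norm (M (w n)) + norm (rem' n)"
        using norm_triangle_ineq[of "s n" "rem' n"] \<kappa>M[of n] by (simp add: e'_eq)
    qed
    show "(\<lambda>n. \<bar>\<kappa>\<bar> * norm (M (w n)) + norm (rem' n)) \<longlonglongrightarrow> 0"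
      using Mw0 rem' by (auto intro!: tendsto_eq_intros)
  qed
  have p0: "p \<longlonglongrightarrow> 0"
  proof (rule Lim_null_comparison[OF always_eventually])
    show "\<forall>n. norm (p n) \<le> \<bar>\<kappa>\<bar> * D n + \<bar>K\<bar> * D n + BN * (\<bar>\<kappa>\<bar> * norm (M (w n)) + norm (rem' n)) + norm (rem n)"
      using p_bound by blast
    show "(\<lambda>n. \<bar>\<kappa>\<bar> * D n + \<bar>K\<bar> * D n + BN * (\<bar>\<kappa>\<bar> * norm (M (w n)) + norm (rem' n)) + norm (rem n)) \<longlonglongrightarrow> 0"
      using Mw0 rem' rem D_0
      by (auto intro!: tendsto_eq_intros)
  qed
  have aB: "norm (a n) \<le> Bw + BD" for n
    using Bw(1)[of n] BD[of n] norm_triangle_ineq4[of "w n" "w n - a n"] by (simp add: D_def)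
  obtain Be where Be: "\<And>n. norm (e' n - v n) \<le> Be" using bdd[OF ev0] by blast
  have e'B: "norm (e' n) \<le> Bw + Be" for n
    using Bw(2)[of n] Be[of n] norm_triangle_ineq[of "v n" "e' n - v n"] by simp
  have VW: "hilbert_space (V \<times> W)" by (rule hilbert_space_Times[OF V W])
  obtain q where q: "q \<in> KT" "converges_weakly (V \<times> W) X q"
  proof (rule Opial[OF VW _ KT])
    show "X n \<in> V \<times> W" for n using w_in v_in by (simp add: X_def)
    show "KT \<subseteq> V \<times> W" by (auto simp: KT_def)
    show "convergent (\<lambda>n. norm (X n - c))" if "c \<in> KT" for c by (rule X_Fejer_convergent[OF that])
    fix l r assume l: "l \<in> V \<times> W" and r: "strict_mono (r :: nat \<Rightarrow> nat)" and wk: "converges_weakly (V \<times> W) (X \<circ> r) l"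
    obtain u t where ut: "l = (u, t)" by (cases l)
    have "converges_weakly V (w \<circ> r) u"
      unfolding converges_weakly_def
    proof
      fix y assume "y \<in> V"
      then have "(y, 0) \<in> V \<times> W" using subW by (simp add: subspace_0)
      then show "(\<lambda>n. inner ((w \<circ> r) n) y) \<longlonglongrightarrow> inner u y"
        using wk unfolding converges_weakly_def ut by (auto dest!: bspec simp: X_def)
    qed
    moreover have "converges_weakly W (v \<circ> r) t"
      unfolding converges_weakly_def
    proof
      fix y assume "y \<in> W"
      then have "(0, y) \<in> V \<times> W" using subV by (simp add: subspace_0)
      then show "(\<lambda>n. inner ((v \<circ> r) n) y) \<longlonglongrightarrow> inner t y"
        using wk unfolding converges_weakly_def ut by (auto dest!: bspec simp: X_def)
    qed
    ultimately show "l \<in> KT"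
      using cluster_point_KT[OF r _ _ _ _ aB aw0 ev0 aws0 p0 Ma0 e'B] l by (simp add: ut)
  qed
  obtain u t where ut: "q = (u, t)" by (cases q)
  have "converges_weakly V w u"
    unfolding converges_weakly_def
  proof
    fix y assume "y \<in> V"
    then have "(y, 0) \<in> V \<times> W" using subW by (simp add: subspace_0)
    then show "(\<lambda>n. inner (w n) y) \<longlonglongrightarrow> inner u y"
      using q(2) unfolding converges_weakly_def ut by (auto dest!: bspec simp: X_def)
  qed
  moreover from this have "converges_weakly V a u" using aw0 by (rule converges_weakly_perturb)
  ultimately show ?thesis using q(1) ut by blast
qed

end

section \<open>The composite problem as a saddle problem\<close>
lemma weakly_lsc_convex_onD:
  assumes "weakly_lsc_convex_on V f"
  shows "x \<in> V \<Longrightarrow> f x \<noteq> -\<infinity>"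
    and "x \<in> V \<Longrightarrow> y \<in> V \<Longrightarrow> f x \<le> ereal r \<Longrightarrow> f y \<le> ereal s \<Longrightarrow> 0 \<le> t \<Longrightarrow> t \<le> 1 \<Longrightarrow>
        f ((1 - t) *\<^sub>R x + t *\<^sub>R y) \<le> ereal ((1 - t) * r + t * s)"
    and "(\<And>n. w n \<in> V) \<Longrightarrow> l \<in> V \<Longrightarrow> converges_weakly V w l \<Longrightarrow> f l \<le> liminf (\<lambda>n. f (w n))"
  using assms unfolding weakly_lsc_convex_on_def by blast+

lemma Gamma0_weakly_lsc_convex_on:
  assumes "hilbert_space V" "f \<in> Gamma0 V" shows "weakly_lsc_convex_on V f"
  unfolding weakly_lsc_convex_on_def
  using Gamma0_not_MInfty[OF assms(2)] Gamma0_convex[OF assms(2)] Gamma0_weakly_lsc[OF assms] by blast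

lemma weakly_lsc_convex_on_add:
  assumes f: "weakly_lsc_convex_on V f" and g: "weakly_lsc_convex_on V g"
  shows "weakly_lsc_convex_on V (\<lambda>x. f x + g x)"
  unfolding weakly_lsc_convex_on_def
proof (intro conjI ballI allI impI)
  fix x assume x: "x \<in> V"
  show "f x + g x \<noteq> -\<infinity>"
    using weakly_lsc_convex_onD(1)[OF f x] weakly_lsc_convex_onD(1)[OF g x] by simp
next
  fix x y r s and t :: real
  assume x: "x \<in> V" "f x + g x \<le> ereal r" and y: "y \<in> V" "f y + g y \<le> ereal s" and t: "0 \<le> t" "t \<le> 1"
  have split: "\<exists>r1 r2. f x = ereal r1 \<and> g x = ereal r2 \<and> r1 + r2 \<le> r"
    if "x \<in> V" "f x + g x \<le> ereal r" for x r
    using that weakly_lsc_convex_onD(1)[OF f that(1)] weakly_lsc_convex_onD(1)[OF g that(1)]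
    by (cases "f x"; cases "g x") auto
  obtain r1 r2 where r: "f x = ereal r1" "g x = ereal r2" "r1 + r2 \<le> r" using split x by blast
  obtain s1 s2 where s: "f y = ereal s1" "g y = ereal s2" "s1 + s2 \<le> s" using split y by blast
  let ?z = "(1 - t) *\<^sub>R x + t *\<^sub>R y"
  have "f ?z + g ?z \<le> ereal ((1 - t) * r1 + t * s1) + ereal ((1 - t) * r2 + t * s2)"
    using x y r s t by (intro add_mono weakly_lsc_convex_onD(2)[OF f] weakly_lsc_convex_onD(2)[OF g]) auto
  also have "\<dots> = ereal ((1 - t) * (r1 + r2) + t * (s1 + s2))" by (simp add: algebra_simps)
  also have "\<dots> \<le> ereal ((1 - t) * r + t * s)"
    using r s t by (simp add: add_mono mult_left_mono)
  finally show "f ?z + g ?z \<le> ereal ((1 - t) * r + t * s)" .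
next
  fix w l assume w: "\<forall>n. w n \<in> V" and l: "l \<in> V" and conv: "converges_weakly V w l"
  have fl: "f l \<le> liminf (\<lambda>n. f (w n))" and gl: "g l \<le> liminf (\<lambda>n. g (w n))"
    using weakly_lsc_convex_onD(3)[OF f] weakly_lsc_convex_onD(3)[OF g] w l conv by blast+
  then have "liminf (\<lambda>n. f (w n)) \<noteq> -\<infinity>" "liminf (\<lambda>n. g (w n)) \<noteq> -\<infinity>"
    using weakly_lsc_convex_onD(1)[OF f l] weakly_lsc_convex_onD(1)[OF g l] by auto
  then have "liminf (\<lambda>n. f (w n)) + liminf (\<lambda>n. g (w n)) \<le> liminf (\<lambda>n. f (w n) + g (w n))"
    by (intro ereal_liminf_add_mono) auto
  then show "f l + g l \<le> liminf (\<lambda>n. f (w n) + g (w n))"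
    using add_mono[OF fl gl] by (rule order_trans[rotated])
qed

lemma weakly_lsc_convex_on_sum:
  assumes "finite A" "\<And>i. i \<in> A \<Longrightarrow> weakly_lsc_convex_on V (f i)"
  shows "weakly_lsc_convex_on V (\<lambda>x. \<Sum>i\<in>A. f i x)"
  using assms
proof (induction A rule: finite_induct)
  case empty
  have "(0::ereal) \<le> liminf (\<lambda>n. 0)" by (simp add: Liminf_const)
  then show ?case
    by (auto simp: weakly_lsc_convex_on_def intro!: add_nonneg_nonneg mult_nonneg_nonneg)
next
  case (insert i A)
  then show ?case by (simp add: weakly_lsc_convex_on_add)
qed

text \<open>Precomposition with a map that has an adjoint; it will be applied to coordinate projections.\<close>
lemma weakly_lsc_convex_on_compose:
  assumes f: "weakly_lsc_convex_on U f" and \<pi>: "linear \<pi>" "\<And>x. x \<in> V \<Longrightarrow> \<pi> x \<in> U"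
    and adj: "\<And>u. u \<in> U \<Longrightarrow> \<pi>' u \<in> V" "\<And>x u. inner (\<pi> x) u = inner x (\<pi>' u)"
  shows "weakly_lsc_convex_on V (\<lambda>x. f (\<pi> x))"
  unfolding weakly_lsc_convex_on_def
proof (intro conjI ballI allI impI)
  fix x assume "x \<in> V" then show "f (\<pi> x) \<noteq> -\<infinity>" using weakly_lsc_convex_onD(1)[OF f] \<pi> by blast
next
  fix x y r s and t :: real
  assume "x \<in> V" "f (\<pi> x) \<le> ereal r" "y \<in> V" "f (\<pi> y) \<le> ereal s" "0 \<le> t" "t \<le> 1"
  moreover have "\<pi> ((1 - t) *\<^sub>R x + t *\<^sub>R y) = (1 - t) *\<^sub>R \<pi> x + t *\<^sub>R \<pi> y"
    by (simp only: linear_add[OF \<pi>(1)] linear_scale[OF \<pi>(1)])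
  ultimately show "f (\<pi> ((1 - t) *\<^sub>R x + t *\<^sub>R y)) \<le> ereal ((1 - t) * r + t * s)"
    using weakly_lsc_convex_onD(2)[OF f] \<pi>(2) by metis
next
  fix w l assume w: "\<forall>n. w n \<in> V" and l: "l \<in> V" and conv: "converges_weakly V w l"
  have "converges_weakly U (\<lambda>n. \<pi> (w n)) (\<pi> l)"
    using conv adj by (simp add: converges_weakly_def)
  then show "f (\<pi> l) \<le> liminf (\<lambda>n. f (\<pi> (w n)))"
    using weakly_lsc_convex_onD(3)[OF f, of "\<lambda>n. \<pi> (w n)"] w l \<pi>(2) by blast
qed

lemma le_add_INF:
  fixes c d :: ereal
  assumes "\<And>y. y \<in> Y \<Longrightarrow> c \<le> d + Q y"
  shows "c \<le> d + (INF y\<in>Y. Q y)"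
proof (cases d)
  case (real r)
  have "c - d \<le> (INF y\<in>Y. Q y)"
    using assms real by (intro INF_greatest) (simp add: ereal_minus_le add.commute)
  then show ?thesis using real by (simp add: ereal_minus_le add.commute)
next
  case MInf
  show ?thesis
  proof (cases "c = -\<infinity>")
    case False
    then have "Q y = \<infinity>" if "y \<in> Y" for y using assms[OF that] MInf by (cases "Q y") auto
    then have "\<infinity> \<le> (INF y\<in>Y. Q y)" by (intro INF_greatest) simp
    then show ?thesis using MInf by simp
  qed simp
qed simp

text \<open>
  A bound valid for every simultaneous choice of the \<open>y k\<close> survives taking the infima separately.
  The infima may be infinite with either sign, so they are taken one at a time, the terms already
  treated being moved into \<open>d\<close>.
\<close>
lemma le_sum_INF:
  fixes c :: ereal
  assumes "finite A" "\<And>k. Y k \<noteq> {}"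
    and "\<And>y. (\<And>k. y k \<in> Y k) \<Longrightarrow> c \<le> d + (\<Sum>k\<in>A. Q k (y k))"
  shows "c \<le> d + (\<Sum>k\<in>A. INF y\<in>Y k. Q k y)"
  using assms(1,3)
proof (induction A arbitrary: d rule: finite_induct)
  case empty
  have "(SOME y. y \<in> Y k) \<in> Y k" for k using assms(2)[of k] by (auto intro: someI)
  with empty(1)[of "\<lambda>k. SOME y. y \<in> Y k"] show ?case by simp
next
  case (insert k A)
  have "c \<le> (d + (INF y\<in>Y k. Q k y)) + (\<Sum>k\<in>A. INF y\<in>Y k. Q k y)"
  proof (rule insert.IH)
    fix y assume y: "\<And>k. y k \<in> Y k"
    have "c \<le> (d + (\<Sum>j\<in>A. Q j (y j))) + (INF y\<in>Y k. Q k y)"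
    proof (rule le_add_INF)
      fix u assume "u \<in> Y k"
      then have "c \<le> d + (\<Sum>j\<in>insert k A. Q j ((y(k := u)) j))"
        using y by (intro insert.prems) auto
      moreover have "(\<Sum>j\<in>A. Q j ((y(k := u)) j)) = (\<Sum>j\<in>A. Q j (y j))"
        using insert.hyps by (intro sum.cong) auto
      ultimately show "c \<le> (d + (\<Sum>j\<in>A. Q j (y j))) + Q k u"
        using insert.hyps by (simp add: ac_simps)
    qed
    then show "c \<le> (d + (INF y\<in>Y k. Q k y)) + (\<Sum>j\<in>A. Q j (y j))" by (simp add: ac_simps)
  qed
  then show ?case using insert.hyps by (simp add: ac_simps)
qed

lemma has_derivative_compose_adjoint:
  assumes \<phi>: "(\<phi> has_derivative (\<lambda>t. inner u t)) (at (\<pi> x) within U)"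
    and \<pi>: "bounded_linear \<pi>" "\<And>x. x \<in> V \<Longrightarrow> \<pi> x \<in> U" and adj: "\<And>t. inner (\<pi> t) u = inner t u'"
  shows "((\<lambda>x. \<phi> (\<pi> x)) has_derivative (\<lambda>t. inner u' t)) (at x within V)"
proof -
  have "((\<lambda>x. \<phi> (\<pi> x)) has_derivative (\<lambda>t. inner u (\<pi> t))) (at x within V)"
    using \<pi>(2) by (intro has_derivative_in_compose[OF bounded_linear_imp_has_derivative[OF \<pi>(1)]]
        has_derivative_subset[OF \<phi>]) auto
  moreover have "inner u (\<pi> t) = inner u' t" for t
    using adj[of t] by (metis inner_commute)
  ultimately show ?thesis by simp
qed

lemma norm_le_sum_components: "norm x \<le> (\<Sum>i\<in>UNIV. norm (x $ i))"
  for x :: "'a::real_normed_vector ^ 'i::finite"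
  unfolding norm_vec_def by (rule L2_set_le_sum) simp

locale composite_minimization =
  fixes H :: "'i::finite \<Rightarrow> 'h::real_inner set"
    and G :: "'k::finite \<Rightarrow> 'g::real_inner set"
    and f :: "'i \<Rightarrow> 'h \<Rightarrow> ereal" and \<phi> :: "'i \<Rightarrow> 'h \<Rightarrow> real" and \<alpha> :: "'i \<Rightarrow> real"
    and g h :: "'k \<Rightarrow> 'g \<Rightarrow> ereal" and \<psi> :: "'k \<Rightarrow> 'g \<Rightarrow> real" and \<beta> :: "'k \<Rightarrow> real"
    and L :: "'k \<Rightarrow> 'i \<Rightarrow> 'h \<Rightarrow> 'g"
    and \<Theta> :: "'h ^ 'i \<Rightarrow> real"
    and chi alpha :: real
  assumes H: "\<And>i. hilbert_space (H i)"
    and G: "\<And>k. hilbert_space (G k)"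
    and f: "\<And>i. f i \<in> Gamma0 (H i)"
    and \<alpha>: "\<And>i. \<alpha> i > 0"
    and \<phi>: "\<And>i. convex_on (H i) (\<phi> i)" "\<And>i. \<phi> i differentiable_on H i"
      "\<And>i. (1 / \<alpha> i)-lipschitz_on (H i) (gradient_on (H i) (\<phi> i))"
    and g: "\<And>k. g k \<in> Gamma0 (G k)"
    and h: "\<And>k. h k \<in> Gamma0 (G k)"
    and \<beta>: "\<And>k. \<beta> k > 0"
    and \<psi>: "\<And>k. convex_on (G k) (\<psi> k)" "\<And>k. \<psi> k differentiable_on G k"
      "\<And>k. (1 / \<beta> k)-lipschitz_on (G k) (gradient_on (G k) (\<psi> k))"
    and L: "\<And>k i. bounded_linear_between (H i) (G k) (L k i)"
    and chi: "chi \<ge> 0"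
    and \<Theta>: "convex_on (hilbert_sum H) \<Theta>" "\<Theta> differentiable_on hilbert_sum H"
      "chi-lipschitz_on (hilbert_sum H) (gradient_on (hilbert_sum H) \<Theta>)"
    and alpha: "alpha = Min (range \<alpha> \<union> range \<beta>)"
begin

abbreviation "HH \<equiv> hilbert_sum H"
abbreviation "GG \<equiv> hilbert_sum G"

text \<open>
  The triples \<open>(x, y, z)\<close> carry the primal variable and, for each \<open>k\<close>, the two summands into which the
  infimal convolution splits \<open>L x\<close>.
\<close>
definition V :: "(('h ^ 'i) \<times> ('g ^ 'k) \<times> ('g ^ 'k)) set" where "V = HH \<times> GG \<times> GG"

definition Lx :: "'h ^ 'i \<Rightarrow> 'g ^ 'k" where "Lx x = (\<chi> k. \<Sum>i\<in>UNIV. L k i (x $ i))"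
definition Ladj :: "'g ^ 'k \<Rightarrow> 'h ^ 'i" where
  "Ladj v = (\<chi> i. \<Sum>k\<in>UNIV. adjoint_on (H i) (L k i) (v $ k))"

definition M :: "('h ^ 'i) \<times> ('g ^ 'k) \<times> ('g ^ 'k) \<Rightarrow> 'g ^ 'k" where
  "M = (\<lambda>(x, y, z). Lx x - y - z)"
definition N :: "'g ^ 'k \<Rightarrow> ('h ^ 'i) \<times> ('g ^ 'k) \<times> ('g ^ 'k)" where "N v = (Ladj v, - v, - v)"

definition F :: "('h ^ 'i) \<times> ('g ^ 'k) \<times> ('g ^ 'k) \<Rightarrow> ereal" where
  "F w = (\<Sum>i\<in>UNIV. f i (fst w $ i)) + ((\<Sum>k\<in>UNIV. g k (fst (snd w) $ k)) + (\<Sum>k\<in>UNIV. h k (snd (snd w) $ k)))"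
definition S :: "('h ^ 'i) \<times> ('g ^ 'k) \<times> ('g ^ 'k) \<Rightarrow> real" where
  "S w = (\<Sum>i\<in>UNIV. \<phi> i (fst w $ i)) + (\<Sum>k\<in>UNIV. \<psi> k (fst (snd w) $ k)) + \<Theta> (fst w)"

definition \<phi>' :: "'h ^ 'i \<Rightarrow> 'h ^ 'i" where "\<phi>' x = (\<chi> i. gradient_on (H i) (\<phi> i) (x $ i))"
definition \<psi>' :: "'g ^ 'k \<Rightarrow> 'g ^ 'k" where "\<psi>' y = (\<chi> k. gradient_on (G k) (\<psi> k) (y $ k))"
abbreviation "\<Theta>' \<equiv> gradient_on HH \<Theta>"

definition C :: "('h ^ 'i) \<times> ('g ^ 'k) \<times> ('g ^ 'k) \<Rightarrow> ('h ^ 'i) \<times> ('g ^ 'k) \<times> ('g ^ 'k)" where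
  "C = (\<lambda>(x, y, z). (\<phi>' x, \<psi>' y, 0))"
definition R :: "('h ^ 'i) \<times> ('g ^ 'k) \<times> ('g ^ 'k) \<Rightarrow> ('h ^ 'i) \<times> ('g ^ 'k) \<times> ('g ^ 'k)" where
  "R = (\<lambda>(x, y, z). (\<Theta>' x, 0, 0))"

lemma HH: "hilbert_space HH" and GG: "hilbert_space GG"
  by (rule hilbert_space_hilbert_sum[OF H], rule hilbert_space_hilbert_sum[OF G])

lemma subHH: "subspace HH" and subGG: "subspace GG" and subH: "subspace (H i)" and subG: "subspace (G k)"
  using HH GG H G by (auto simp: hilbert_space_def)

lemma V: "hilbert_space V"
  unfolding V_def by (intro hilbert_space_Times HH GG)

lemma V_iff: "(x, y, z) \<in> V \<longleftrightarrow> x \<in> HH \<and> y \<in> GG \<and> z \<in> GG"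
  by (simp add: V_def)

lemma HH_nth: "x \<in> HH \<Longrightarrow> x $ i \<in> H i" and GG_nth: "y \<in> GG \<Longrightarrow> y $ k \<in> G k"
  by (auto simp: hilbert_sum_def)

lemma alpha_pos: "alpha > 0" and alpha_le_\<alpha>: "alpha \<le> \<alpha> i" and alpha_le_\<beta>: "alpha \<le> \<beta> k"
  using \<alpha> \<beta> by (auto simp: alpha)

lemma \<phi>'_in: "x \<in> HH \<Longrightarrow> \<phi>' x \<in> HH"
  using gradient_on_in[OF H _ \<phi>(2)] by (auto simp: \<phi>'_def hilbert_sum_def)

lemma \<psi>'_in: "y \<in> GG \<Longrightarrow> \<psi>' y \<in> GG"
  using gradient_on_in[OF G _ \<psi>(2)] by (auto simp: \<psi>'_def hilbert_sum_def)

lemma \<Theta>'_in: "x \<in> HH \<Longrightarrow> \<Theta>' x \<in> HH"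
  by (rule gradient_on_in[OF HH _ \<Theta>(2)])

lemma Lx_in: "x \<in> HH \<Longrightarrow> Lx x \<in> GG"
  using L subG by (auto simp: Lx_def hilbert_sum_def bounded_linear_between_def intro!: subspace_sum)

lemma Ladj_in: "Ladj v \<in> HH"
  using adjoint_on_in[OF H L] subH by (auto simp: Ladj_def hilbert_sum_def intro!: subspace_sum)

lemma Lx_adjoint: "x \<in> HH \<Longrightarrow> inner (Lx x) v = inner x (Ladj v)"
proof -
  assume x: "x \<in> HH"
  have "inner (Lx x) v = (\<Sum>k\<in>UNIV. \<Sum>i\<in>UNIV. inner (L k i (x $ i)) (v $ k))"
    by (simp add: inner_vec_def Lx_def inner_sum_left)
  also have "\<dots> = (\<Sum>i\<in>UNIV. \<Sum>k\<in>UNIV. inner (x $ i) (adjoint_on (H i) (L k i) (v $ k)))"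
    by (subst sum.swap) (simp add: adjoint_on_inner[OF H L HH_nth[OF x]])
  also have "\<dots> = inner x (Ladj v)" by (simp add: inner_vec_def Ladj_def inner_sum_right)
  finally show ?thesis .
qed

lemma M_bounded_linear: "bounded_linear_between V GG M"
  unfolding bounded_linear_between_def
proof (intro conjI ballI allI)
  fix u assume u: "u \<in> V"
  obtain x y z where xyz: "u = (x, y, z)" by (cases u)
  show "M u \<in> GG" using u Lx_in subGG by (simp add: xyz V_iff M_def subspace_diff)
  show "M (r *\<^sub>R u) = r *\<^sub>R M u" for r
    using u L by (auto simp: xyz V_iff M_def Lx_def vec_eq_iff algebra_simps bounded_linear_between_def
        hilbert_sum_def scaleR_sum_right)
  fix u' assume u': "u' \<in> V"
  obtain x' y' z' where xyz': "u' = (x', y', z')" by (cases u')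
  show "M (u + u') = M u + M u'"
    using u u' L by (auto simp: xyz xyz' V_iff M_def Lx_def vec_eq_iff algebra_simps bounded_linear_between_def
        hilbert_sum_def sum.distrib)
next
  have "\<exists>B. \<forall>x\<in>H i. norm (L k i x) \<le> B * norm x" for k i
    using L[of i k] unfolding bounded_linear_between_def by blast
  note ex = this
  define B where "B k i = (SOME B. \<forall>x\<in>H i. norm (L k i x) \<le> B * norm x)" for k i
  have B: "x \<in> H i \<Longrightarrow> norm (L k i x) \<le> B k i * norm x" for k i x
    using someI_ex[OF ex[of i k]] by (simp add: B_def)
  define BL where "BL = (\<Sum>k\<in>UNIV. \<Sum>i\<in>UNIV. \<bar>B k i\<bar>)"
  have BL: "norm (Lx x) \<le> BL * norm x" if x: "x \<in> HH" for x
  proof -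
    have "norm (Lx x $ k) \<le> (\<Sum>i\<in>UNIV. \<bar>B k i\<bar>) * norm x" for k
    proof -
      have "norm (Lx x $ k) \<le> (\<Sum>i\<in>UNIV. norm (L k i (x $ i)))" by (simp add: Lx_def norm_sum)
      also have "\<dots> \<le> (\<Sum>i\<in>UNIV. \<bar>B k i\<bar> * norm x)"
      proof (rule sum_mono)
        fix i
        have "norm (L k i (x $ i)) \<le> B k i * norm (x $ i)" by (rule B[OF HH_nth[OF x]])
        also have "\<dots> \<le> \<bar>B k i\<bar> * norm x" by (intro mult_mono Finite_Cartesian_Product.norm_nth_le) auto
        finally show "norm (L k i (x $ i)) \<le> \<bar>B k i\<bar> * norm x" .
      qed
      finally show ?thesis by (simp add: sum_distrib_right)
    qed
    then have "(\<Sum>k\<in>UNIV. norm (Lx x $ k)) \<le> (\<Sum>k\<in>UNIV. (\<Sum>i\<in>UNIV. \<bar>B k i\<bar>) * norm x)" by (intro sum_mono)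
    then show ?thesis using norm_le_sum_components[of "Lx x"] by (simp add: BL_def sum_distrib_right)
  qed
  show "\<exists>B. \<forall>u\<in>V. norm (M u) \<le> B * norm u"
  proof (intro exI ballI)
    fix u assume u: "u \<in> V"
    obtain x y z where xyz: "u = (x, y, z)" by (cases u)
    have "BL \<ge> 0" by (simp add: BL_def sum_nonneg)
    then have "BL * norm x \<le> BL * norm u" by (intro mult_left_mono) (simp_all add: xyz norm_fst_le)
    moreover have "norm y \<le> norm u" "norm z \<le> norm u"
      using norm_snd_le[of "(y, z)" x] norm_fst_le[of y z] norm_snd_le[of z y] by (auto simp: xyz)
    moreover have "norm (M u) \<le> norm (Lx x) + norm y + norm z"
      unfolding xyz M_def prod.case by norm
    ultimately show "norm (M u) \<le> (BL + 2) * norm u"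
      using BL[of x] u by (simp add: xyz V_iff algebra_simps)
  qed
qed

lemma M_adjoint: "u \<in> V \<Longrightarrow> inner (M u) s = inner u (N s)"
  by (cases u) (simp add: M_def N_def V_iff inner_diff_left Lx_adjoint)

lemma axis_in_HH: "u \<in> H i \<Longrightarrow> axis i u \<in> HH" and axis_in_GG: "s \<in> G k \<Longrightarrow> axis k s \<in> GG"
  using subH subG by (auto simp: hilbert_sum_def axis_def subspace_0)

lemma F_weakly_lsc_convex: "weakly_lsc_convex_on V F"
  unfolding F_def
proof (intro weakly_lsc_convex_on_add weakly_lsc_convex_on_sum)
  have zero: "0 \<in> HH" "0 \<in> GG" using subHH subGG by (simp_all add: subspace_0)
  show "weakly_lsc_convex_on V (\<lambda>w. f i (fst w $ i))" for i
    by (rule weakly_lsc_convex_on_compose[OF Gamma0_weakly_lsc_convex_on[OF H f],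
          where \<pi>' = "\<lambda>u. (axis i u, 0, 0)"])
      (auto simp: linear_iff V_def HH_nth inner_prod_def inner_axis zero axis_in_HH)
  show "weakly_lsc_convex_on V (\<lambda>w. g k (fst (snd w) $ k))" for k
    by (rule weakly_lsc_convex_on_compose[OF Gamma0_weakly_lsc_convex_on[OF G g],
          where \<pi>' = "\<lambda>u. (0, axis k u, 0)"])
      (auto simp: linear_iff V_def GG_nth inner_prod_def inner_axis zero axis_in_GG)
  show "weakly_lsc_convex_on V (\<lambda>w. h k (snd (snd w) $ k))" for k
    by (rule weakly_lsc_convex_on_compose[OF Gamma0_weakly_lsc_convex_on[OF G h],
          where \<pi>' = "\<lambda>u. (0, 0, axis k u)"])
      (auto simp: linear_iff V_def GG_nth inner_prod_def inner_axis zero axis_in_GG)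
qed simp_all

lemma F_proper: "\<exists>u\<in>V. F u \<noteq> \<infinity>"
proof -
  have "\<exists>u\<in>H i. \<exists>r. f i u = ereal r" for i using Gamma0_proper[OF f[of i]] by metis
  then obtain x r where x: "\<And>i. x i \<in> H i" "\<And>i. f i (x i) = ereal (r i)" by metis
  have "\<exists>u\<in>G k. \<exists>r. g k u = ereal r" for k using Gamma0_proper[OF g[of k]] by metis
  then obtain y s where y: "\<And>k. y k \<in> G k" "\<And>k. g k (y k) = ereal (s k)" by metis
  have "\<exists>u\<in>G k. \<exists>r. h k u = ereal r" for k using Gamma0_proper[OF h[of k]] by metis
  then obtain z t where z: "\<And>k. z k \<in> G k" "\<And>k. h k (z k) = ereal (t k)" by metis
  have "((\<chi> i. x i), (\<chi> k. y k), (\<chi> k. z k)) \<in> V" using x y z by (simp add: V_iff hilbert_sum_def)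
  then show ?thesis by (rule bexI[rotated]) (simp add: F_def x y z)
qed

text \<open>The function \<open>F\<close> is separable, so coordinatewise subgradients add up.\<close>
lemma F_subgradient:
  assumes w: "(x, y, z) \<in> V" and u: "(u, p, q) \<in> V"
    and "\<And>i w. w \<in> H i \<Longrightarrow> ereal (inner (w - x $ i) (u $ i)) + f i (x $ i) \<le> f i w"
    and "\<And>k w. w \<in> G k \<Longrightarrow> ereal (inner (w - y $ k) (p $ k)) + g k (y $ k) \<le> g k w"
    and "\<And>k w. w \<in> G k \<Longrightarrow> ereal (inner (w - z $ k) (q $ k)) + h k (z $ k) \<le> h k w"
  shows "(u, p, q) \<in> subdifferential V F (x, y, z)"
  unfolding subdifferential_def
proof (intro CollectI conjI u ballI)
  fix w assume "w \<in> V"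
  then obtain x' y' z' where w': "w = (x', y', z')" "x' \<in> HH" "y' \<in> GG" "z' \<in> GG"
    by (cases w) (auto simp: V_iff)
  have 1: "ereal (inner (x' - x) u) + (\<Sum>i\<in>UNIV. f i (x $ i)) \<le> (\<Sum>i\<in>UNIV. f i (x' $ i))"
    unfolding inner_vec_def sum_ereal[symmetric] sum.distrib[symmetric]
    using assms(3) HH_nth[OF w'(2)] by (intro sum_mono) simp
  have 2: "ereal (inner (y' - y) p) + (\<Sum>k\<in>UNIV. g k (y $ k)) \<le> (\<Sum>k\<in>UNIV. g k (y' $ k))"
    unfolding inner_vec_def sum_ereal[symmetric] sum.distrib[symmetric]
    using assms(4) GG_nth[OF w'(3)] by (intro sum_mono) simp
  have 3: "ereal (inner (z' - z) q) + (\<Sum>k\<in>UNIV. h k (z $ k)) \<le> (\<Sum>k\<in>UNIV. h k (z' $ k))"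
    unfolding inner_vec_def sum_ereal[symmetric] sum.distrib[symmetric]
    using assms(5) GG_nth[OF w'(4)] by (intro sum_mono) simp
  have "ereal (inner (w - (x, y, z)) (u, p, q)) = ereal (inner (x' - x) u) + (ereal (inner (y' - y) p) + ereal (inner (z' - z) q))"
    by (simp add: w')
  then show "ereal (inner (w - (x, y, z)) (u, p, q)) + F (x, y, z) \<le> F w"
    using add_mono[OF 1 add_mono[OF 2 3]] by (simp only: F_def w' fst_conv snd_conv ac_simps)
qed

lemma S_derivative:
  assumes "w \<in> V" shows "(S has_derivative (\<lambda>t. inner (C w + R w) t)) (at w within V)"
proof -
  obtain x y z where w: "w = (x, y, z)" by (cases w)
  have xyz: "x \<in> HH" "y \<in> GG" using assms by (auto simp: w V_iff)
  note bl = bounded_linear_compose[OF bounded_linear_vec_nth bounded_linear_fst]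
    bounded_linear_compose[OF bounded_linear_vec_nth bounded_linear_compose[OF bounded_linear_fst bounded_linear_snd]]
  have 1: "((\<lambda>w. \<phi> i (fst w $ i)) has_derivative (\<lambda>t. inner (axis i (\<phi>' x $ i), 0, 0) t)) (at w within V)" for i
  proof (rule has_derivative_compose_adjoint[where \<pi> = "\<lambda>w. fst w $ i" and U = "H i" and u = "\<phi>' x $ i"])
    show "(\<phi> i has_derivative (\<lambda>t. inner (\<phi>' x $ i) t)) (at (fst w $ i) within H i)"
      using gradient_on_has_derivative[OF H HH_nth[OF xyz(1)] \<phi>(2), of i] by (simp add: w \<phi>'_def)
  qed (simp_all add: bl V_def HH_nth mem_Times_iff inner_prod_def inner_axis)
  have 2: "((\<lambda>w. \<psi> k (fst (snd w) $ k)) has_derivative (\<lambda>t. inner (0, axis k (\<psi>' y $ k), 0) t)) (at w within V)" for k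
  proof (rule has_derivative_compose_adjoint[where \<pi> = "\<lambda>w. fst (snd w) $ k" and U = "G k" and u = "\<psi>' y $ k"])
    show "(\<psi> k has_derivative (\<lambda>t. inner (\<psi>' y $ k) t)) (at (fst (snd w) $ k) within G k)"
      using gradient_on_has_derivative[OF G GG_nth[OF xyz(2)] \<psi>(2), of k] by (simp add: w \<psi>'_def)
  qed (simp_all add: bl V_def GG_nth mem_Times_iff inner_prod_def inner_axis)
  have 3: "((\<lambda>w. \<Theta> (fst w)) has_derivative (\<lambda>t. inner (\<Theta>' x, 0, 0) t)) (at w within V)"
  proof (rule has_derivative_compose_adjoint[where \<pi> = fst and U = HH and u = "\<Theta>' x"])
    show "(\<Theta> has_derivative (\<lambda>t. inner (\<Theta>' x) t)) (at (fst w) within HH)"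
      using gradient_on_has_derivative[OF HH xyz(1) \<Theta>(2)] by (simp add: w)
  qed (simp_all add: bounded_linear_fst V_def mem_Times_iff inner_prod_def)
  have "(S has_derivative (\<lambda>t. (\<Sum>i\<in>UNIV. inner (axis i (\<phi>' x $ i), 0, 0) t)
      + (\<Sum>k\<in>UNIV. inner (0, axis k (\<psi>' y $ k), 0) t) + inner (\<Theta>' x, 0, 0) t)) (at w within V)"
    unfolding S_def by (intro has_derivative_add has_derivative_sum 1 2 3)
  moreover have "(\<Sum>i\<in>UNIV. inner (axis i (\<phi>' x $ i), 0, 0) t)
      + (\<Sum>k\<in>UNIV. inner (0, axis k (\<psi>' y $ k), 0) t) + inner (\<Theta>' x, 0, 0) t = inner (C w + R w) t" for t
    by (cases t) (simp add: w C_def R_def inner_axis' inner_vec_def[of "\<phi>' x"] inner_vec_def[of "\<psi>' y"] inner_add_left)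
  ultimately show ?thesis by simp
qed

lemma S_gradient:
  assumes "w \<in> V" "w' \<in> V" shows "S w + inner (w' - w) (C w + R w) \<le> S w'"
proof -
  obtain x y z where w: "w = (x, y, z)" by (cases w)
  obtain x' y' z' where w': "w' = (x', y', z')" by (cases w')
  have xyz: "x \<in> HH" "y \<in> GG" "x' \<in> HH" "y' \<in> GG" using assms by (auto simp: w w' V_iff)
  have "(\<Sum>i\<in>UNIV. \<phi> i (x $ i) + inner (x' $ i - x $ i) (\<phi>' x $ i)) \<le> (\<Sum>i\<in>UNIV. \<phi> i (x' $ i))"
    using xyz by (intro sum_mono) (simp add: \<phi>'_def convex_gradient_inequality[OF subH \<phi>(1)] HH_nth
        gradient_on_has_derivative[OF H _ \<phi>(2)])
  moreover have "(\<Sum>k\<in>UNIV. \<psi> k (y $ k) + inner (y' $ k - y $ k) (\<psi>' y $ k)) \<le> (\<Sum>k\<in>UNIV. \<psi> k (y' $ k))"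
    using xyz by (intro sum_mono) (simp add: \<psi>'_def convex_gradient_inequality[OF subG \<psi>(1)] GG_nth
        gradient_on_has_derivative[OF G _ \<psi>(2)])
  moreover have "\<Theta> x + inner (x' - x) (\<Theta>' x) \<le> \<Theta> x'"
    using xyz by (intro convex_gradient_inequality[OF subHH \<Theta>(1)] gradient_on_has_derivative[OF HH _ \<Theta>(2)])
  ultimately show ?thesis
    by (simp add: S_def w w' C_def R_def inner_vec_def[of _ "\<phi>' x"] inner_vec_def[of _ "\<psi>' y"] sum.distrib inner_add_right)
qed

lemma C_cocoercive:
  assumes "w \<in> V" "w' \<in> V" shows "alpha * (norm (C w - C w'))\<^sup>2 \<le> inner (w - w') (C w - C w')"
proof -
  obtain x y z where w: "w = (x, y, z)" by (cases w)
  obtain x' y' z' where w': "w' = (x', y', z')" by (cases w')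
  have xyz: "x \<in> HH" "y \<in> GG" "x' \<in> HH" "y' \<in> GG" using assms by (auto simp: w w' V_iff)
  have 1: "alpha * (norm (\<phi>' x $ i - \<phi>' x' $ i))\<^sup>2 \<le> inner (x $ i - x' $ i) (\<phi>' x $ i - \<phi>' x' $ i)" for i
  proof -
    have "alpha * (norm (\<phi>' x $ i - \<phi>' x' $ i))\<^sup>2 \<le> \<alpha> i * (norm (\<phi>' x $ i - \<phi>' x' $ i))\<^sup>2"
      by (intro mult_right_mono alpha_le_\<alpha>) simp
    also have "\<dots> \<le> inner (x $ i - x' $ i) (\<phi>' x $ i - \<phi>' x' $ i)"
      using Baillon_Haddad[OF subH \<phi>(1) gradient_on_in[OF H _ \<phi>(2)] gradient_on_has_derivative[OF H _ \<phi>(2)] \<phi>(3)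
          _ HH_nth[OF xyz(1)] HH_nth[OF xyz(3)], of i] \<alpha>[of i] by (simp add: \<phi>'_def mult.commute)
    finally show ?thesis .
  qed
  have 2: "alpha * (norm (\<psi>' y $ k - \<psi>' y' $ k))\<^sup>2 \<le> inner (y $ k - y' $ k) (\<psi>' y $ k - \<psi>' y' $ k)" for k
  proof -
    have "alpha * (norm (\<psi>' y $ k - \<psi>' y' $ k))\<^sup>2 \<le> \<beta> k * (norm (\<psi>' y $ k - \<psi>' y' $ k))\<^sup>2"
      by (intro mult_right_mono alpha_le_\<beta>) simp
    also have "\<dots> \<le> inner (y $ k - y' $ k) (\<psi>' y $ k - \<psi>' y' $ k)"
      using Baillon_Haddad[OF subG \<psi>(1) gradient_on_in[OF G _ \<psi>(2)] gradient_on_has_derivative[OF G _ \<psi>(2)] \<psi>(3)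
          _ GG_nth[OF xyz(2)] GG_nth[OF xyz(4)], of k] \<beta>[of k] by (simp add: \<psi>'_def mult.commute)
    finally show ?thesis .
  qed
  have "alpha * (norm (\<phi>' x - \<phi>' x'))\<^sup>2 \<le> inner (x - x') (\<phi>' x - \<phi>' x')"
    unfolding power2_norm_vec inner_vec_def sum_distrib_left using 1 by (intro sum_mono) simp
  moreover have "alpha * (norm (\<psi>' y - \<psi>' y'))\<^sup>2 \<le> inner (y - y') (\<psi>' y - \<psi>' y')"
    unfolding power2_norm_vec inner_vec_def sum_distrib_left using 2 by (intro sum_mono) simp
  ultimately show ?thesis by (simp add: w w' C_def norm_prod_def distrib_left)
qed

sublocale saddle: saddle_problem V GG M N F S C R alpha chi
proof
  fix w w' assume w: "w \<in> V" and w': "w' \<in> V"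
  obtain x y z where xyz: "w = (x, y, z)" by (cases w)
  obtain x' y' z' where xyz': "w' = (x', y', z')" by (cases w')
  have x: "x \<in> HH" "x' \<in> HH" using w w' by (auto simp: xyz xyz' V_iff)
  show "0 \<le> inner (w - w') (R w - R w')"
    using convex_gradient_inequality[OF subHH \<Theta>(1) x(1) x(2) gradient_on_has_derivative[OF HH x(1) \<Theta>(2)]]
      convex_gradient_inequality[OF subHH \<Theta>(1) x(2) x(1) gradient_on_has_derivative[OF HH x(2) \<Theta>(2)]]
    by (simp add: xyz xyz' R_def inner_diff_left inner_diff_right)
  have "norm (R w - R w') = norm (\<Theta>' x - \<Theta>' x')" by (simp add: xyz xyz' R_def norm_prod_def)
  also have "\<dots> \<le> chi * norm (x - x')" using lipschitz_onD[OF \<Theta>(3) x] by (simp add: dist_norm)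
  also have "\<dots> \<le> chi * norm (w - w')" using chi by (intro mult_left_mono) (simp_all add: xyz xyz' norm_fst_le)
  finally show "norm (R w - R w') \<le> chi * norm (w - w')" .
next
  fix w assume "w \<in> V"
  then show "C w \<in> V" "R w \<in> V"
    using subGG by (auto simp: V_def C_def R_def \<phi>'_in \<psi>'_in \<Theta>'_in subspace_0)
next
  fix s assume "s \<in> GG" then show "N s \<in> V" using subGG by (simp add: N_def V_iff Ladj_in subspace_neg)
qed (use V GG M_bounded_linear M_adjoint F_weakly_lsc_convex F_proper S_derivative S_gradient C_cocoercive alpha_pos in auto)

lemma partial_gradient_eq: "x \<in> HH \<Longrightarrow> partial_gradient H \<Theta> i x = \<Theta>' x $ i"
  by (rule partial_gradient_component[OF H \<Theta>(2)])

text \<open>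
  The two summands of \<open>L x\<close> in the dual inclusion are taken as \<open>y\<close> and \<open>z\<close>, which makes the constraint hold.
  Inverting the subdifferentials of the conjugates gives \<open>v \<in> \<partial>(g + \<psi>)(y)\<close> and \<open>v \<in> \<partial>h(z)\<close>, and
  the gradient of \<open>\<psi>\<close> is then split off.
\<close>
lemma KT_from_Kuhn_Tucker:
  assumes x: "x \<in> HH" and v: "v \<in> GG"
    and primal: "\<And>i. - (\<Sum>j\<in>UNIV. adjoint_on (H i) (L j i) (v $ j)) \<in>
          {u + gradient_on (H i) (\<phi> i) (x $ i) + partial_gradient H \<Theta> i x | u.
            u \<in> subdifferential (H i) (f i) (x $ i)}"
    and dual: "\<And>k. (\<Sum>j\<in>UNIV. L k j (x $ j)) \<in>
          {u + w | u w.
            u \<in> subdifferential (G k)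
              (inf_conv (G k) (conjugate (G k) (g k)) (conjugate (G k) (\<lambda>s. ereal (\<psi> k s))))
              (v $ k) \<and>
            w \<in> subdifferential (G k) (conjugate (G k) (h k)) (v $ k)}"
  shows "\<exists>y z. ((x, y, z), v) \<in> saddle.KT"
proof -
  let ?U = "\<lambda>k. subdifferential (G k)
    (inf_conv (G k) (conjugate (G k) (g k)) (conjugate (G k) (\<lambda>s. ereal (\<psi> k s)))) (v $ k)"
  let ?W = "\<lambda>k. subdifferential (G k) (conjugate (G k) (h k)) (v $ k)"
  have "\<forall>k. \<exists>p. (\<Sum>j\<in>UNIV. L k j (x $ j)) = fst p + snd p \<and> fst p \<in> ?U k \<and> snd p \<in> ?W k"
  proof
    fix k
    from dual[of k] obtain u w where "(\<Sum>j\<in>UNIV. L k j (x $ j)) = u + w" "u \<in> ?U k" "w \<in> ?W k"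
      unfolding mem_Collect_eq by (elim exE conjE) rule
    then have "(\<Sum>j\<in>UNIV. L k j (x $ j)) = fst (u, w) + snd (u, w) \<and> fst (u, w) \<in> ?U k \<and> snd (u, w) \<in> ?W k"
      by simp
    then show "\<exists>p. (\<Sum>j\<in>UNIV. L k j (x $ j)) = fst p + snd p \<and> fst p \<in> ?U k \<and> snd p \<in> ?W k" ..
  qed
  from choice[OF this] obtain q where
    q: "\<forall>k. (\<Sum>j\<in>UNIV. L k j (x $ j)) = fst (q k) + snd (q k) \<and> fst (q k) \<in> ?U k \<and> snd (q k) \<in> ?W k" ..
  define u where "u k = fst (q k)" for k
  define w where "w k = snd (q k)" for k
  have uw: "\<And>k. (\<Sum>j\<in>UNIV. L k j (x $ j)) = u k + w k" and u: "\<And>k. u k \<in> ?U k" and w: "\<And>k. w k \<in> ?W k"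
    using q by (simp_all add: u_def w_def)
  define y where "y = (\<chi> k. u k)"
  define z where "z = (\<chi> k. w k)"
  have yz: "y \<in> GG" "z \<in> GG"
    using u w by (auto simp: y_def z_def hilbert_sum_def subdifferential_def)
  have xyz: "(x, y, z) \<in> V" using x yz by (simp add: V_iff)
  have M0: "M (x, y, z) = 0" by (simp add: M_def Lx_def y_def z_def vec_eq_iff uw)
  have "- N v - C (x, y, z) - R (x, y, z) = (- Ladj v - \<phi>' x - \<Theta>' x, v - \<psi>' y, v)"
    by (simp add: N_def C_def R_def)
  moreover have "\<dots> \<in> subdifferential V F (x, y, z)"
  proof (rule F_subgradient[OF xyz])
    show "(- Ladj v - \<phi>' x - \<Theta>' x, v - \<psi>' y, v) \<in> V"
      using x v yz subHH subGG by (simp add: V_iff subspace_diff subspace_neg Ladj_in \<phi>'_in \<psi>'_in \<Theta>'_in)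
  next
    fix i s assume s: "s \<in> H i"
    obtain p where p: "p \<in> subdifferential (H i) (f i) (x $ i)"
      "- (\<Sum>j\<in>UNIV. adjoint_on (H i) (L j i) (v $ j)) = p + gradient_on (H i) (\<phi> i) (x $ i) + partial_gradient H \<Theta> i x"
      using primal[of i] by blast
    have "(- Ladj v - \<phi>' x - \<Theta>' x) $ i = p"
      using p(2) by (simp add: Ladj_def \<phi>'_def partial_gradient_eq[OF x])
    then show "ereal (inner (s - x $ i) ((- Ladj v - \<phi>' x - \<Theta>' x) $ i)) + f i (x $ i) \<le> f i s"
      using p(1) s by (simp add: subdifferential_def)
  next
    fix k s assume s: "s \<in> G k"
    have yk: "y $ k \<in> G k" by (rule GG_nth[OF yz(1)])
    have grad: "(\<psi> k has_derivative (\<lambda>t. inner (\<psi>' y $ k) t)) (at (y $ k) within G k)"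
      using gradient_on_has_derivative[OF G yk \<psi>(2)] by (simp add: \<psi>'_def)
    have sg: "v $ k \<in> subdifferential (G k) (\<lambda>s. g k s + ereal (\<psi> k s)) (y $ k)"
      using u[of k] unfolding y_def vec_lambda_beta
      by (rule subgradient_of_inf_conv_conjugates[where \<psi>' = "gradient_on (G k) (\<psi> k)", OF G g GG_nth[OF v], rotated 2])
        (auto intro: gradient_on_in[OF G _ \<psi>(2)] convex_gradient_inequality[OF subG \<psi>(1)]
          gradient_on_has_derivative[OF G _ \<psi>(2)])
    obtain c where c: "g k (y $ k) = ereal c"
    proof -
      obtain s0 r where s0: "s0 \<in> G k" "g k s0 = ereal r" using Gamma0_proper[OF g] .
      then have "ereal (inner (s0 - y $ k) (v $ k)) + (g k (y $ k) + ereal (\<psi> k (y $ k))) \<le> ereal (r + \<psi> k s0)"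
        using sg by (force simp: subdifferential_def)
      then show ?thesis using that Gamma0_not_MInfty[OF g yk] by (cases "g k (y $ k)") auto
    qed
    have D: "((\<lambda>s. \<psi> k s - inner s (v $ k)) has_derivative (\<lambda>t. inner (\<psi>' y $ k - v $ k) t)) (at (y $ k) within G k)"
      by (auto intro!: derivative_eq_intros grad simp: inner_diff_right inner_commute)
    have "ereal (- inner (\<psi>' y $ k - v $ k) (s - y $ k)) + g k (y $ k) \<le> g k s"
    proof (rule minimizer_convex_plus_smooth[where f = "g k", OF subG yk c _ D _ s])
      fix s r t assume "s \<in> G k" "g k s \<le> ereal r" "0 \<le> t" "t \<le> (1::real)"
      then show "g k ((1 - t) *\<^sub>R y $ k + t *\<^sub>R s) \<le> ereal ((1 - t) * c + t * r)"
        using Gamma0_convex[OF g yk, of s c r t] c by simp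
    next
      fix s assume s: "s \<in> G k"
      then have "ereal (inner (s - y $ k) (v $ k)) + (g k (y $ k) + ereal (\<psi> k (y $ k))) \<le> g k s + ereal (\<psi> k s)"
        using sg by (simp add: subdifferential_def)
      then show "g k (y $ k) + ereal (\<psi> k (y $ k) - inner (y $ k) (v $ k)) \<le> g k s + ereal (\<psi> k s - inner s (v $ k))"
        using Gamma0_not_MInfty[OF g s] by (cases "g k s") (auto simp: c inner_diff_left)
    qed
    moreover have "- inner (\<psi>' y $ k - v $ k) (s - y $ k) = inner (s - y $ k) ((v - \<psi>' y) $ k)"
      by (simp add: inner_diff inner_commute)
    ultimately show "ereal (inner (s - y $ k) ((v - \<psi>' y) $ k)) + g k (y $ k) \<le> g k s" by simp
  next
    fix k s assume s: "s \<in> G k"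
    have "v $ k \<in> subdifferential (G k) (h k) (z $ k)"
      using subgradient_of_conjugate[OF G h GG_nth[OF v] w] by (simp add: z_def)
    then show "ereal (inner (s - z $ k) (v $ k)) + h k (z $ k) \<le> h k s"
      using s by (simp add: subdifferential_def)
  qed
  ultimately have "((x, y, z), v) \<in> saddle.KT" using xyz v M0 by (simp add: saddle.KT_def)
  then show ?thesis by blast
qed

text \<open>
  For points in the kernel of \<open>M\<close> the Lagrangian equals the split objective, so \<open>(x, y, z)\<close> minimizes the latter.
  Taking the infimum over all splittings of \<open>L x'\<close> recovers the infimal convolutions.
\<close>
lemma KT_minimizer:
  assumes KT: "((x, y, z), v) \<in> saddle.KT"
  shows "is_arg_min
      (\<lambda>x. ereal (\<Theta> x) + (\<Sum>i\<in>UNIV. f i (x $ i) + ereal (\<phi> i (x $ i)))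
        + (\<Sum>k\<in>UNIV. inf_conv (G k) (\<lambda>s. g k s + ereal (\<psi> k s)) (h k)
            (\<Sum>j\<in>UNIV. L k j (x $ j))))
      (\<lambda>x. x \<in> HH) x"
proof -
  let ?A = "\<lambda>x. ereal (\<Theta> x) + (\<Sum>i\<in>UNIV. f i (x $ i) + ereal (\<phi> i (x $ i)))"
  let ?Q = "\<lambda>x k s. (g k s + ereal (\<psi> k s)) + h k ((\<Sum>j\<in>UNIV. L k j (x $ j)) - s)"
  have xyz: "x \<in> HH" "y \<in> GG" "z \<in> GG" and M0: "M (x, y, z) = 0"
    using KT by (auto simp: saddle.KT_def V_iff)
  \<comment> \<open>\<open>Lx x - y\<close> is the third component of the point of the kernel of \<open>M\<close> with first components \<open>x\<close> and \<open>y\<close>\<close>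
  have split: "F (x, y, Lx x - y) + ereal (S (x, y, Lx x - y)) = ?A x + (\<Sum>k\<in>UNIV. ?Q x k (y $ k))" for x y
    by (simp add: F_def S_def Lx_def sum.distrib ac_simps flip: sum_ereal plus_ereal.simps)
  have z: "z = Lx x - y" using M0 by (simp add: M_def algebra_simps)
  have "?A x + (\<Sum>k\<in>UNIV. INF s\<in>G k. ?Q x k s) \<le> ?A x + (\<Sum>k\<in>UNIV. ?Q x k (y $ k))"
    using GG_nth[OF xyz(2)] by (intro add_left_mono sum_mono INF_lower)
  also have "\<dots> = F (x, y, z) + ereal (S (x, y, z))" by (simp only: z split)
  finally have upper: "?A x + (\<Sum>k\<in>UNIV. INF s\<in>G k. ?Q x k s) \<le> F (x, y, z) + ereal (S (x, y, z))" .
  have lower: "F (x, y, z) + ereal (S (x, y, z)) \<le> ?A x' + (\<Sum>k\<in>UNIV. INF s\<in>G k. ?Q x' k s)"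
    if x': "x' \<in> HH" for x'
  proof (rule le_sum_INF)
    fix s assume s: "\<And>k. s k \<in> G k"
    let ?s = "\<chi> k. s k"
    have "?s \<in> GG" using s by (simp add: hilbert_sum_def)
    then have "(x', ?s, Lx x' - ?s) \<in> V" using x' Lx_in subGG by (simp add: V_iff subspace_diff)
    moreover have "M (x', ?s, Lx x' - ?s) = 0" by (simp add: M_def)
    ultimately have "F (x, y, z) + ereal (S (x, y, z)) \<le> F (x', ?s, Lx x' - ?s) + ereal (S (x', ?s, Lx x' - ?s))"
      using saddle.KT_saddle[OF KT, of "(x', ?s, Lx x' - ?s)"] by simp
    then show "F (x, y, z) + ereal (S (x, y, z)) \<le> ?A x' + (\<Sum>k\<in>UNIV. ?Q x' k (s k))"
      by (simp add: split)
  qed (use subG subspace_0 in auto)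
  show ?thesis
    unfolding is_arg_min_def inf_conv_def
    using xyz(1) upper lower order_trans by (simp add: not_less) blast
qed

end

section \<open>Delays and block activation\<close>
lemma scaleR_bounded_tendsto_zero:
  fixes f :: "nat \<Rightarrow> 'a::real_normed_vector"
  assumes f: "f \<longlonglongrightarrow> 0" and c: "\<And>n. \<bar>c n\<bar> \<le> B"
  shows "(\<lambda>n. c n *\<^sub>R f n) \<longlonglongrightarrow> 0"
proof (rule Lim_null_comparison[OF always_eventually])
  show "\<forall>n. norm (c n *\<^sub>R f n) \<le> B * norm (f n)" using c by (simp add: mult_right_mono)
  show "(\<lambda>n. B * norm (f n)) \<longlonglongrightarrow> 0" using tendsto_mult_right_zero[OF tendsto_norm_zero[OF f]] .
qed

lemma tendsto_delayed_difference:
  fixes X :: "nat \<Rightarrow> 'a::real_normed_vector"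
  assumes X: "(\<lambda>n. X (Suc n) - X n) \<longlonglongrightarrow> 0" and \<tau>: "\<And>n. n \<le> \<tau> n + D \<and> \<tau> n \<le> n"
  shows "(\<lambda>n. X (\<tau> n) - X n) \<longlonglongrightarrow> 0"
proof (rule LIMSEQ_I)
  fix e :: real assume e: "e > 0"
  define \<delta> where "\<delta> = e / (real D + 1)"
  have \<delta>: "\<delta> > 0" "real D * \<delta> < e" using e by (simp_all add: \<delta>_def field_simps)
  obtain N where N: "\<And>n. n \<ge> N \<Longrightarrow> norm (X (Suc n) - X n) < \<delta>"
    using LIMSEQ_D[OF X \<delta>(1)] by auto
  have steps: "norm (X (t + m) - X t) \<le> real m * \<delta>" if "t \<ge> N" for t m
  proof (induction m)
    case (Suc m)
    have "norm (X (t + Suc m) - X t) \<le> norm (X (Suc (t + m)) - X (t + m)) + norm (X (t + m) - X t)"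
      using norm_triangle_ineq[of "X (Suc (t + m)) - X (t + m)" "X (t + m) - X t"] by simp
    then show ?case using Suc N[of "t + m"] that by (simp add: algebra_simps)
  qed simp
  show "\<exists>no. \<forall>n\<ge>no. norm (X (\<tau> n) - X n - 0) < e"
  proof (intro exI allI impI)
    fix n assume n: "n \<ge> N + D"
    have "\<tau> n \<ge> N" "\<tau> n \<le> n" "n - \<tau> n \<le> D" using n \<tau>[of n] by auto
    then have "norm (X n - X (\<tau> n)) \<le> real (n - \<tau> n) * \<delta>"
      using steps[of "\<tau> n" "n - \<tau> n"] by simp
    also have "\<dots> \<le> real D * \<delta>" using \<open>n - \<tau> n \<le> D\<close> \<delta> by (intro mult_right_mono) auto
    finally show "norm (X (\<tau> n) - X n - 0) < e" using \<delta> by (simp add: norm_minus_commute)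
  qed
qed

text \<open>
  Block iterations become delayed iterations of all blocks: every block was last computed at a step \<open>m i n\<close>
  at most \<open>P\<close> steps ago. For \<open>n \<le> P\<close> this holds because all blocks are active at step 0.
\<close>
lemma last_activation:
  fixes A :: "nat \<Rightarrow> 'i set"
  assumes "A 0 = UNIV" and cover: "\<And>n. (\<Union>j\<in>{n..n + P}. A j) = UNIV"
  obtains m where "\<And>i n. i \<in> A (m i n)" "\<And>i n. m i n \<le> n" "\<And>i n. n \<le> m i n + P"
    "\<And>i n j. m i n < j \<Longrightarrow> j \<le> n \<Longrightarrow> i \<notin> A j"
proof
  define m where "m i n = Max {j. j \<le> n \<and> i \<in> A j}" for i n
  have fin: "finite {j. j \<le> n \<and> i \<in> A j}" for i n by simp
  have "{j. j \<le> n \<and> i \<in> A j} \<noteq> {}" for i n using assms(1) by auto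
  from Max_in[OF fin this] show "i \<in> A (m i n)" "m i n \<le> n" for i n by (auto simp: m_def)
  show "n \<le> m i n + P" for i n
  proof (cases "n \<le> P")
    case False
    have "i \<in> (\<Union>j\<in>{n - P..n - P + P}. A j)" using cover[of "n - P"] by simp
    then obtain j where "j \<ge> n - P" "j \<le> n" "i \<in> A j" using False by auto
    then have "j \<le> m i n" unfolding m_def by (intro Max_ge[OF fin]) simp
    then show ?thesis using \<open>j \<ge> n - P\<close> by simp
  qed simp
  show "i \<notin> A j" if "m i n < j" "j \<le> n" for i n j
  proof
    assume "i \<in> A j"
    then have "j \<le> m i n" unfolding m_def using that by (intro Max_ge[OF fin]) simp
    then show False using that by simp
  qed
qed

lemma kept_value:
  assumes "m \<le> (n::nat)" and "\<And>j. m < j \<Longrightarrow> j \<le> n \<Longrightarrow> u j = u (j - 1)"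
  shows "u n = u m"
  using assms by (induction n rule: dec_induct) auto

lemma power2_norm_Pair: "(norm (a, b))\<^sup>2 = (norm a)\<^sup>2 + (norm b)\<^sup>2"
  by (simp add: norm_prod_def)

lemma diagonal_scaling_lower:
  fixes u :: "'a::real_inner ^ 'i::finite"
  assumes "\<And>i. s \<le> t i"
  shows "s * (norm u)\<^sup>2 \<le> inner u (\<chi> i. t i *\<^sub>R u $ i)"
  unfolding power2_norm_vec inner_vec_def sum_distrib_left
  using assms by (intro sum_mono) (simp add: mult_right_mono flip: power2_norm_eq_inner)

lemma diagonal_scaling_upper:
  fixes u :: "'a::real_inner ^ 'i::finite"
  assumes "\<And>i. \<bar>t i\<bar> \<le> s"
  shows "(norm (\<chi> i. t i *\<^sub>R u $ i))\<^sup>2 \<le> s\<^sup>2 * (norm u)\<^sup>2"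
  unfolding power2_norm_vec sum_distrib_left
proof (rule sum_mono)
  fix i
  have "\<bar>t i\<bar> * norm (u $ i) \<le> s * norm (u $ i)" using assms by (intro mult_right_mono) auto
  then have "(\<bar>t i\<bar> * norm (u $ i))\<^sup>2 \<le> (s * norm (u $ i))\<^sup>2" by (intro power_mono) auto
  then show "(norm ((\<chi> i. t i *\<^sub>R u $ i) $ i))\<^sup>2 \<le> s\<^sup>2 * (norm (u $ i))\<^sup>2"
    by (simp add: power_mult_distrib)
qed

text \<open>
  The algorithm with activation sets eliminated: every quantity is computed at every step, from data
  at most \<open>D\<close> steps old. The index \<open>\<tau> i n\<close> combines the age of the block with the delay of its data.
\<close>
locale delayed_iteration = composite_minimization H G f \<phi> \<alpha> g h \<psi> \<beta> L \<Theta> chi alpha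
  for H :: "'i::finite \<Rightarrow> 'h::real_inner set"
    and G :: "'k::finite \<Rightarrow> 'g::real_inner set"
    and f \<phi> \<alpha> g h \<psi> \<beta> L \<Theta> chi alpha +
  fixes \<sigma> \<epsilon> :: real
    and \<gamma> :: "'i \<Rightarrow> nat \<Rightarrow> real" and \<mu> \<nu> sigma :: "'k \<Rightarrow> nat \<Rightarrow> real" and lam :: "nat \<Rightarrow> real"
    and D :: nat and \<tau> :: "'i \<Rightarrow> nat \<Rightarrow> nat" and \<rho> :: "'k \<Rightarrow> nat \<Rightarrow> nat"
    and x a a' p' :: "nat \<Rightarrow> 'h ^ 'i"
    and y z v' b d e e' q' t' :: "nat \<Rightarrow> 'g ^ 'k"
    and \<Delta> \<theta> :: "nat \<Rightarrow> real"
  assumes \<sigma>: "\<sigma> > 1 / (4 * alpha)"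
    and \<epsilon>: "0 < \<epsilon>"
    and \<gamma>: "\<And>i n. \<gamma> i n \<in> {\<epsilon>..1 / (chi + \<sigma>)}"
    and \<mu>: "\<And>k n. \<mu> k n \<in> {\<epsilon>..1 / \<sigma>}"
    and \<nu>: "\<And>k n. \<nu> k n \<in> {\<epsilon>..1 / \<sigma>}"
    and sigma: "\<And>k n. sigma k n \<in> {\<epsilon>..1 / \<epsilon>}"
    and lam: "\<And>n. lam n \<in> {\<epsilon>..2 - \<epsilon>}"
    and init: "x 0 \<in> hilbert_sum H" "y 0 \<in> hilbert_sum G" "z 0 \<in> hilbert_sum G"
      "v' 0 \<in> hilbert_sum G"
    and \<tau>: "\<And>i n. n \<le> \<tau> i n + D \<and> \<tau> i n \<le> n"
    and \<rho>: "\<And>k n. n \<le> \<rho> k n + D \<and> \<rho> k n \<le> n"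
    and a: "\<And>n i. a n $ i = prox (H i) (\<lambda>w. ereal (\<gamma> i (\<tau> i n)) * f i w)
        (x (\<tau> i n) $ i - \<gamma> i (\<tau> i n) *\<^sub>R
          (partial_gradient H \<Theta> i (x (\<tau> i n))
            + (\<Sum>k\<in>UNIV. adjoint_on (H i) (L k i) (v' (\<tau> i n) $ k))
            + gradient_on (H i) (\<phi> i) (x (\<tau> i n) $ i)))"
    and a': "\<And>n i. a' n $ i = inverse (\<gamma> i (\<tau> i n)) *\<^sub>R (x (\<tau> i n) $ i - a n $ i)
        - (partial_gradient H \<Theta> i (x (\<tau> i n))
            + (\<Sum>k\<in>UNIV. adjoint_on (H i) (L k i) (v' (\<tau> i n) $ k)))"
    and b: "\<And>n k. b n $ k = prox (G k) (\<lambda>w. ereal (\<mu> k (\<rho> k n)) * g k w)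
        (y (\<rho> k n) $ k + \<mu> k (\<rho> k n) *\<^sub>R
          (v' (\<rho> k n) $ k - gradient_on (G k) (\<psi> k) (y (\<rho> k n) $ k)))"
    and d: "\<And>n k. d n $ k = prox (G k) (\<lambda>w. ereal (\<nu> k (\<rho> k n)) * h k w)
        (z (\<rho> k n) $ k + \<nu> k (\<rho> k n) *\<^sub>R (v' (\<rho> k n) $ k))"
    and e': "\<And>n k. e' n $ k = sigma k (\<rho> k n) *\<^sub>R
          ((\<Sum>i\<in>UNIV. L k i (x (\<rho> k n) $ i)) - y (\<rho> k n) $ k - z (\<rho> k n) $ k)
        + v' (\<rho> k n) $ k"
    and q': "\<And>n k. q' n $ k = inverse (\<mu> k (\<rho> k n)) *\<^sub>R (y (\<rho> k n) $ k - b n $ k)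
        + v' (\<rho> k n) $ k - e' n $ k"
    and t': "\<And>n k. t' n $ k = inverse (\<nu> k (\<rho> k n)) *\<^sub>R (z (\<rho> k n) $ k - d n $ k)
        + v' (\<rho> k n) $ k - e' n $ k"
    and e: "\<And>n k. e n $ k = b n $ k + d n $ k - (\<Sum>i\<in>UNIV. L k i (a n $ i))"
    and p': "\<And>n i. p' n $ i = a' n $ i + partial_gradient H \<Theta> i (a n)
        + (\<Sum>k\<in>UNIV. adjoint_on (H i) (L k i) (e' n $ k))"
    and \<Delta>: "\<And>n. \<Delta> n =
      - inverse (4 * alpha) * ((\<Sum>i\<in>UNIV. (norm (a n $ i - x (\<tau> i n) $ i))\<^sup>2)
        + (\<Sum>k\<in>UNIV. (norm (b n $ k - y (\<rho> k n) $ k))\<^sup>2 + (norm (d n $ k - z (\<rho> k n) $ k))\<^sup>2))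
      + (\<Sum>i\<in>UNIV. inner (x n $ i - a n $ i) (p' n $ i))
      + (\<Sum>k\<in>UNIV. inner (y n $ k - b n $ k) (q' n $ k)
          + inner (z n $ k - d n $ k) (t' n $ k)
          + inner (e n $ k) (v' n $ k - e' n $ k))"
    and move: "\<And>n. \<Delta> n > 0 \<Longrightarrow>
      \<theta> n = lam n * \<Delta> n / ((\<Sum>i\<in>UNIV. (norm (p' n $ i))\<^sup>2)
        + (\<Sum>k\<in>UNIV. (norm (q' n $ k))\<^sup>2 + (norm (t' n $ k))\<^sup>2 + (norm (e n $ k))\<^sup>2)) \<and>
      (\<forall>i. x (Suc n) $ i = x n $ i - \<theta> n *\<^sub>R (p' n $ i)) \<and>
      (\<forall>k. y (Suc n) $ k = y n $ k - \<theta> n *\<^sub>R (q' n $ k) \<and>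
        z (Suc n) $ k = z n $ k - \<theta> n *\<^sub>R (t' n $ k) \<and>
        v' (Suc n) $ k = v' n $ k - \<theta> n *\<^sub>R (e n $ k))"
    and stay: "\<And>n. \<not> \<Delta> n > 0 \<Longrightarrow>
        x (Suc n) = x n \<and> y (Suc n) = y n \<and> z (Suc n) = z n \<and> v' (Suc n) = v' n"
begin

lemma \<sigma>_pos: "\<sigma> > 0" and chi_\<sigma>_pos: "chi + \<sigma> > 0"
proof -
  have "1 / (4 * alpha) > 0" using alpha_pos by simp
  then show "\<sigma> > 0" using \<sigma> by linarith
  then show "chi + \<sigma> > 0" using chi by linarith
qed

lemma step_sizes_pos: "\<gamma> i n > 0" "\<mu> k n > 0" "\<nu> k n > 0" "sigma k n > 0"
  using \<gamma>[of i n] \<mu>[of k n] \<nu>[of k n] sigma[of k n] \<epsilon> by auto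

lemma inverse_bounds:
  assumes "s > 0" "r \<in> {\<epsilon>..1 / s}" shows "s \<le> inverse r" "\<bar>inverse r\<bar> \<le> 1 / \<epsilon>"
proof -
  have r: "r > 0" "\<epsilon> \<le> r" "r \<le> 1 / s" using assms \<epsilon> by auto
  show "s \<le> inverse r" using r assms(1) by (simp add: field_simps)
  show "\<bar>inverse r\<bar> \<le> 1 / \<epsilon>" using r \<epsilon> by (simp add: field_simps)
qed

lemma a_in: "a n \<in> HH" and b_in: "b n \<in> GG" and d_in: "d n \<in> GG"
  using prox_in[OF H f] prox_in[OF G g] prox_in[OF G h] step_sizes_pos
  by (auto simp: hilbert_sum_def a b d)

lemma e_eq: "e n = b n + d n - Lx (a n)"
  by (simp add: vec_eq_iff e Lx_def)

lemma e_in: "e n \<in> GG"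
  unfolding e_eq using a_in b_in d_in Lx_in subGG by (simp add: subspace_add subspace_diff)

lemma p'_eq: "p' n = a' n + \<Theta>' (a n) + Ladj (e' n)"
  by (simp add: vec_eq_iff p' Ladj_def partial_gradient_eq[OF a_in])

lemma directions_in:
  assumes "\<And>m. m \<le> n \<Longrightarrow> x m \<in> HH \<and> y m \<in> GG \<and> z m \<in> GG \<and> v' m \<in> GG"
  shows "a' n \<in> HH" "p' n \<in> HH" "e' n \<in> GG" "q' n \<in> GG" "t' n \<in> GG"
proof -
  have \<tau>n: "x (\<tau> i n) \<in> HH" for i using assms \<tau> by blast
  have \<rho>n: "x (\<rho> k n) \<in> HH" "y (\<rho> k n) \<in> GG" "z (\<rho> k n) \<in> GG" "v' (\<rho> k n) \<in> GG" for k
    using assms \<rho> by blast+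
  have adj: "(\<Sum>k\<in>UNIV. adjoint_on (H i) (L k i) (s $ k)) \<in> H i" for s i
    using adjoint_on_in[OF H L] subH by (intro subspace_sum) auto
  have "a' n $ i \<in> H i" for i
    unfolding a' partial_gradient_eq[OF \<tau>n] using subH \<tau>n a_in \<Theta>'_in adj
    by (intro subspace_diff subspace_add subspace_scale HH_nth) auto
  then show a'n: "a' n \<in> HH" by (simp add: hilbert_sum_def)
  show "p' n \<in> HH" unfolding p'_eq using subHH a'n \<Theta>'_in a_in Ladj_in by (intro subspace_add) auto
  have "e' n $ k \<in> G k" for k
  proof -
    have "(\<Sum>i\<in>UNIV. L k i (x (\<rho> k n) $ i)) \<in> G k"
      using GG_nth[OF Lx_in[OF \<rho>n(1)[of k]], of k] by (simp add: Lx_def)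
    then show ?thesis
      unfolding e' using subG \<rho>n by (intro subspace_diff subspace_add subspace_scale) (auto intro: GG_nth)
  qed
  then show e'n: "e' n \<in> GG" by (simp add: hilbert_sum_def)
  show "q' n \<in> GG" "t' n \<in> GG"
    unfolding hilbert_sum_def mem_Collect_eq q' t'
    using subG \<rho>n e'n b_in d_in by (auto intro!: subspace_diff subspace_add subspace_scale GG_nth)
qed

text \<open>The directions at step \<open>n\<close> use iterates of several earlier steps, hence the strong induction.\<close>
lemma iterates_in: "x n \<in> HH \<and> y n \<in> GG \<and> z n \<in> GG \<and> v' n \<in> GG"
proof (induction n rule: less_induct)
  case (less n)
  show ?case
  proof (cases n)
    case 0 then show ?thesis using init by simp
  next
    case (Suc m)
    have prev: "x j \<in> HH \<and> y j \<in> GG \<and> z j \<in> GG \<and> v' j \<in> GG" if "j \<le> m" for j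
      using less[of j] that Suc by simp
    note dir = directions_in[OF prev]
    show ?thesis
    proof (cases "\<Delta> m > 0")
      case True
      have "x n = x m - \<theta> m *\<^sub>R p' m" "y n = y m - \<theta> m *\<^sub>R q' m" "z n = z m - \<theta> m *\<^sub>R t' m"
        "v' n = v' m - \<theta> m *\<^sub>R e m"
        using move[OF True] by (simp_all add: Suc vec_eq_iff)
      then show ?thesis
        using prev[of m] dir e_in subHH subGG by (simp add: subspace_diff subspace_scale)
    next
      case False
      then show ?thesis using stay[OF False] prev[of m] by (simp add: Suc)
    qed
  qed
qed

lemma x_in: "x n \<in> HH" and y_in: "y n \<in> GG" and z_in: "z n \<in> GG" and v'_in: "v' n \<in> GG"
  using iterates_in by auto

lemma e'_in: "e' n \<in> GG"
  by (rule directions_in(3)[OF iterates_in])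

definition w :: "nat \<Rightarrow> ('h ^ 'i) \<times> ('g ^ 'k) \<times> ('g ^ 'k)" where "w n = (x n, y n, z n)"
definition ws :: "nat \<Rightarrow> ('h ^ 'i) \<times> ('g ^ 'k) \<times> ('g ^ 'k)" where
  "ws n = ((\<chi> i. x (\<tau> i n) $ i), (\<chi> k. y (\<rho> k n) $ k), (\<chi> k. z (\<rho> k n) $ k))"
definition aa :: "nat \<Rightarrow> ('h ^ 'i) \<times> ('g ^ 'k) \<times> ('g ^ 'k)" where "aa n = (a n, b n, d n)"
definition aa' :: "nat \<Rightarrow> ('h ^ 'i) \<times> ('g ^ 'k) \<times> ('g ^ 'k)" where
  "aa' n = (a' n, q' n + e' n, t' n + e' n)"

lemma M_w: "M (w n) $ k = (\<Sum>i\<in>UNIV. L k i (x n $ i)) - y n $ k - z n $ k"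
  by (simp add: M_def w_def Lx_def)

lemma M_aa: "M (aa n) = - e n"
  by (simp add: M_def aa_def e_eq)

lemma ws_in: "ws n \<in> V"
  using x_in y_in z_in by (auto simp: ws_def V_iff hilbert_sum_def)

lemma subgradient: "aa' n - C (ws n) \<in> subdifferential V F (aa n)"
proof -
  have eq: "aa' n - C (ws n) = (a' n - \<phi>' (fst (ws n)), q' n + e' n - \<psi>' (fst (snd (ws n))), t' n + e' n)"
    by (simp add: aa'_def C_def ws_def)
  have dir: "a' n \<in> HH" "q' n \<in> GG" "t' n \<in> GG" using directions_in[OF iterates_in, of n] by auto
  show ?thesis
    unfolding eq unfolding aa_def
  proof (rule F_subgradient)
    show "(a n, b n, d n) \<in> V" using a_in b_in d_in by (simp add: V_iff)
    show "(a' n - \<phi>' (fst (ws n)), q' n + e' n - \<psi>' (fst (snd (ws n))), t' n + e' n) \<in> V"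
      using dir e'_in ws_in[of n] subHH subGG
      by (auto simp: V_def mem_Times_iff subspace_diff subspace_add \<phi>'_in \<psi>'_in)
  next
    fix i s assume s: "s \<in> H i"
    have "inverse c *\<^sub>R ((X - c *\<^sub>R (l + D)) - A) = (inverse c *\<^sub>R (X - A) - l) - D" if "c > 0"
      for c :: real and X l D A :: 'h using that by (simp add: algebra_simps)
    from this[OF step_sizes_pos(1)]
    show "ereal (inner (s - a n $ i) ((a' n - \<phi>' (fst (ws n))) $ i)) + f i (a n $ i) \<le> f i s"
      using prox_subgradient[OF H f step_sizes_pos(1)[of i "\<tau> i n"] s, of "x (\<tau> i n) $ i - \<gamma> i (\<tau> i n) *\<^sub>R
          (partial_gradient H \<Theta> i (x (\<tau> i n))
            + (\<Sum>k\<in>UNIV. adjoint_on (H i) (L k i) (v' (\<tau> i n) $ k))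
            + gradient_on (H i) (\<phi> i) (x (\<tau> i n) $ i))", folded a]
      by (simp only: a' \<phi>'_def ws_def fst_conv vector_minus_component vec_lambda_beta)
  next
    fix k s assume s: "s \<in> G k"
    have "inverse c *\<^sub>R ((X + c *\<^sub>R (l - D)) - A) = (inverse c *\<^sub>R (X - A) + l - E) + E - D" if "c > 0"
      for c :: real and X l D A E :: 'g using that by (simp add: algebra_simps)
    from this[OF step_sizes_pos(2)]
    show "ereal (inner (s - b n $ k) ((q' n + e' n - \<psi>' (fst (snd (ws n)))) $ k)) + g k (b n $ k) \<le> g k s"
      using prox_subgradient[OF G g step_sizes_pos(2)[of k "\<rho> k n"] s, of "y (\<rho> k n) $ k + \<mu> k (\<rho> k n) *\<^sub>R
          (v' (\<rho> k n) $ k - gradient_on (G k) (\<psi> k) (y (\<rho> k n) $ k))", folded b]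
      by (simp only: q' \<psi>'_def ws_def fst_conv snd_conv vector_minus_component vector_add_component vec_lambda_beta)
  next
    fix k s assume s: "s \<in> G k"
    have "inverse c *\<^sub>R ((X + c *\<^sub>R l) - A) = (inverse c *\<^sub>R (X - A) + l - E) + E" if "c > 0"
      for c :: real and X l A E :: 'g using that by (simp add: algebra_simps)
    from this[OF step_sizes_pos(3)]
    show "ereal (inner (s - d n $ k) ((t' n + e' n) $ k)) + h k (d n $ k) \<le> h k s"
      using prox_subgradient[OF G h step_sizes_pos(3)[of k "\<rho> k n"] s, of "z (\<rho> k n) $ k + \<nu> k (\<rho> k n) *\<^sub>R
          (v' (\<rho> k n) $ k)", folded d]
      by (simp only: t' vector_add_component)
  qed
qed

lemma \<Delta>_eq: "\<Delta> n = - inverse (4 * alpha) * (norm (aa n - ws n))\<^sup>2 + inner (w n - aa n) (p' n, q' n, t' n)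
    - inner (M (aa n)) (v' n - e' n)"
proof -
  have "(norm (aa n - ws n))\<^sup>2 = (\<Sum>i\<in>UNIV. (norm (a n $ i - x (\<tau> i n) $ i))\<^sup>2)
        + (\<Sum>k\<in>UNIV. (norm (b n $ k - y (\<rho> k n) $ k))\<^sup>2 + (norm (d n $ k - z (\<rho> k n) $ k))\<^sup>2)"
    by (simp add: aa_def ws_def power2_norm_Pair power2_norm_vec sum.distrib)
  then show ?thesis
    unfolding \<Delta> M_aa by (simp add: w_def aa_def inner_vec_def sum.distrib sum_negf)
qed

sublocale splitting: projective_splitting V GG M N F S C R alpha chi w ws aa aa'
  "\<lambda>n. (p' n, q' n, t' n)" v' e' \<Delta> \<theta> lam \<epsilon>
proof
  fix n
  show "w n \<in> V" "ws n \<in> V" "aa n \<in> V" "v' n \<in> GG" "e' n \<in> GG"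
    using x_in y_in z_in v'_in e'_in a_in b_in d_in ws_in by (simp_all add: w_def aa_def V_iff)
  show "aa' n - C (ws n) \<in> subdifferential V F (aa n)" by (rule subgradient)
  show "(p' n, q' n, t' n) = aa' n + R (aa n) + N (e' n)"
    by (simp add: p'_eq aa'_def R_def aa_def N_def)
  show "\<Delta> n = - inverse (4 * alpha) * (norm (aa n - ws n))\<^sup>2 + inner (w n - aa n) (p' n, q' n, t' n)
    - inner (M (aa n)) (v' n - e' n)" by (rule \<Delta>_eq)
  show "\<epsilon> > 0" "\<epsilon> \<le> lam n" "lam n \<le> 2 - \<epsilon>" using \<epsilon> lam[of n] by auto
  show "\<theta> n = lam n * \<Delta> n / ((norm (p' n, q' n, t' n))\<^sup>2 + (norm (M (aa n)))\<^sup>2)" if "\<Delta> n > 0"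
    using move[OF that] by (simp add: M_aa power2_norm_Pair power2_norm_vec sum.distrib add.assoc)
  show "w (Suc n) = w n - \<theta> n *\<^sub>R (p' n, q' n, t' n) \<and> v' (Suc n) = v' n + \<theta> n *\<^sub>R M (aa n)" if "\<Delta> n > 0"
    using move[OF that] by (simp add: w_def M_aa vec_eq_iff)
  show "w (Suc n) = w n \<and> v' (Suc n) = v' n" if "\<not> \<Delta> n > 0"
    using stay[OF that] by (simp add: w_def)
qed

definition c :: "nat \<Rightarrow> ('h ^ 'i) \<times> ('g ^ 'k) \<times> ('g ^ 'k)" where
  "c n = ((\<chi> i. inverse (\<gamma> i (\<tau> i n)) *\<^sub>R (x n - a n) $ i),
          (\<chi> k. inverse (\<mu> k (\<rho> k n)) *\<^sub>R (y n - b n) $ k),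
          (\<chi> k. inverse (\<nu> k (\<rho> k n)) *\<^sub>R (z n - d n) $ k))"

text \<open>
  The bound \<open>\<gamma> \<le> 1/(chi + \<sigma>)\<close> reserves \<open>chi\<close> to absorb the Lipschitz operator \<open>R\<close>, leaving \<open>\<sigma>\<close>; \<open>R\<close> acts on
  the \<open>x\<close> block only, so \<open>\<mu>, \<nu> \<le> 1/\<sigma>\<close> are enough for the other two.
\<close>
lemma c_strongly_monotone:
  "\<sigma> * (norm (w n - aa n))\<^sup>2 \<le> inner (w n - aa n) (c n + R (aa n) - R (w n))"
proof -
  have 1: "(chi + \<sigma>) * (norm (x n - a n))\<^sup>2 \<le> inner (x n - a n) (\<chi> i. inverse (\<gamma> i (\<tau> i n)) *\<^sub>R (x n - a n) $ i)"
    by (intro diagonal_scaling_lower inverse_bounds(1)[OF chi_\<sigma>_pos \<gamma>])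
  have 2: "\<sigma> * (norm (y n - b n))\<^sup>2 \<le> inner (y n - b n) (\<chi> k. inverse (\<mu> k (\<rho> k n)) *\<^sub>R (y n - b n) $ k)"
    by (intro diagonal_scaling_lower inverse_bounds(1)[OF \<sigma>_pos \<mu>])
  have 3: "\<sigma> * (norm (z n - d n))\<^sup>2 \<le> inner (z n - d n) (\<chi> k. inverse (\<nu> k (\<rho> k n)) *\<^sub>R (z n - d n) $ k)"
    by (intro diagonal_scaling_lower inverse_bounds(1)[OF \<sigma>_pos \<nu>])
  have "inner (x n - a n) (\<Theta>' (x n) - \<Theta>' (a n)) \<le> norm (x n - a n) * norm (\<Theta>' (x n) - \<Theta>' (a n))"
    by (rule norm_cauchy_schwarz)
  also have "\<dots> \<le> norm (x n - a n) * (chi * norm (x n - a n))"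
    using lipschitz_onD[OF \<Theta>(3) x_in a_in, of n n] by (intro mult_left_mono) (simp_all add: dist_norm)
  finally have 4: "inner (x n - a n) (\<Theta>' (x n) - \<Theta>' (a n)) \<le> chi * (norm (x n - a n))\<^sup>2"
    by (simp add: power2_eq_square mult_ac)
  have "(norm (w n - aa n))\<^sup>2 = (norm (x n - a n))\<^sup>2 + ((norm (y n - b n))\<^sup>2 + (norm (z n - d n))\<^sup>2)"
    by (simp add: w_def aa_def norm_prod_def)
  moreover have "inner (w n - aa n) (c n + R (aa n) - R (w n)) =
      inner (x n - a n) (\<chi> i. inverse (\<gamma> i (\<tau> i n)) *\<^sub>R (x n - a n) $ i) - inner (x n - a n) (\<Theta>' (x n) - \<Theta>' (a n))
      + (inner (y n - b n) (\<chi> k. inverse (\<mu> k (\<rho> k n)) *\<^sub>R (y n - b n) $ k)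
       + inner (z n - d n) (\<chi> k. inverse (\<nu> k (\<rho> k n)) *\<^sub>R (z n - d n) $ k))"
    unfolding w_def aa_def c_def R_def by (simp only: prod.case diff_Pair add_Pair inner_Pair inner_diff_right inner_add_right)
  ultimately show ?thesis using 1 2 3 4 by (simp only: distrib_left distrib_right)
qed

lemma c_bound: "norm (c n) \<le> 1 / \<epsilon> * norm (w n - aa n)"
proof (rule power2_le_imp_le)
  have "(norm (\<chi> i. inverse (\<gamma> i (\<tau> i n)) *\<^sub>R (x n - a n) $ i))\<^sup>2 \<le> (1 / \<epsilon>)\<^sup>2 * (norm (x n - a n))\<^sup>2"
    "(norm (\<chi> k. inverse (\<mu> k (\<rho> k n)) *\<^sub>R (y n - b n) $ k))\<^sup>2 \<le> (1 / \<epsilon>)\<^sup>2 * (norm (y n - b n))\<^sup>2"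
    "(norm (\<chi> k. inverse (\<nu> k (\<rho> k n)) *\<^sub>R (z n - d n) $ k))\<^sup>2 \<le> (1 / \<epsilon>)\<^sup>2 * (norm (z n - d n))\<^sup>2"
    by (intro diagonal_scaling_upper inverse_bounds(2)[OF chi_\<sigma>_pos \<gamma>] inverse_bounds(2)[OF \<sigma>_pos \<mu>]
        inverse_bounds(2)[OF \<sigma>_pos \<nu>])+
  moreover have "(norm (c n))\<^sup>2 = (norm (\<chi> i. inverse (\<gamma> i (\<tau> i n)) *\<^sub>R (x n - a n) $ i))\<^sup>2
     + ((norm (\<chi> k. inverse (\<mu> k (\<rho> k n)) *\<^sub>R (y n - b n) $ k))\<^sup>2
     + (norm (\<chi> k. inverse (\<nu> k (\<rho> k n)) *\<^sub>R (z n - d n) $ k))\<^sup>2)"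
    by (simp add: c_def norm_prod_def)
  moreover have "(norm (w n - aa n))\<^sup>2 = (norm (x n - a n))\<^sup>2 + ((norm (y n - b n))\<^sup>2 + (norm (z n - d n))\<^sup>2)"
    by (simp add: w_def aa_def norm_prod_def)
  ultimately show "(norm (c n))\<^sup>2 \<le> (1 / \<epsilon> * norm (w n - aa n))\<^sup>2"
    unfolding power_mult_distrib by (simp only: distrib_left)
  show "0 \<le> 1 / \<epsilon> * norm (w n - aa n)" using \<epsilon> by simp
qed

text \<open>
  The errors \<open>rx\<close>, \<open>ry\<close>, \<open>rz\<close> and \<open>re\<close> compare the step at the delayed points with the step at \<open>w n\<close>; each is a
  bounded or Lipschitz image of a delayed difference of the iterates, and these differences vanish.
\<close>
lemma iterates_converge_weakly:
  assumes KT: "saddle.KT \<noteq> {}"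
  shows "\<exists>u s. (u, s) \<in> saddle.KT \<and> converges_weakly V w u \<and> converges_weakly V aa u"
proof -
  have X: "(\<lambda>n. splitting.X (\<kappa> n) - splitting.X n) \<longlonglongrightarrow> 0" if "\<And>n. n \<le> \<kappa> n + D \<and> \<kappa> n \<le> n" for \<kappa>
    using tendsto_delayed_difference[OF splitting.X_steps_vanish[OF KT] that] .
  have delay: "(\<lambda>n. w (\<kappa> n) - w n) \<longlonglongrightarrow> 0" "(\<lambda>n. v' (\<kappa> n) - v' n) \<longlonglongrightarrow> 0"
    if "\<And>n. n \<le> \<kappa> n + D \<and> \<kappa> n \<le> n" for \<kappa>
    using tendsto_fst[OF X[OF that]] tendsto_snd[OF X[OF that]] by (simp_all add: splitting.X_def)
  have delay': "(\<lambda>n. x (\<kappa> n) - x n) \<longlonglongrightarrow> 0" "(\<lambda>n. y (\<kappa> n) - y n) \<longlonglongrightarrow> 0" "(\<lambda>n. z (\<kappa> n) - z n) \<longlonglongrightarrow> 0"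
    if "\<And>n. n \<le> \<kappa> n + D \<and> \<kappa> n \<le> n" for \<kappa>
    using tendsto_fst[OF delay(1)[OF that]] tendsto_fst[OF tendsto_snd[OF delay(1)[OF that]]]
      tendsto_snd[OF tendsto_snd[OF delay(1)[OF that]]] by (simp_all add: w_def)
  have comp: "(\<lambda>n. u n $ j) \<longlonglongrightarrow> 0" if "u \<longlonglongrightarrow> 0" for u :: "nat \<Rightarrow> 'c::real_normed_vector ^ 'd::finite" and j
    using tendsto_vec_nth[OF that, of j] by simp
  have ws: "(\<lambda>n. ws n - w n) \<longlonglongrightarrow> 0"
  proof -
    have "(\<lambda>n. (\<chi> i. x (\<tau> i n) $ i) - x n) \<longlonglongrightarrow> 0"
      using comp[OF delay'(1)[OF \<tau>]] by (intro vec_tendstoI) simp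
    moreover have "(\<lambda>n. (\<chi> k. y (\<rho> k n) $ k) - y n) \<longlonglongrightarrow> 0"
      using comp[OF delay'(2)[OF \<rho>]] by (intro vec_tendstoI) simp
    moreover have "(\<lambda>n. (\<chi> k. z (\<rho> k n) $ k) - z n) \<longlonglongrightarrow> 0"
      using comp[OF delay'(3)[OF \<rho>]] by (intro vec_tendstoI) simp
    ultimately show ?thesis
      unfolding ws_def w_def diff_Pair zero_prod_def by (intro tendsto_Pair)
  qed
  obtain BN where BN: "\<And>s. s \<in> GG \<Longrightarrow> norm (N s) \<le> BN * norm s" using saddle.N_bound by blast
  obtain BM where BM: "\<And>u. u \<in> V \<Longrightarrow> norm (M u) \<le> BM * norm u" using saddle.M_bound by blast
  have \<Theta>'_delay: "(\<lambda>n. \<Theta>' (x (\<kappa> n)) - \<Theta>' (x n)) \<longlonglongrightarrow> 0" if "\<And>n. n \<le> \<kappa> n + D \<and> \<kappa> n \<le> n" for \<kappa>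
  proof (rule Lim_null_comparison[OF always_eventually])
    show "\<forall>n. norm (\<Theta>' (x (\<kappa> n)) - \<Theta>' (x n)) \<le> chi * norm (x (\<kappa> n) - x n)"
      using lipschitz_onD[OF \<Theta>(3) x_in x_in] by (simp add: dist_norm)
    show "(\<lambda>n. chi * norm (x (\<kappa> n) - x n)) \<longlonglongrightarrow> 0"
      using tendsto_mult_right_zero[OF tendsto_norm_zero[OF delay'(1)[OF that]]] .
  qed
  have Ladj_delay: "(\<lambda>n. Ladj (v' (\<kappa> n)) - Ladj (v' n)) \<longlonglongrightarrow> 0" if "\<And>n. n \<le> \<kappa> n + D \<and> \<kappa> n \<le> n" for \<kappa>
  proof (rule Lim_null_comparison[OF always_eventually])
    show "\<forall>n. norm (Ladj (v' (\<kappa> n)) - Ladj (v' n)) \<le> BN * norm (v' (\<kappa> n) - v' n)"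
    proof
      fix n
      have "Ladj (v' (\<kappa> n)) - Ladj (v' n) = fst (N (v' (\<kappa> n) - v' n))"
        using saddle.N_diff[OF v'_in v'_in, of "\<kappa> n" n] by (simp add: N_def)
      moreover have "norm (fst (N (v' (\<kappa> n) - v' n))) \<le> norm (N (v' (\<kappa> n) - v' n))"
        by (metis norm_fst_le prod.collapse)
      ultimately show "norm (Ladj (v' (\<kappa> n)) - Ladj (v' n)) \<le> BN * norm (v' (\<kappa> n) - v' n)"
        using BN[of "v' (\<kappa> n) - v' n"] v'_in subGG by (simp add: subspace_diff)
    qed
    show "(\<lambda>n. BN * norm (v' (\<kappa> n) - v' n)) \<longlonglongrightarrow> 0"
      using tendsto_mult_right_zero[OF tendsto_norm_zero[OF delay(2)[OF that]]] .
  qed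
  have M_delay: "(\<lambda>n. M (w (\<kappa> n)) - M (w n)) \<longlonglongrightarrow> 0" if "\<And>n. n \<le> \<kappa> n + D \<and> \<kappa> n \<le> n" for \<kappa>
  proof (rule Lim_null_comparison[OF always_eventually])
    show "\<forall>n. norm (M (w (\<kappa> n)) - M (w n)) \<le> BM * norm (w (\<kappa> n) - w n)"
    proof
      fix n
      show "norm (M (w (\<kappa> n)) - M (w n)) \<le> BM * norm (w (\<kappa> n) - w n)"
        using BM[of "w (\<kappa> n) - w n"] splitting.w_in saddle.subV saddle.M_diff[OF splitting.w_in splitting.w_in, of "\<kappa> n" n]
        by (simp add: subspace_diff)
    qed
    show "(\<lambda>n. BM * norm (w (\<kappa> n) - w n)) \<longlonglongrightarrow> 0"
      using tendsto_mult_right_zero[OF tendsto_norm_zero[OF delay(1)[OF that]]] .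
  qed
  define rx where "rx n = (\<chi> i. inverse (\<gamma> i (\<tau> i n)) *\<^sub>R (x (\<tau> i n) - x n) $ i
      - (\<Theta>' (x (\<tau> i n)) - \<Theta>' (x n)) $ i - (Ladj (v' (\<tau> i n)) - Ladj (v' n)) $ i)" for n
  define ry where "ry n = (\<chi> k. inverse (\<mu> k (\<rho> k n)) *\<^sub>R (y (\<rho> k n) - y n) $ k + (v' (\<rho> k n) - v' n) $ k)" for n
  define rz where "rz n = (\<chi> k. inverse (\<nu> k (\<rho> k n)) *\<^sub>R (z (\<rho> k n) - z n) $ k + (v' (\<rho> k n) - v' n) $ k)" for n
  define re where "re n = (\<chi> k. sigma k (\<rho> k n) *\<^sub>R (M (w (\<rho> k n)) - M (w n)) $ k + (v' (\<rho> k n) - v' n) $ k)" for n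
  have rx: "rx \<longlonglongrightarrow> 0"
  proof (rule vec_tendstoI)
    fix i
    have "(\<lambda>n. inverse (\<gamma> i (\<tau> i n)) *\<^sub>R (x (\<tau> i n) - x n) $ i
      - (\<Theta>' (x (\<tau> i n)) - \<Theta>' (x n)) $ i - (Ladj (v' (\<tau> i n)) - Ladj (v' n)) $ i) \<longlonglongrightarrow> 0 - 0 - 0"
      by (intro tendsto_diff scaleR_bounded_tendsto_zero[where B = "1 / \<epsilon>"] comp delay'(1)[OF \<tau>] \<Theta>'_delay[OF \<tau>]
          Ladj_delay[OF \<tau>] inverse_bounds(2)[OF chi_\<sigma>_pos \<gamma>])
    then show "(\<lambda>n. rx n $ i) \<longlonglongrightarrow> 0 $ i" by (simp add: rx_def)
  qed
  have ry: "ry \<longlonglongrightarrow> 0"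
  proof (rule vec_tendstoI)
    fix k
    have "(\<lambda>n. inverse (\<mu> k (\<rho> k n)) *\<^sub>R (y (\<rho> k n) - y n) $ k + (v' (\<rho> k n) - v' n) $ k) \<longlonglongrightarrow> 0 + 0"
      by (intro tendsto_add scaleR_bounded_tendsto_zero[where B = "1 / \<epsilon>"] comp delay'(2)[OF \<rho>] delay(2)[OF \<rho>]
          inverse_bounds(2)[OF \<sigma>_pos \<mu>])
    then show "(\<lambda>n. ry n $ k) \<longlonglongrightarrow> 0 $ k" by (simp add: ry_def)
  qed
  have rz: "rz \<longlonglongrightarrow> 0"
  proof (rule vec_tendstoI)
    fix k
    have "(\<lambda>n. inverse (\<nu> k (\<rho> k n)) *\<^sub>R (z (\<rho> k n) - z n) $ k + (v' (\<rho> k n) - v' n) $ k) \<longlonglongrightarrow> 0 + 0"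
      by (intro tendsto_add scaleR_bounded_tendsto_zero[where B = "1 / \<epsilon>"] comp delay'(3)[OF \<rho>] delay(2)[OF \<rho>]
          inverse_bounds(2)[OF \<sigma>_pos \<nu>])
    then show "(\<lambda>n. rz n $ k) \<longlonglongrightarrow> 0 $ k" by (simp add: rz_def)
  qed
  have sigma_bound: "\<bar>sigma k n\<bar> \<le> 1 / \<epsilon>" for k n using sigma[of k n] \<epsilon> by auto
  have re: "re \<longlonglongrightarrow> 0"
  proof (rule vec_tendstoI)
    fix k
    have "(\<lambda>n. sigma k (\<rho> k n) *\<^sub>R (M (w (\<rho> k n)) - M (w n)) $ k + (v' (\<rho> k n) - v' n) $ k) \<longlonglongrightarrow> 0 + 0"
      by (intro tendsto_add scaleR_bounded_tendsto_zero[where B = "1 / \<epsilon>"] comp M_delay[OF \<rho>] delay(2)[OF \<rho>]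
          sigma_bound)
    then show "(\<lambda>n. re n $ k) \<longlonglongrightarrow> 0 $ k" by (simp add: re_def)
  qed
  show ?thesis
  proof (rule splitting.weak_convergence[OF KT, where c = c and rem = "\<lambda>n. (rx n, ry n, rz n)"
        and s = "\<lambda>n. \<chi> k. sigma k (\<rho> k n) *\<^sub>R M (w n) $ k" and rem' = re and \<kappa> = "1 / \<epsilon>" and \<rho> = \<epsilon> and \<sigma> = \<sigma>])
    fix n
    have "a' n = (\<chi> i. inverse (\<gamma> i (\<tau> i n)) *\<^sub>R (x n - a n) $ i) - \<Theta>' (x n) - Ladj (v' n) + rx n"
      by (simp add: vec_eq_iff a' rx_def partial_gradient_eq[OF x_in] Ladj_def algebra_simps)
    moreover have "q' n + e' n = (\<chi> k. inverse (\<mu> k (\<rho> k n)) *\<^sub>R (y n - b n) $ k) + v' n + ry n"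
      by (simp add: vec_eq_iff q' ry_def algebra_simps)
    moreover have "t' n + e' n = (\<chi> k. inverse (\<nu> k (\<rho> k n)) *\<^sub>R (z n - d n) $ k) + v' n + rz n"
      by (simp add: vec_eq_iff t' rz_def algebra_simps)
    ultimately show "aa' n = c n - R (w n) - N (v' n) + (rx n, ry n, rz n)"
      by (simp add: aa'_def c_def R_def w_def N_def)
    show "e' n = v' n + (\<chi> k. sigma k (\<rho> k n) *\<^sub>R M (w n) $ k) + re n"
      by (simp add: vec_eq_iff e' re_def M_w algebra_simps)
    show "\<epsilon> * (norm (M (w n)))\<^sup>2 \<le> inner (M (w n)) (\<chi> k. sigma k (\<rho> k n) *\<^sub>R M (w n) $ k)"
      using sigma by (intro diagonal_scaling_lower) auto
    show "norm (\<chi> k. sigma k (\<rho> k n) *\<^sub>R M (w n) $ k) \<le> 1 / \<epsilon> * norm (M (w n))"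
    proof (rule power2_le_imp_le)
      show "(norm (\<chi> k. sigma k (\<rho> k n) *\<^sub>R M (w n) $ k))\<^sup>2 \<le> (1 / \<epsilon> * norm (M (w n)))\<^sup>2"
        unfolding power_mult_distrib by (intro diagonal_scaling_upper sigma_bound)
    qed (use \<epsilon> in simp)
    show "\<sigma> * (norm (w n - aa n))\<^sup>2 \<le> inner (w n - aa n) (c n + R (aa n) - R (w n))"
      by (rule c_strongly_monotone)
    show "norm (c n) \<le> 1 / \<epsilon> * norm (w n - aa n)" by (rule c_bound)
  next
    show "(\<lambda>n. (rx n, ry n, rz n)) \<longlonglongrightarrow> 0"
      unfolding zero_prod_def by (intro tendsto_Pair rx ry rz)
    show "re \<longlonglongrightarrow> 0" "(\<lambda>n. ws n - w n) \<longlonglongrightarrow> 0" "\<epsilon> > 0" by (fact re ws \<epsilon>)+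
    show "\<sigma> > inverse (4 * alpha)" using \<sigma> by (simp only: inverse_eq_divide)
  qed
qed

end

section \<open>Weak convergence of the block-iterative algorithm\<close>
lemma converges_weakly_component:
  fixes H :: "'i::finite \<Rightarrow> 'h::real_inner set"
  assumes H: "\<And>i. hilbert_space (H i)" and W: "subspace W"
    and conv: "converges_weakly (hilbert_sum H \<times> W) u l"
  shows "converges_weakly (H i) (\<lambda>n. fst (u n) $ i) (fst l $ i)"
  unfolding converges_weakly_def
proof
  fix s assume "s \<in> H i"
  then have "(axis i s, 0) \<in> hilbert_sum H \<times> W"
    using W H by (auto simp: hilbert_sum_def axis_def hilbert_space_def subspace_0)
  then have "(\<lambda>n. inner (u n) (axis i s, 0)) \<longlonglongrightarrow> inner l (axis i s, 0)"
    using conv unfolding converges_weakly_def by blast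
  then show "(\<lambda>n. inner (fst (u n) $ i) s) \<longlonglongrightarrow> inner (fst l $ i) s"
    by (simp add: inner_prod_def inner_axis)
qed

theorem corollary4p7:
  fixes H :: "'i::finite \<Rightarrow> 'h::real_inner set"
    and G :: "'k::finite \<Rightarrow> 'g::real_inner set"
    and f :: "'i \<Rightarrow> 'h \<Rightarrow> ereal" and \<phi> :: "'i \<Rightarrow> 'h \<Rightarrow> real" and \<alpha> :: "'i \<Rightarrow> real"
    and g h :: "'k \<Rightarrow> 'g \<Rightarrow> ereal" and \<psi> :: "'k \<Rightarrow> 'g \<Rightarrow> real" and \<beta> :: "'k \<Rightarrow> real"
    and L :: "'k \<Rightarrow> 'i \<Rightarrow> 'h \<Rightarrow> 'g"
    and \<Theta> :: "'h ^ 'i \<Rightarrow> real"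
    and chi alpha \<sigma> \<epsilon> :: real
    and \<gamma> :: "'i \<Rightarrow> nat \<Rightarrow> real" and \<mu> \<nu> sigma :: "'k \<Rightarrow> nat \<Rightarrow> real" and lam :: "nat \<Rightarrow> real"
    and P T :: nat and I :: "nat \<Rightarrow> 'i set" and K :: "nat \<Rightarrow> 'k set"
    and \<pi> :: "'i \<Rightarrow> nat \<Rightarrow> nat" and \<omega> :: "'k \<Rightarrow> nat \<Rightarrow> nat"
    and x a a' l' p' :: "nat \<Rightarrow> 'h ^ 'i"
    and y z v' b d e e' q' t' :: "nat \<Rightarrow> 'g ^ 'k"
    and \<xi> :: "'i \<Rightarrow> nat \<Rightarrow> real" and \<eta> :: "'k \<Rightarrow> nat \<Rightarrow> real" and \<Delta> \<theta> :: "nat \<Rightarrow> real"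
  \<comment> \<open>Problem (M)\<close>
  assumes H: "\<And>i. hilbert_space (H i)"
    and G: "\<And>k. hilbert_space (G k)"
    and f: "\<And>i. f i \<in> Gamma0 (H i)"
    and \<alpha>: "\<And>i. \<alpha> i > 0"
    and \<phi>: "\<And>i. convex_on (H i) (\<phi> i)" "\<And>i. \<phi> i differentiable_on H i"
      "\<And>i. (1 / \<alpha> i)-lipschitz_on (H i) (gradient_on (H i) (\<phi> i))"
    and g: "\<And>k. g k \<in> Gamma0 (G k)"
    and h: "\<And>k. h k \<in> Gamma0 (G k)"
    and \<beta>: "\<And>k. \<beta> k > 0"
    and \<psi>: "\<And>k. convex_on (G k) (\<psi> k)" "\<And>k. \<psi> k differentiable_on G k"
      "\<And>k. (1 / \<beta> k)-lipschitz_on (G k) (gradient_on (G k) (\<psi> k))"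
    and L: "\<And>k i. bounded_linear_between (H i) (G k) (L k i)"
    and chi: "chi \<ge> 0"
    and \<Theta>: "convex_on (hilbert_sum H) \<Theta>" "\<Theta> differentiable_on hilbert_sum H"
      "chi-lipschitz_on (hilbert_sum H) (gradient_on (hilbert_sum H) \<Theta>)"
  \<comment> \<open>Parameters\<close>
    and alpha: "alpha = Min (range \<alpha> \<union> range \<beta>)"
    and \<sigma>: "\<sigma> > 1 / (4 * alpha)"
    and \<epsilon>: "0 < \<epsilon>" "\<epsilon> < min 1 (1 / (chi + \<sigma>))"
    and \<gamma>: "\<And>i n. \<gamma> i n \<in> {\<epsilon>..1 / (chi + \<sigma>)}"
    and \<mu>: "\<And>k n. \<mu> k n \<in> {\<epsilon>..1 / \<sigma>}"
    and \<nu>: "\<And>k n. \<nu> k n \<in> {\<epsilon>..1 / \<sigma>}"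
    and sigma: "\<And>k n. sigma k n \<in> {\<epsilon>..1 / \<epsilon>}"
    and lam: "\<And>n. lam n \<in> {\<epsilon>..2 - \<epsilon>}"
    and init: "x 0 \<in> hilbert_sum H" "y 0 \<in> hilbert_sum G" "z 0 \<in> hilbert_sum G"
      "v' 0 \<in> hilbert_sum G"
    and I: "\<And>n. I n \<noteq> {}" "I 0 = UNIV" "\<And>n. (\<Union>j\<in>{n..n + P}. I j) = UNIV"
    and K: "\<And>n. K n \<noteq> {}" "K 0 = UNIV" "\<And>n. (\<Union>j\<in>{n..n + P}. K j) = UNIV"
    and \<pi>: "\<And>i n. n \<le> \<pi> i n + T \<and> \<pi> i n \<le> n"
    and \<omega>: "\<And>k n. n \<le> \<omega> k n + T \<and> \<omega> k n \<le> n"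
  \<comment> \<open>Algorithm M; primed letters are the starred ones of the paper\<close>
    and step1: "\<And>n i. i \<in> I n \<Longrightarrow>
      l' n $ i = partial_gradient H \<Theta> i (x (\<pi> i n))
        + (\<Sum>k\<in>UNIV. adjoint_on (H i) (L k i) (v' (\<pi> i n) $ k)) \<and>
      a n $ i = prox (H i) (\<lambda>w. ereal (\<gamma> i (\<pi> i n)) * f i w)
        (x (\<pi> i n) $ i
          - \<gamma> i (\<pi> i n) *\<^sub>R (l' n $ i + gradient_on (H i) (\<phi> i) (x (\<pi> i n) $ i))) \<and>
      a' n $ i = inverse (\<gamma> i (\<pi> i n)) *\<^sub>R (x (\<pi> i n) $ i - a n $ i) - l' n $ i \<and>
      \<xi> i n = (norm (a n $ i - x (\<pi> i n) $ i))\<^sup>2"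
    and step2: "\<And>n i. i \<notin> I n \<Longrightarrow>
      a n $ i = a (n - 1) $ i \<and> a' n $ i = a' (n - 1) $ i \<and> \<xi> i n = \<xi> i (n - 1)"
    and step3: "\<And>n k. k \<in> K n \<Longrightarrow>
      b n $ k = prox (G k) (\<lambda>w. ereal (\<mu> k (\<omega> k n)) * g k w)
        (y (\<omega> k n) $ k + \<mu> k (\<omega> k n) *\<^sub>R
          (v' (\<omega> k n) $ k - gradient_on (G k) (\<psi> k) (y (\<omega> k n) $ k))) \<and>
      d n $ k = prox (G k) (\<lambda>w. ereal (\<nu> k (\<omega> k n)) * h k w)
        (z (\<omega> k n) $ k + \<nu> k (\<omega> k n) *\<^sub>R (v' (\<omega> k n) $ k)) \<and>
      e' n $ k = sigma k (\<omega> k n) *\<^sub>R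
          ((\<Sum>i\<in>UNIV. L k i (x (\<omega> k n) $ i)) - y (\<omega> k n) $ k - z (\<omega> k n) $ k)
        + v' (\<omega> k n) $ k \<and>
      q' n $ k = inverse (\<mu> k (\<omega> k n)) *\<^sub>R (y (\<omega> k n) $ k - b n $ k)
        + v' (\<omega> k n) $ k - e' n $ k \<and>
      t' n $ k = inverse (\<nu> k (\<omega> k n)) *\<^sub>R (z (\<omega> k n) $ k - d n $ k)
        + v' (\<omega> k n) $ k - e' n $ k \<and>
      \<eta> k n = (norm (b n $ k - y (\<omega> k n) $ k))\<^sup>2 + (norm (d n $ k - z (\<omega> k n) $ k))\<^sup>2"
    and step4: "\<And>n k. k \<notin> K n \<Longrightarrow>
      b n $ k = b (n - 1) $ k \<and> d n $ k = d (n - 1) $ k \<and> e' n $ k = e' (n - 1) $ k \<and>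
      q' n $ k = q' (n - 1) $ k \<and> t' n $ k = t' (n - 1) $ k \<and> \<eta> k n = \<eta> k (n - 1)"
    and step5: "\<And>n k. e n $ k = b n $ k + d n $ k - (\<Sum>i\<in>UNIV. L k i (a n $ i))"
      "\<And>n i. p' n $ i = a' n $ i + partial_gradient H \<Theta> i (a n)
        + (\<Sum>k\<in>UNIV. adjoint_on (H i) (L k i) (e' n $ k))"
    and step6: "\<And>n. \<Delta> n =
      - inverse (4 * alpha) * ((\<Sum>i\<in>UNIV. \<xi> i n) + (\<Sum>k\<in>UNIV. \<eta> k n))
      + (\<Sum>i\<in>UNIV. inner (x n $ i - a n $ i) (p' n $ i))
      + (\<Sum>k\<in>UNIV. inner (y n $ k - b n $ k) (q' n $ k)
          + inner (z n $ k - d n $ k) (t' n $ k)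
          + inner (e n $ k) (v' n $ k - e' n $ k))"
    and step7: "\<And>n. \<Delta> n > 0 \<Longrightarrow>
      \<theta> n = lam n * \<Delta> n / ((\<Sum>i\<in>UNIV. (norm (p' n $ i))\<^sup>2)
        + (\<Sum>k\<in>UNIV. (norm (q' n $ k))\<^sup>2 + (norm (t' n $ k))\<^sup>2 + (norm (e n $ k))\<^sup>2)) \<and>
      (\<forall>i. x (Suc n) $ i = x n $ i - \<theta> n *\<^sub>R (p' n $ i)) \<and>
      (\<forall>k. y (Suc n) $ k = y n $ k - \<theta> n *\<^sub>R (q' n $ k) \<and>
        z (Suc n) $ k = z n $ k - \<theta> n *\<^sub>R (t' n $ k) \<and>
        v' (Suc n) $ k = v' n $ k - \<theta> n *\<^sub>R (e n $ k))"
      "\<And>n. \<not> \<Delta> n > 0 \<Longrightarrow>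
        x (Suc n) = x n \<and> y (Suc n) = y n \<and> z (Suc n) = z n \<and> v' (Suc n) = v' n"
  \<comment> \<open>Hypotheses of the corollary\<close>
    and epi_closed:
      "\<And>k. closed {u + w | u w. u \<in> epi (G k) (\<lambda>s. g k s + ereal (\<psi> k s)) \<and> w \<in> epi (G k) (h k)}"
    and kuhn_tucker: "\<exists>xt \<in> hilbert_sum H. \<exists>vt \<in> hilbert_sum G. \<forall>i k.
      - (\<Sum>j\<in>UNIV. adjoint_on (H i) (L j i) (vt $ j)) \<in>
          {u + gradient_on (H i) (\<phi> i) (xt $ i) + partial_gradient H \<Theta> i xt | u.
            u \<in> subdifferential (H i) (f i) (xt $ i)} \<and>
      (\<Sum>j\<in>UNIV. L k j (xt $ j)) \<in>
          {u + w | u w.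
            u \<in> subdifferential (G k)
              (inf_conv (G k) (conjugate (G k) (g k)) (conjugate (G k) (\<lambda>s. ereal (\<psi> k s))))
              (vt $ k) \<and>
            w \<in> subdifferential (G k) (conjugate (G k) (h k)) (vt $ k)}"
  shows "\<exists>xbar.
    is_arg_min
      (\<lambda>x. ereal (\<Theta> x) + (\<Sum>i\<in>UNIV. f i (x $ i) + ereal (\<phi> i (x $ i)))
        + (\<Sum>k\<in>UNIV. inf_conv (G k) (\<lambda>s. g k s + ereal (\<psi> k s)) (h k)
            (\<Sum>j\<in>UNIV. L k j (x $ j))))
      (\<lambda>x. x \<in> hilbert_sum H) xbar \<and>
    (\<forall>i. converges_weakly (H i) (\<lambda>n. x n $ i) (xbar $ i) \<and>
         converges_weakly (H i) (\<lambda>n. a n $ i) (xbar $ i))"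
proof -
  interpret cm: composite_minimization H G f \<phi> \<alpha> g h \<psi> \<beta> L \<Theta> chi alpha
    by unfold_locales (fact H G f \<alpha> \<phi> g h \<beta> \<psi> L chi \<Theta> alpha)+
  obtain m where m: "\<And>i n. i \<in> I (m i n)" "\<And>i n. m i n \<le> n" "\<And>i n. n \<le> m i n + P"
    "\<And>i n j. m i n < j \<Longrightarrow> j \<le> n \<Longrightarrow> i \<notin> I j"
    using last_activation[of I P] I(2,3) by metis
  obtain r where r: "\<And>k n. k \<in> K (r k n)" "\<And>k n. r k n \<le> n" "\<And>k n. n \<le> r k n + P"
    "\<And>k n j. r k n < j \<Longrightarrow> j \<le> n \<Longrightarrow> k \<notin> K j"
    using last_activation[of K P] K(2,3) by metis
  have keep_a: "a n $ i = a (m i n) $ i" and keep_a': "a' n $ i = a' (m i n) $ i"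
    and keep_\<xi>: "\<xi> i n = \<xi> i (m i n)" for n i
    by (rule kept_value[OF m(2)], use step2 m(4) in blast)+
  have keep_b: "b n $ k = b (r k n) $ k" and keep_d: "d n $ k = d (r k n) $ k" and keep_e': "e' n $ k = e' (r k n) $ k"
    and keep_q': "q' n $ k = q' (r k n) $ k" and keep_t': "t' n $ k = t' (r k n) $ k"
    and keep_\<eta>: "\<eta> k n = \<eta> k (r k n)" for n k
    by (rule kept_value[OF r(2)], use step4 r(4) in blast)+
  define \<tau> where "\<tau> i n = \<pi> i (m i n)" for i n
  define \<rho> where "\<rho> k n = \<omega> k (r k n)" for k n
  note s1 = step1[OF m(1)] and s3 = step3[OF r(1)]
  interpret di: delayed_iteration H G f \<phi> \<alpha> g h \<psi> \<beta> L \<Theta> chi alpha \<sigma> \<epsilon> \<gamma> \<mu> \<nu> sigma lam "P + T" \<tau> \<rho>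
    x a a' p' y z v' b d e e' q' t' \<Delta> \<theta>
  proof unfold_locales
    fix n :: nat and i :: 'i and k :: 'k
    show "n \<le> \<tau> i n + (P + T) \<and> \<tau> i n \<le> n"
      using \<pi>[of "m i n" i] m(2)[of i n] m(3)[of n i] by (simp add: \<tau>_def)
    show "n \<le> \<rho> k n + (P + T) \<and> \<rho> k n \<le> n"
      using \<omega>[of "r k n" k] r(2)[of k n] r(3)[of n k] by (simp add: \<rho>_def)
    show "a n $ i = prox (H i) (\<lambda>w. ereal (\<gamma> i (\<tau> i n)) * f i w)
        (x (\<tau> i n) $ i - \<gamma> i (\<tau> i n) *\<^sub>R
          (partial_gradient H \<Theta> i (x (\<tau> i n))
            + (\<Sum>k\<in>UNIV. adjoint_on (H i) (L k i) (v' (\<tau> i n) $ k))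
            + gradient_on (H i) (\<phi> i) (x (\<tau> i n) $ i)))"
      using s1[of i n] unfolding keep_a[of n i] \<tau>_def by metis
    show "a' n $ i = inverse (\<gamma> i (\<tau> i n)) *\<^sub>R (x (\<tau> i n) $ i - a n $ i)
        - (partial_gradient H \<Theta> i (x (\<tau> i n))
            + (\<Sum>k\<in>UNIV. adjoint_on (H i) (L k i) (v' (\<tau> i n) $ k)))"
      using s1[of i n] unfolding keep_a[of n i] keep_a'[of n i] \<tau>_def by metis
    show "b n $ k = prox (G k) (\<lambda>w. ereal (\<mu> k (\<rho> k n)) * g k w)
        (y (\<rho> k n) $ k + \<mu> k (\<rho> k n) *\<^sub>R
          (v' (\<rho> k n) $ k - gradient_on (G k) (\<psi> k) (y (\<rho> k n) $ k)))"
      using s3[of k n] unfolding keep_b[of n k] \<rho>_def by blast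
    show "d n $ k = prox (G k) (\<lambda>w. ereal (\<nu> k (\<rho> k n)) * h k w)
        (z (\<rho> k n) $ k + \<nu> k (\<rho> k n) *\<^sub>R (v' (\<rho> k n) $ k))"
      using s3[of k n] unfolding keep_d[of n k] \<rho>_def by blast
    show "e' n $ k = sigma k (\<rho> k n) *\<^sub>R
          ((\<Sum>i\<in>UNIV. L k i (x (\<rho> k n) $ i)) - y (\<rho> k n) $ k - z (\<rho> k n) $ k)
        + v' (\<rho> k n) $ k"
      using s3[of k n] unfolding keep_e'[of n k] \<rho>_def by blast
    show "q' n $ k = inverse (\<mu> k (\<rho> k n)) *\<^sub>R (y (\<rho> k n) $ k - b n $ k)
        + v' (\<rho> k n) $ k - e' n $ k"
      using s3[of k n] unfolding keep_q'[of n k] keep_b[of n k] keep_e'[of n k] \<rho>_def by blast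
    show "t' n $ k = inverse (\<nu> k (\<rho> k n)) *\<^sub>R (z (\<rho> k n) $ k - d n $ k)
        + v' (\<rho> k n) $ k - e' n $ k"
      using s3[of k n] unfolding keep_t'[of n k] keep_d[of n k] keep_e'[of n k] \<rho>_def by blast
    have "\<xi> i n = (norm (a n $ i - x (\<tau> i n) $ i))\<^sup>2" for i
      using s1[of i n] unfolding keep_\<xi>[of i n] keep_a[of n i] \<tau>_def by blast
    moreover have "\<eta> k n = (norm (b n $ k - y (\<rho> k n) $ k))\<^sup>2 + (norm (d n $ k - z (\<rho> k n) $ k))\<^sup>2" for k
      using s3[of k n] unfolding keep_\<eta>[of k n] keep_b[of n k] keep_d[of n k] \<rho>_def by blast
    ultimately show "\<Delta> n =
      - inverse (4 * alpha) * ((\<Sum>i\<in>UNIV. (norm (a n $ i - x (\<tau> i n) $ i))\<^sup>2)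
        + (\<Sum>k\<in>UNIV. (norm (b n $ k - y (\<rho> k n) $ k))\<^sup>2 + (norm (d n $ k - z (\<rho> k n) $ k))\<^sup>2))
      + (\<Sum>i\<in>UNIV. inner (x n $ i - a n $ i) (p' n $ i))
      + (\<Sum>k\<in>UNIV. inner (y n $ k - b n $ k) (q' n $ k)
          + inner (z n $ k - d n $ k) (t' n $ k)
          + inner (e n $ k) (v' n $ k - e' n $ k))"
      using step6[of n] by simp
  qed (fact \<sigma> \<epsilon>(1) \<gamma> \<mu> \<nu> sigma lam init step5 step7)+
  obtain xt vt where "xt \<in> hilbert_sum H" "vt \<in> hilbert_sum G" and kt: "\<forall>i k.
      - (\<Sum>j\<in>UNIV. adjoint_on (H i) (L j i) (vt $ j)) \<in>
          {u + gradient_on (H i) (\<phi> i) (xt $ i) + partial_gradient H \<Theta> i xt | u.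
            u \<in> subdifferential (H i) (f i) (xt $ i)} \<and>
      (\<Sum>j\<in>UNIV. L k j (xt $ j)) \<in>
          {u + w | u w.
            u \<in> subdifferential (G k)
              (inf_conv (G k) (conjugate (G k) (g k)) (conjugate (G k) (\<lambda>s. ereal (\<psi> k s))))
              (vt $ k) \<and>
            w \<in> subdifferential (G k) (conjugate (G k) (h k)) (vt $ k)}"
    using kuhn_tucker by (elim bexE) rule
  then have "cm.saddle.KT \<noteq> {}"
    using cm.KT_from_Kuhn_Tucker[OF _ _ kt[THEN spec, THEN spec, THEN conjunct1]
        kt[THEN spec, THEN spec, THEN conjunct2]] by blast
  then obtain u s where us: "(u, s) \<in> cm.saddle.KT"
    and conv: "converges_weakly cm.V di.w u" "converges_weakly cm.V di.aa u"
    using di.iterates_converge_weakly by blast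
  obtain xbar ybar zbar where u: "u = (xbar, ybar, zbar)" by (cases u)
  have "converges_weakly (H i) (\<lambda>n. fst (di.w n) $ i) (fst u $ i)"
    "converges_weakly (H i) (\<lambda>n. fst (di.aa n) $ i) (fst u $ i)" for i
    by (rule converges_weakly_component[OF H subspace_Times[OF cm.subGG cm.subGG]],
        fact conv[unfolded cm.V_def])+
  then have "converges_weakly (H i) (\<lambda>n. x n $ i) (xbar $ i) \<and> converges_weakly (H i) (\<lambda>n. a n $ i) (xbar $ i)" for i
    by (simp add: di.w_def di.aa_def u)
  with cm.KT_minimizer[OF us[unfolded u]] show ?thesis by blast
qed

end
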